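(* Let $b\in\mathbb{R}$ and let $\mu$ be a Borel measure on $(0,\infty)$ with $\bar\mu(x)<\infty$ for all $x>0$. Denote by $(\mathcal{A},\mathcal{D}(\mathcal{A}))$ the generator, with its domain, of the (Feller) $\mathrm{ESN}(b,\mu)$ process on $C_0([0,\infty))$. Set $$\mathcal{D}_0:=\{f\in C^{1,0}([0,\infty)):\ \exists\,\epsilon>0\text{ such that } f_{|[0,\epsilon]}\text{ is constant}\},$$ $$\mathcal{D}_1:=\Big\{f\in C^{1,0}([0,\infty)):\ f'(0)=0\ \text{ and }\ \int_0^1|f'(v)|\,\bar\mu(v)\,dv<\infty\Big\}.$$ Then $\mathcal{D}_0\subset\mathcal{D}_1\subset\mathcal{D}(\mathcal{A})$. Moreover, $\mathcal{A}$ acts on $f\in\mathcal{D}_1$ by $$\mathcal{A}f(x)=\int_x^\infty\big(f(y)-f(x)\big)\,\mu(dy)-bf'(x),\qquad x\ge0.$$ When $b>0$, $\mathcal{D}_0$ and $\mathcal{D}_1$ are cores for $\mathcal{A}$. When $b\le0$ and $\int_0^1\bar\mu(v)\,dv=\infty$, $\mathcal{D}_1$ is a core for $\mathcal{A}$.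
   Context: Write $(a)_+=\max(a,0)$ and $\bar\mu(x):=\mu([x,\infty))$ for $x>0$. In integrals $\int_a^\infty$ and $\int_a^b$ the lower endpoint $a$ is excluded. Extremal shot noise process $\mathrm{ESN}(b,\mu)$: let $\mathcal{N}=\sum_{s\ge0}\delta_{(s,\xi_s)}$ be a Poisson point process on $[0,\infty)\times(0,\infty)$ with intensity $\lambda\times\mu$, $\lambda$ being Lebesgue measure; set $\xi_s=0$ at times $s$ which carry no atom. The standard $\mathrm{ESN}(b,\mu)$ process (started from $0$) is $$M^0(t):=\sup_{0\le s\le t}\big(\xi_s-b(t-s)\big)_+,\qquad t\ge0.$$ The $\mathrm{ESN}(b,\mu)$ process started from $x\ge0$ is obtained by adjoining a point $(0,x)$ to $\mathcal{N}$, i.e. $M^x(t)=(x-bt)_+\vee M^0(t)$. Its law is $\mathbb{P}_x$ (expectation $\mathbb{E}_x$). This is a Markov process on $[0,\infty)$ with Feller semigroup $P_tf(x)=\mathbb{E}_x[f(M(t))]$ on $C_0([0,\infty))$, the space of continuous functions on $[0,\infty)$ vanishing at $\infty$ (with supremum norm). The generator is $\mathcal{A}f=\lim_{t\to0}(P_tf-f)/t$ (uniform limit), with domain $\mathcal{D}(\mathcal{A})$ the set of $f\in C_0([0,\infty))$ for which the limit exists in $C_0([0,\infty))$. A core for $\mathcal{A}$ is a subspace $\mathcal{D}\subset\mathcal{D}(\mathcal{A})$ such that $\mathcal{A}$ is the closure of its restriction to $\mathcal{D}$. $C^{1,0}([0,\infty))$ is the space of continuously differentiable functions on $[0,\infty)$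 vanishing at $\infty$ and whose derivative vanishes at $\infty$. *)

theory Defs
  imports "HOL-Probability.Probability"
begin

section \<open>Poisson point processes\<close>

text \<open>The law of \<open>N(B)\<close> is given by the explicit Poisson weights because \<^const>\<open>poisson_pmf\<close> is
  only specified for strictly positive rates; a set of intensity \<open>0\<close> is covered by \<open>0 ^ 0 = 1\<close>.\<close>

definition poisson_point_process ::
    "'w measure \<Rightarrow> 'e measure \<Rightarrow> ('w \<Rightarrow> 'e measure) \<Rightarrow> bool" where
  "poisson_point_process \<Omega> \<nu> N \<longleftrightarrow>
     (\<forall>\<omega>\<in>space \<Omega>. sets (N \<omega>) = sets \<nu>) \<and>
     (\<forall>B\<in>sets \<nu>. (\<lambda>\<omega>. emeasure (N \<omega>) B) \<in> borel_measurable \<Omega>) \<and>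
     (\<forall>B\<in>sets \<nu>. emeasure \<nu> B < \<infinity> \<longrightarrow>
        (\<forall>k::nat. measure \<Omega> {\<omega>\<in>space \<Omega>. emeasure (N \<omega>) B = of_nat k} =
           exp (- measure \<nu> B) * measure \<nu> B ^ k / fact k)) \<and>
     (\<forall>B\<in>sets \<nu>. emeasure \<nu> B = \<infinity> \<longrightarrow> (AE \<omega> in \<Omega>. emeasure (N \<omega>) B = \<infinity>)) \<and>
     (\<forall>(B :: nat \<Rightarrow> 'e set) I. finite I \<and> disjoint_family_on B I \<and> B ` I \<subseteq> sets \<nu> \<longrightarrow>
        prob_space.indep_vars \<Omega> (\<lambda>_. borel) (\<lambda>i \<omega>. emeasure (N \<omega>) (B i)) I)"


section \<open>The extremal shot noise process\<close>

text \<open>The point process \<open>\<N> = \<Sum>\<^sub>s \<delta>\<^bsub>(s, \<xi>\<^sub>s)\<^esub>\<close> is encoded by its family of marks \<open>\<xi>\<close>, where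
  \<open>\<xi>\<^sub>s = 0\<close> means that time \<open>s\<close> carries no atom. The associated point measure is the image of the
  counting measure on the set of atom times under \<open>s \<mapsto> (s, \<xi>\<^sub>s)\<close>.\<close>

definition esn_intensity :: "real measure \<Rightarrow> (real \<times> real) measure" where
  "esn_intensity \<mu> = restrict_space lborel {0..} \<Otimes>\<^sub>M \<mu>"

definition atom_measure :: "real measure \<Rightarrow> (real \<Rightarrow> real) \<Rightarrow> (real \<times> real) measure" where
  "atom_measure \<mu> \<xi> =
     distr (count_space {s. 0 \<le> s \<and> 0 < \<xi> s}) (esn_intensity \<mu>) (\<lambda>s. (s, \<xi> s))"

definition esn_noise :: "'w measure \<Rightarrow> real measure \<Rightarrow> ('w \<Rightarrow> real \<Rightarrow> real) \<Rightarrow> bool" where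
  "esn_noise \<Omega> \<mu> \<xi> \<longleftrightarrow>
     (\<forall>\<omega>\<in>space \<Omega>. \<forall>s\<ge>0. 0 \<le> \<xi> \<omega> s) \<and>
     poisson_point_process \<Omega> (esn_intensity \<mu>) (\<lambda>\<omega>. atom_measure \<mu> (\<xi> \<omega>))"

text \<open>When \<open>\<mu>[x,\<infinity>) < \<infinity>\<close> for all \<open>x > 0\<close>, the supremum is over a bounded set for almost every
  realisation of the marks; the real \<^const>\<open>Sup\<close> takes an unspecified value on the exceptional null set.\<close>

definition esn0 :: "real \<Rightarrow> (real \<Rightarrow> real) \<Rightarrow> real \<Rightarrow> real" where
  "esn0 b \<xi> t = (SUP s\<in>{0..t}. max (\<xi> s - b * (t - s)) 0)"

definition esn :: "real \<Rightarrow> (real \<Rightarrow> real) \<Rightarrow> real \<Rightarrow> real \<Rightarrow> real" where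
  "esn b \<xi> x t = max (max (x - b * t) 0) (esn0 b \<xi> t)"

definition esn_semigroup ::
    "'w measure \<Rightarrow> real \<Rightarrow> ('w \<Rightarrow> real \<Rightarrow> real) \<Rightarrow> real \<Rightarrow> (real \<Rightarrow> real) \<Rightarrow> (real \<Rightarrow> real)" where
  "esn_semigroup \<Omega> b \<xi> t f = (\<lambda>x\<in>{0..}. \<integral>\<omega>. f (esn b (\<xi> \<omega>) x t) \<partial>\<Omega>)"


section \<open>Function spaces on the half-line\<close>

text \<open>As in \<^const>\<open>cfunspace\<close>, functions on \<open>[0,\<infinity>)\<close> are represented extensionally, so that elements
  of \<open>C0\<close> correspond bijectively to functions on \<open>[0,\<infinity>)\<close>.\<close>

definition C0 :: "(real \<Rightarrow> real) set" where
  "C0 = {f \<in> extensional {0..}. continuous_on {0..} f \<and> (f \<longlongrightarrow> 0) at_top}"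

definition C0_topology :: "(real \<Rightarrow> real) topology" where
  "C0_topology =
     mtopology_of (submetric (cfunspace (top_of_set {0::real..}) euclidean_metric) C0)"

text \<open>The derivative on \<open>[0,\<infinity>)\<close>, one-sided at \<open>0\<close>.\<close>

definition hderiv :: "(real \<Rightarrow> real) \<Rightarrow> real \<Rightarrow> real" where
  "hderiv f x = vector_derivative f (at x within {0..})"

definition C10 :: "(real \<Rightarrow> real) set" where
  "C10 = {f \<in> C0. f differentiable_on {0..} \<and> continuous_on {0..} (hderiv f) \<and>
                  (hderiv f \<longlongrightarrow> 0) at_top}"

definition D0 :: "(real \<Rightarrow> real) set" where
  "D0 = {f \<in> C10. \<exists>\<epsilon>>0. f constant_on {0..\<epsilon>}}"

definition D1 :: "real measure \<Rightarrow> (real \<Rightarrow> real) set" where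
  "D1 \<mu> = {f \<in> C10. hderiv f 0 = 0 \<and>
             (\<integral>\<^sup>+v\<in>{0<..1}. ennreal \<bar>hderiv f v\<bar> * emeasure \<mu> {v..} \<partial>lborel) < \<infinity>}"


section \<open>Generators and cores\<close>

definition is_generator_value ::
    "(real \<Rightarrow> (real \<Rightarrow> real) \<Rightarrow> (real \<Rightarrow> real)) \<Rightarrow> (real \<Rightarrow> real) \<Rightarrow> (real \<Rightarrow> real) \<Rightarrow> bool" where
  "is_generator_value P f g \<longleftrightarrow>
     g \<in> C0 \<and> uniform_limit {0..} (\<lambda>t x. (P t f x - f x) / t) g (at_right 0)"

definition gen_domain :: "(real \<Rightarrow> (real \<Rightarrow> real) \<Rightarrow> (real \<Rightarrow> real)) \<Rightarrow> (real \<Rightarrow> real) set" where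
  "gen_domain P = {f \<in> C0. \<exists>g. is_generator_value P f g}"

definition generator ::
    "(real \<Rightarrow> (real \<Rightarrow> real) \<Rightarrow> (real \<Rightarrow> real)) \<Rightarrow> (real \<Rightarrow> real) \<Rightarrow> (real \<Rightarrow> real)" where
  "generator P f = (THE g. is_generator_value P f g)"

definition gen_graph ::
    "(real \<Rightarrow> (real \<Rightarrow> real) \<Rightarrow> (real \<Rightarrow> real)) \<Rightarrow> (real \<Rightarrow> real) set \<Rightarrow>
     ((real \<Rightarrow> real) \<times> (real \<Rightarrow> real)) set" where
  "gen_graph P D = (\<lambda>f. (f, generator P f)) ` D"

definition linear_subspace_C0 :: "(real \<Rightarrow> real) set \<Rightarrow> bool" where
  "linear_subspace_C0 D \<longleftrightarrow> D \<subseteq> C0 \<and> (\<lambda>x\<in>{0..}. 0) \<in> D \<and>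
     (\<forall>f\<in>D. \<forall>g\<in>D. \<forall>a c. (\<lambda>x\<in>{0..}. a * f x + c * g x) \<in> D)"

text \<open>The closure of an operator is the operator whose graph is the closure of its graph.\<close>

definition is_core ::
    "(real \<Rightarrow> (real \<Rightarrow> real) \<Rightarrow> (real \<Rightarrow> real)) \<Rightarrow> (real \<Rightarrow> real) set \<Rightarrow> bool" where
  "is_core P D \<longleftrightarrow> linear_subspace_C0 D \<and> D \<subseteq> gen_domain P \<and>
     prod_topology C0_topology C0_topology closure_of gen_graph P D = gen_graph P (gen_domain P)"

end

theory Submission
  imports Defs
begin

text \<open>
  Why the theorem is true. Call \<open>prim g\<close> the primitive, vanishing at \<open>\<infinity>\<close>, of a continuous
  function \<open>g\<close> whose support is a compact subset of \<open>(0,\<infinity>)\<close>. Such primitives lie in \<open>D0\<close>, and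
  they are good enough to carry the whole argument.

  \<^emph>\<open>The semigroup.\<close> For \<open>y \<ge> max 0 (- b t)\<close>, the event \<open>M\<^sup>0(t) \<le> y\<close> says that the Poisson
  process has no atom above the line \<open>s \<mapsto> y + b (t - s)\<close>, so its probability is \<open>exp (- \<integral>\<^sub>0\<^sup>t \<mu>(y + b u, \<infinity>) du)\<close>. This one formula
  yields the semigroup property (the exponents add up, and a law on the line is determined by its
  distribution function), strong continuity, and the generator: for \<open>f = prim g\<close>,
  \<open>P\<^sub>t f (x) = f (x - b t) + \<integral> g(v) P(M\<^sup>0(t) > v) dv\<close> over \<open>v \<ge> x - b t\<close>, and \<open>P(M\<^sup>0(t) > v) / t\<close> tends
  to \<open>\<mu>[v,\<infinity>)\<close> in \<open>L\<^sup>1\<close> of the support of \<open>g\<close>. Hence \<open>generator_prim\<close>: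
  \<open>A f (x) = \<integral>\<^sub>x\<^sup>\<infinity> g(v) \<mu>[v,\<infinity>) dv - b g(x)\<close>, which is the formula of the theorem integrated by parts.

  \<^emph>\<open>From primitives to D1.\<close> The operator of the theorem satisfies
  \<open>\<parallel>A f\<parallel> \<le> 2 \<mu>[1,\<infinity>) \<parallel>f\<parallel> + \<integral>\<^sub>0\<^sup>1 |f'(v)| \<mu>[v,\<infinity>) dv + |b| \<parallel>f'\<parallel>\<close> (\<open>jump_bound\<close>), and every \<open>f\<close> in \<open>D1\<close>
  is a limit of primitives for the three quantities on the right (\<open>D1_approx\<close>). As generators of
  strongly continuous contraction semigroups are closed (\<open>generator_closed\<close>), \<open>D1\<close> lies in the domain
  and \<open>A\<close> acts on it as claimed.

  \<^emph>\<open>Cores.\<close> A generator is dissipative: \<open>\<parallel>f\<parallel> \<le> \<parallel>f - A f\<parallel>\<close>. So a subspace of the domain is a core as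
  soon as its image under \<open>1 - A\<close> is dense, and the point is that primitives already achieve this
  (\<open>range_dense\<close>). Let \<open>h\<close> itself be a primitive. Solving \<open>prim g - A (prim g) = h\<close> amounts to the
  linear equation \<open>b g' + (1 + \<mu>[v,\<infinity>)) g = h'\<close>. With the integrating factor \<open>e\<^sup>Q\<close>,
  \<open>Q' = (1 + \<mu>[v,\<infinity>)) / b\<close>, it has a solution with compact support in \<open>(0,\<infinity>)\<close> exactly when \<open>\<integral> h' e\<^sup>Q = 0\<close>. This linear constraint defines a dense
  set of \<open>h\<close> because \<open>e\<^sup>Q\<close> is unbounded: near \<open>\<infinity>\<close> when \<open>b > 0\<close>, and near \<open>0\<close> when \<open>b < 0\<close> and
  \<open>\<integral>\<^sub>0\<^sup>1 \<mu>[v,\<infinity>) dv = \<infinity>\<close>. A bump of tiny mass placed where \<open>e\<^sup>Q\<close> is huge corrects the integral. For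
  \<open>b = 0\<close> one just divides \<open>h'\<close> by \<open>1 + \<mu>[v,\<infinity>)\<close>. In all cases \<open>1 + \<mu>[v,\<infinity>)\<close> must first be replaced by a
  continuous function that is close to it in \<open>L\<^sup>1\<close>, as \<open>\<mu>\<close> may have atoms.
\<close>

section \<open>The space C0\<close>

lemma C0_bounded:
  assumes "f \<in> C0"
  obtains B where "B \<ge> 0" "\<And>x. x \<ge> 0 \<Longrightarrow> \<bar>f x\<bar> \<le> B"
proof -
  have c: "continuous_on {0..} f" and l: "(f \<longlongrightarrow> 0) at_top" using assms by (auto simp: C0_def)
  have "eventually (\<lambda>x. \<bar>f x\<bar> < 1) at_top"
    using tendstoD[OF l, of 1] by (simp add: dist_real_def)
  then obtain R where R: "\<And>x. x \<ge> R \<Longrightarrow> \<bar>f x\<bar> < 1" by (auto simp: eventually_at_top_linorder)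
  have "compact (f ` {0..max R 0})"
    by (intro compact_continuous_image continuous_on_subset[OF c]) auto
  then obtain B where B: "\<And>x. x \<in> {0..max R 0} \<Longrightarrow> \<bar>f x\<bar> \<le> B"
    using compact_imp_bounded bounded_real by (metis (no_types, lifting) imageI)
  have "\<bar>f x\<bar> \<le> max 1 B" if "x \<ge> 0" for x
    using R[of x] B[of x] that by (cases "x \<ge> R") auto
  then show ?thesis using that[of "max 1 B"] by auto
qed

text \<open>Continuous functions are uniformly continuous on compact intervals, and far out an element of
  \<open>C0\<close> varies little because it is small.\<close>

lemma C0_uniformly_continuous:
  assumes "f \<in> C0" "e > 0"
  obtains d where "d > 0" "\<And>x y. x \<ge> 0 \<Longrightarrow> y \<ge> 0 \<Longrightarrow> \<bar>x - y\<bar> \<le> d \<Longrightarrow> \<bar>f x - f y\<bar> \<le> e"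
proof -
  have c: "continuous_on {0..} f" and l: "(f \<longlongrightarrow> 0) at_top" using assms by (auto simp: C0_def)
  have "eventually (\<lambda>x. \<bar>f x\<bar> < e/2) at_top"
    using tendstoD[OF l, of "e/2"] assms by (simp add: dist_real_def)
  then obtain R where R: "\<And>x. x \<ge> R \<Longrightarrow> \<bar>f x\<bar> < e/2" by (auto simp: eventually_at_top_linorder)
  have "uniformly_continuous_on {0..max R 0 + 1} f"
    by (intro compact_uniformly_continuous continuous_on_subset[OF c]) auto
  then obtain d where d: "d > 0" "\<And>x y. x \<in> {0..max R 0 + 1} \<Longrightarrow> y \<in> {0..max R 0 + 1} \<Longrightarrow> dist x y < d \<Longrightarrow> dist (f x) (f y) < e"
    unfolding uniformly_continuous_on_def using assms(2) by metis
  show ?thesis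
  proof (rule that[of "min (d/2) 1"])
    show "min (d/2) 1 > 0" using d by auto
    fix x y :: real assume xy: "x \<ge> 0" "y \<ge> 0" "\<bar>x - y\<bar> \<le> min (d/2) 1"
    show "\<bar>f x - f y\<bar> \<le> e"
    proof (cases "x \<ge> R \<and> y \<ge> R")
      case True
      then show ?thesis using R[of x] R[of y] by auto
    next
      case False
      then have "x \<in> {0..max R 0 + 1}" "y \<in> {0..max R 0 + 1}" using xy by auto
      then show ?thesis using d(2)[of x y] xy d(1) by (auto simp: dist_real_def)
    qed
  qed
qed

lemma C0_linear:
  assumes "f \<in> C0" "g \<in> C0"
  shows "(\<lambda>x\<in>{0..}. a * f x + c * g x) \<in> C0"
proof -
  have "continuous_on {0..} (\<lambda>x. a * f x + c * g x)"
    using assms by (auto simp: C0_def intro!: continuous_intros)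
  then have "continuous_on {0..} (\<lambda>x\<in>{0..}. a * f x + c * g x)"
    by (rule continuous_on_eq) auto
  moreover have "((\<lambda>x. a * f x + c * g x) \<longlongrightarrow> a * 0 + c * 0) at_top"
    using assms unfolding C0_def by (intro tendsto_intros) auto
  then have "((\<lambda>x\<in>{0..}. a * f x + c * g x) \<longlongrightarrow> 0) at_top"
    by (subst tendsto_cong[of _ "\<lambda>x. a * f x + c * g x"])
       (auto intro!: eventually_mono[OF eventually_ge_at_top[of 0]])
  ultimately show ?thesis by (auto simp: C0_def)
qed

lemma C0_ext:
  assumes "f \<in> C0" "g \<in> C0" "\<And>x. x \<ge> 0 \<Longrightarrow> f x = g x"
  shows "f = g"
  using assms by (auto simp: C0_def intro!: extensionalityI[of f "{0..}" g])

lemma C0_uniform_closed: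
  assumes ext: "f \<in> extensional {0..}"
    and approx: "\<And>e. e > 0 \<Longrightarrow> \<exists>g\<in>C0. \<forall>x\<ge>0. \<bar>f x - g x\<bar> \<le> e"
  shows "f \<in> C0"
proof -
  have "\<exists>g. g \<in> C0 \<and> (\<forall>x\<ge>0. \<bar>f x - g x\<bar> \<le> inverse (Suc n))" for n
    using approx[of "inverse (Suc n)"] by fastforce
  then obtain g where g: "\<And>n. g n \<in> C0" "\<And>n x. x \<ge> 0 \<Longrightarrow> \<bar>f x - g n x\<bar> \<le> inverse (Suc n)"
    by metis
  have ul: "uniform_limit {0..} g f sequentially"
  proof (rule uniform_limitI)
    fix e :: real assume "e > 0"
    then obtain N where N: "inverse (Suc N) < e" using reals_Archimedean by blast
    have "dist (g n x) (f x) < e" if "n \<ge> N" "x \<ge> 0" for n x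
    proof -
      have "inverse (real (Suc n)) \<le> inverse (real (Suc N))" using that by simp
      moreover have "\<bar>f x - g n x\<bar> \<le> inverse (real (Suc n))" by (rule g(2)) (use that in auto)
      ultimately show ?thesis using N unfolding dist_real_def by linarith
    qed
    then show "\<forall>\<^sub>F n in sequentially. \<forall>x\<in>{0..}. dist (g n x) (f x) < e"
      by (auto simp: eventually_sequentially)
  qed
  have "continuous_on {0..} f"
    by (rule uniform_limit_theorem[OF _ ul]) (use g in \<open>auto simp: C0_def\<close>)
  moreover have "(f \<longlongrightarrow> 0) at_top"
  proof (rule tendstoI)
    fix e :: real assume "e > 0"
    then obtain n where n: "inverse (Suc n) < e/2" using reals_Archimedean[of "e/2"] by auto
    have "(g n \<longlongrightarrow> 0) at_top" using g(1)[of n] by (auto simp: C0_def)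
    then have "eventually (\<lambda>x. \<bar>g n x\<bar> < e/2) at_top"
      using tendstoD[of "g n" 0 at_top "e/2"] \<open>e > 0\<close> by (simp add: dist_real_def)
    then show "\<forall>\<^sub>F x in at_top. dist (f x) 0 < e"
      using eventually_ge_at_top[of 0]
    proof eventually_elim
      case (elim x)
      then show ?case using g(2)[of x n] n by (auto simp: dist_real_def)
    qed
  qed
  ultimately show ?thesis using ext by (auto simp: C0_def)
qed

section \<open>Generators of contraction semigroups on C0\<close>

text \<open>All estimates below are explicit bounds for the difference quotient, so the uniform limit is
  used in this form.\<close>

lemma is_generator_value_iff:
  "is_generator_value P f g \<longleftrightarrow> g \<in> C0 \<and>
     (\<forall>e>0. \<exists>d>0. \<forall>t. 0 < t \<and> t < d \<longrightarrow> (\<forall>x\<ge>0. \<bar>(P t f x - f x) / t - g x\<bar> \<le> e))"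
proof -
  have "uniform_limit {0..} (\<lambda>t x. (P t f x - f x) / t) g (at_right 0) \<longleftrightarrow>
     (\<forall>e>0. \<exists>d>0. \<forall>t. 0 < t \<and> t < d \<longrightarrow> (\<forall>x\<ge>0. \<bar>(P t f x - f x) / t - g x\<bar> \<le> e))" (is "?l \<longleftrightarrow> ?r")
  proof
    assume ?l
    show ?r
    proof (intro allI impI)
      fix e :: real assume "e > 0"
      then have "\<forall>\<^sub>F t in at_right 0. \<forall>x\<in>{0..}. dist ((P t f x - f x) / t) (g x) < e"
        using \<open>?l\<close> by (auto simp: uniform_limit_iff)
      then obtain d where "d > 0" "\<forall>t. 0 < t \<and> t < d \<longrightarrow> (\<forall>x\<in>{0..}. dist ((P t f x - f x) / t) (g x) < e)"
        by (auto simp: eventually_at_right[OF zero_less_one])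
      then show "\<exists>d>0. \<forall>t. 0 < t \<and> t < d \<longrightarrow> (\<forall>x\<ge>0. \<bar>(P t f x - f x) / t - g x\<bar> \<le> e)"
        by (intro exI[of _ d]) (force simp: dist_real_def)
    qed
  next
    assume r: ?r
    show ?l
    proof (rule uniform_limitI)
      fix e :: real assume "e > 0"
      then obtain d where d: "d > 0" "\<And>t x. 0 < t \<Longrightarrow> t < d \<Longrightarrow> x \<ge> 0 \<Longrightarrow> \<bar>(P t f x - f x) / t - g x\<bar> \<le> e/2"
        using r[rule_format, of "e/2"] by auto
      show "\<forall>\<^sub>F t in at_right 0. \<forall>x\<in>{0..}. dist ((P t f x - f x) / t) (g x) < e"
        unfolding eventually_at_right[OF zero_less_one]
      proof (intro exI[of _ d] conjI allI impI ballI)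
        fix t x :: real assume "0 < t" "t < d" "x \<in> {0..}"
        then show "dist ((P t f x - f x) / t) (g x) < e"
          using d(2)[of t x] \<open>e > 0\<close> by (auto simp: dist_real_def)
      qed (use d in auto)
    qed
  qed
  then show ?thesis by (simp add: is_generator_value_def)
qed

lemma generator_value_unique:
  assumes "is_generator_value P f g" "is_generator_value P f h"
  shows "g = h"
proof (rule C0_ext)
  show "g \<in> C0" "h \<in> C0" using assms by (auto simp: is_generator_value_def)
  fix x :: real assume x: "x \<ge> 0"
  have "((\<lambda>t. (P t f x - f x) / t) \<longlongrightarrow> g x) (at_right 0)" "((\<lambda>t. (P t f x - f x) / t) \<longlongrightarrow> h x) (at_right 0)"
    using assms x unfolding is_generator_value_def by (auto intro: tendsto_uniform_limitI)
  then show "g x = h x" using tendsto_unique[of "at_right (0::real)"] by auto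
qed

lemma generator_eqI: "is_generator_value P f g \<Longrightarrow> generator P f = g"
  unfolding generator_def by (blast intro: the_equality generator_value_unique)

lemma generator_value:
  "f \<in> gen_domain P \<Longrightarrow> is_generator_value P f (generator P f)"
  by (auto simp: gen_domain_def generator_eqI)

lemma mult_abs_quotient:
  assumes "(t::real) > 0"
  shows "t * \<bar>a / t - h\<bar> = \<bar>a - t * h\<bar>"
proof -
  have "t * \<bar>a / t - h\<bar> = \<bar>t * (a / t - h)\<bar>" using assms by (simp add: abs_mult)
  also have "t * (a / t - h) = a - t * h" using assms by (simp only: right_diff_distrib) simp
  finally show ?thesis .
qed

locale C0_contraction_semigroup =
  fixes P :: "real \<Rightarrow> (real \<Rightarrow> real) \<Rightarrow> (real \<Rightarrow> real)"
  assumes maps_C0: "f \<in> C0 \<Longrightarrow> 0 \<le> t \<Longrightarrow> P t f \<in> C0"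
    and linear: "f \<in> C0 \<Longrightarrow> g \<in> C0 \<Longrightarrow> 0 \<le> t \<Longrightarrow> 0 \<le> x \<Longrightarrow>
      P t (\<lambda>x\<in>{0..}. a * f x + c * g x) x = a * P t f x + c * P t g x"
    and contraction: "f \<in> C0 \<Longrightarrow> 0 \<le> t \<Longrightarrow> (\<And>x. x \<ge> 0 \<Longrightarrow> \<bar>f x\<bar> \<le> B) \<Longrightarrow> 0 \<le> x \<Longrightarrow> \<bar>P t f x\<bar> \<le> B"
    and at_0: "f \<in> C0 \<Longrightarrow> P 0 f = f"
    and semigroup: "f \<in> C0 \<Longrightarrow> 0 \<le> s \<Longrightarrow> 0 \<le> t \<Longrightarrow> P (s + t) f = P s (P t f)"
    and strongly_continuous: "f \<in> C0 \<Longrightarrow> 0 < e \<Longrightarrow>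
      \<exists>d>0. \<forall>t. 0 \<le> t \<and> t \<le> d \<longrightarrow> (\<forall>x\<ge>0. \<bar>P t f x - f x\<bar> \<le> e)"
begin

text \<open>Telescoping along a grid of mesh \<open>d\<close>: each increment \<open>P\<^bsub>(k+1)d\<^esub> f - P\<^bsub>kd\<^esub> f\<close> is the contraction
  \<open>P\<^bsub>kd\<^esub>\<close> applied to \<open>P\<^sub>d f - f\<close>, which replaces the Banach space valued integral in
  \<open>P\<^sub>t f - f = \<integral>\<^sub>0\<^sup>t P\<^sub>s A f ds\<close>.\<close>

lemma increment_bound:
  assumes f: "f \<in> C0" and h: "h \<in> C0" and d: "0 \<le> d"
    and step: "\<And>x. x \<ge> 0 \<Longrightarrow> \<bar>P d f x - f x - d * h x\<bar> \<le> d * e1"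
    and osc: "\<And>k x. k < n \<Longrightarrow> x \<ge> 0 \<Longrightarrow> \<bar>P (real k * d) h x - h x\<bar> \<le> e2"
    and "k \<le> n" "x \<ge> 0"
  shows "\<bar>P (real k * d) f x - f x - real k * d * h x\<bar> \<le> real k * d * (e1 + e2)"
  using assms(6,7)
proof (induction k)
  case 0
  then show ?case using f by (simp add: at_0)
next
  case (Suc k)
  define u where "u = (\<lambda>x\<in>{0..}. 1 * P d f x + (-1) * f x)"
  define v where "v = (\<lambda>x\<in>{0..}. 1 * u x + (-d) * h x)"
  have u: "u \<in> C0" unfolding u_def by (intro C0_linear maps_C0 f d)
  have v: "v \<in> C0" unfolding v_def by (intro C0_linear u h)
  have kd: "0 \<le> real k * d" using d by simp
  have Pv: "P (real k * d) v x = P (real k * d + d) f x - P (real k * d) f x - d * P (real k * d) h x"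
    unfolding v_def linear[OF u h kd \<open>x \<ge> 0\<close>]
    unfolding u_def linear[OF maps_C0[OF f d] f kd \<open>x \<ge> 0\<close>] semigroup[OF f kd d] by simp
  have 1: "\<bar>P (real k * d) v x\<bar> \<le> d * e1"
    by (rule contraction[OF v kd]) (use step Suc.prems in \<open>auto simp: v_def u_def\<close>)
  have 2: "\<bar>P (real k * d) f x - f x - real k * d * h x\<bar> \<le> real k * d * (e1 + e2)" using Suc by simp
  have 3: "\<bar>d * (P (real k * d) h x - h x)\<bar> \<le> d * e2"
    using osc[of k x] Suc.prems d by (simp add: abs_mult mult_left_mono)
  have "P (real (Suc k) * d) f x - f x - real (Suc k) * d * h x
     = P (real k * d) v x + (P (real k * d) f x - f x - real k * d * h x) + d * (P (real k * d) h x - h x)"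
    unfolding Pv by (simp add: algebra_simps)
  then have "\<bar>P (real (Suc k) * d) f x - f x - real (Suc k) * d * h x\<bar> \<le> d * e1 + real k * d * (e1 + e2) + d * e2"
    using 1 2 3 by linarith
  then show ?case by (simp add: algebra_simps)
qed

text \<open>As the mesh tends to \<open>0\<close>, the first error of \<open>increment_bound\<close> becomes the distance of \<open>h\<close> to the
  value \<open>g\<close> of the generator. The resulting bound no longer involves how fast the difference quotients
  of \<open>f\<close> converge, so it survives a limit in \<open>f\<close>.\<close>

lemma difference_quotient_bound:
  assumes f: "is_generator_value P f g" "f \<in> C0" and h: "h \<in> C0"
    and gh: "\<And>x. x \<ge> 0 \<Longrightarrow> \<bar>g x - h x\<bar> \<le> e1"
    and t: "0 < t" and osc: "\<And>s x. 0 \<le> s \<Longrightarrow> s \<le> t \<Longrightarrow> x \<ge> 0 \<Longrightarrow> \<bar>P s h x - h x\<bar> \<le> e2"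
    and x: "x \<ge> 0"
  shows "\<bar>(P t f x - f x) / t - h x\<bar> \<le> e1 + e2"
proof (rule field_le_epsilon)
  fix e :: real assume "e > 0"
  then obtain d where d: "d > 0" "\<And>t x. 0 < t \<Longrightarrow> t < d \<Longrightarrow> x \<ge> 0 \<Longrightarrow> \<bar>(P t f x - f x) / t - g x\<bar> \<le> e"
    using f(1) unfolding is_generator_value_iff by meson
  obtain n :: nat where n: "real n > t / d" using reals_Archimedean2 by blast
  have n0: "real n > 0" using n t d by (meson divide_pos_pos less_trans)
  define r where "r = t / real n"
  have r: "0 < r" "r < d" "real n * r = t" using n n0 t d by (auto simp: r_def field_simps)
  have step: "\<bar>P r f y - f y - r * h y\<bar> \<le> r * (e + e1)" if "y \<ge> 0" for y
  proof -
    have "\<bar>(P r f y - f y) / r - h y\<bar> \<le> e + e1" using d(2)[OF r(1,2) that] gh[OF that] by linarith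
    then have "r * \<bar>(P r f y - f y) / r - h y\<bar> \<le> r * (e + e1)" using r by (intro mult_left_mono) auto
    moreover have "r * \<bar>(P r f y - f y) / r - h y\<bar> = \<bar>P r f y - f y - r * h y\<bar>"
      by (rule mult_abs_quotient[OF r(1)])
    ultimately show ?thesis by simp
  qed
  have "\<bar>P (real n * r) f x - f x - real n * r * h x\<bar> \<le> real n * r * ((e + e1) + e2)"
  proof (rule increment_bound[OF f(2) h _ step _ le_refl x])
    fix k y assume "k < n" "(y::real) \<ge> 0"
    then show "\<bar>P (real k * r) h y - h y\<bar> \<le> e2"
      using r by (intro osc) (auto simp flip: r(3))
  qed (use r in auto)
  then have "\<bar>P t f x - f x - t * h x\<bar> \<le> t * (e1 + e2 + e)" unfolding r(3) by (simp add: algebra_simps)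
  moreover have "t * \<bar>(P t f x - f x) / t - h x\<bar> = \<bar>P t f x - f x - t * h x\<bar>"
    by (rule mult_abs_quotient[OF t])
  ultimately show "\<bar>(P t f x - f x) / t - h x\<bar> \<le> e1 + e2 + e" using t by (metis mult_le_cancel_left_pos)
qed

text \<open>Closedness of the generator: apply \<open>difference_quotient_bound\<close> to the approximants with \<open>h\<close> in
  the role of the target, and let them converge for fixed \<open>t\<close>.\<close>

lemma generator_closed:
  assumes f: "f \<in> C0" and h: "h \<in> C0"
    and approx: "\<And>e. e > 0 \<Longrightarrow> \<exists>f' g'. f' \<in> C0 \<and> is_generator_value P f' g' \<and>
       (\<forall>x\<ge>0. \<bar>f' x - f x\<bar> \<le> e) \<and> (\<forall>x\<ge>0. \<bar>g' x - h x\<bar> \<le> e)"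
  shows "is_generator_value P f h"
  unfolding is_generator_value_iff
proof (intro conjI h allI impI)
  fix e :: real assume e: "e > 0"
  obtain d where d: "d > 0" "\<And>t x. 0 \<le> t \<Longrightarrow> t \<le> d \<Longrightarrow> x \<ge> 0 \<Longrightarrow> \<bar>P t h x - h x\<bar> \<le> e"
    using strongly_continuous[OF h e] by auto
  have "\<bar>(P t f x - f x) / t - h x\<bar> \<le> e" if t: "0 < t" "t < d" and x: "x \<ge> 0" for t x
  proof (rule field_le_epsilon)
    fix r :: real assume r: "r > 0"
    define q where "q = min (r / 2) (r * t / 4)"
    have q: "q > 0" "q \<le> r / 2" "q * (2 / t) \<le> r / 2" using r t by (auto simp: q_def min_def field_simps)
    obtain f' g' where fg: "f' \<in> C0" "is_generator_value P f' g'" "\<And>x. x \<ge> 0 \<Longrightarrow> \<bar>f' x - f x\<bar> \<le> q" "\<And>x. x \<ge> 0 \<Longrightarrow> \<bar>g' x - h x\<bar> \<le> q"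
      using approx[OF q(1)] by blast
    have 1: "\<bar>(P t f' x - f' x) / t - h x\<bar> \<le> q + e"
      by (rule difference_quotient_bound[OF fg(2,1) h fg(4) t(1) d(2) x]) (use t in auto)
    have dC: "(\<lambda>x\<in>{0..}. 1 * f' x + (-1) * f x) \<in> C0" by (intro C0_linear fg f)
    have "\<bar>P t (\<lambda>x\<in>{0..}. 1 * f' x + (-1) * f x) x\<bar> \<le> q"
      by (rule contraction[OF dC]) (use fg t x in auto)
    then have 2: "\<bar>P t f' x - P t f x\<bar> \<le> q"
      using t x by (subst (asm) linear[OF fg(1) f]) auto
    have "\<bar>(P t f x - f x) / t - (P t f' x - f' x) / t\<bar> = \<bar>(P t f x - P t f' x) - (f x - f' x)\<bar> / t"
      using t by (simp add: diff_divide_distrib[symmetric] abs_divide algebra_simps)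
    also have "\<dots> \<le> (2 * q) / t" using 2 fg(3)[OF x] t by (intro divide_right_mono) auto
    also have "\<dots> \<le> r / 2" using q(3) by (simp add: mult.commute)
    finally show "\<bar>(P t f x - f x) / t - h x\<bar> \<le> e + r" using 1 q(2) by linarith
  qed
  then show "\<exists>d>0. \<forall>t. 0 < t \<and> t < d \<longrightarrow> (\<forall>x\<ge>0. \<bar>(P t f x - f x) / t - h x\<bar> \<le> e)" using d(1) by auto
qed

lemma generator_value_linear:
  assumes "is_generator_value P f g" "is_generator_value P f' g'" "f \<in> C0" "f' \<in> C0"
  shows "is_generator_value P (\<lambda>x\<in>{0..}. a * f x + c * f' x) (\<lambda>x\<in>{0..}. a * g x + c * g' x)"
proof -
  have g: "g \<in> C0" "g' \<in> C0" using assms by (auto simp: is_generator_value_def)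
  have "uniform_limit {0..} (\<lambda>t x. a * ((P t f x - f x) / t) + c * ((P t f' x - f' x) / t)) (\<lambda>x. a * g x + c * g' x) (at_right 0)"
    using assms unfolding is_generator_value_def
    by (intro uniform_limit_add bounded_linear.uniform_limit[OF bounded_linear_mult_right]) auto
  moreover have "(P t (\<lambda>x\<in>{0..}. a * f x + c * f' x) x - (\<lambda>x\<in>{0..}. a * f x + c * f' x) x) / t
     = a * ((P t f x - f x) / t) + c * ((P t f' x - f' x) / t)" if "0 < t" "x \<ge> 0" for t x
    using that linear[OF assms(3,4), of t x a c] by (simp add: field_simps)
  ultimately have "uniform_limit {0..} (\<lambda>t x. (P t (\<lambda>x\<in>{0..}. a * f x + c * f' x) x - (\<lambda>x\<in>{0..}. a * f x + c * f' x) x) / t)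
      (\<lambda>x\<in>{0..}. a * g x + c * g' x) (at_right 0)"
    by (subst uniform_limit_cong[where g="\<lambda>t x. a * ((P t f x - f x) / t) + c * ((P t f' x - f' x) / t)" and i="\<lambda>x. a * g x + c * g' x"])
       (auto intro!: eventually_mono[OF eventually_at_right_less[of 0]])
  then show ?thesis using C0_linear[OF g] by (auto simp: is_generator_value_def)
qed

text \<open>From \<open>(1 + 1/t) d = (d - (P\<^sub>t d - d) / t) + P\<^sub>t d / t\<close> and contractivity, the supremum \<open>S\<close> of
  \<open>\<bar>d\<bar>\<close> satisfies \<open>(1 + 1/t) S \<le> (e + r) + S / t\<close> with \<open>r\<close> small as \<open>t\<close> tends to \<open>0\<close>.\<close>

lemma dissipative:
  assumes d: "d \<in> C0" "is_generator_value P d g"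
    and bd: "\<And>x. x \<ge> 0 \<Longrightarrow> \<bar>d x - g x\<bar> \<le> e" and x: "x \<ge> 0"
  shows "\<bar>d x\<bar> \<le> e"
proof -
  define S where "S = (SUP x\<in>{0..}. \<bar>d x\<bar>)"
  obtain B where B: "\<And>x. x \<ge> 0 \<Longrightarrow> \<bar>d x\<bar> \<le> B" using C0_bounded[OF d(1)] by metis
  have bdd: "bdd_above ((\<lambda>x. \<bar>d x\<bar>) ` {0..})" using B by (intro bdd_aboveI[of _ B]) auto
  have leS: "\<bar>d y\<bar> \<le> S" if "y \<ge> 0" for y unfolding S_def using that by (intro cSUP_upper bdd) auto
  have "S \<le> e"
  proof (rule field_le_epsilon)
    fix r :: real assume "r > 0"
    then obtain \<delta> where \<delta>: "\<delta> > 0" "\<And>t x. 0 < t \<Longrightarrow> t < \<delta> \<Longrightarrow> x \<ge> 0 \<Longrightarrow> \<bar>(P t d x - d x) / t - g x\<bar> \<le> r"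
      using d(2) unfolding is_generator_value_iff by meson
    define t where "t = \<delta> / 2"
    have t: "0 < t" "t < \<delta>" using \<delta> by (auto simp: t_def)
    have "\<bar>d y\<bar> \<le> ((e + r) * t + S) / (1 + t)" if y: "y \<ge> 0" for y
    proof -
      have PS: "\<bar>P t d y\<bar> \<le> S" by (rule contraction[OF d(1)]) (use leS t y in auto)
      have "\<bar>d y - (P t d y - d y) / t\<bar> \<le> e + r" using \<delta>(2)[OF t y] bd[OF y] by linarith
      hence "\<bar>t * (d y - (P t d y - d y) / t)\<bar> \<le> (e + r) * t" using t by (simp add: abs_mult mult.commute)
      moreover have "t * (d y - (P t d y - d y) / t) = t * d y - (P t d y - d y)" using t by (simp only: right_diff_distrib) simp
      ultimately have "\<bar>t * d y - (P t d y - d y)\<bar> \<le> (e + r) * t" by simp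
      hence *: "\<bar>t * d y - (P t d y - d y)\<bar> \<le> (e + r) * t" .
      have "(1 + t) * d y = (t * d y - (P t d y - d y)) + P t d y" by (simp add: algebra_simps)
      then have "\<bar>(1 + t) * d y\<bar> \<le> (e + r) * t + S" using * PS by linarith
      then show ?thesis using t by (simp add: abs_mult field_simps)
    qed
    then have "S \<le> ((e + r) * t + S) / (1 + t)" unfolding S_def by (intro cSUP_least) auto
    then have "S * t \<le> (e + r) * t" using t by (simp add: field_simps)
    then show "S \<le> e + r" using t by simp
  qed
  then show ?thesis using leS[OF x] by simp
qed

end

section \<open>Closures of graphs\<close>

lemma C0_subset_cfunspace: "C0 \<subseteq> mspace (cfunspace (top_of_set {0::real..}) euclidean_metric)"
proof
  fix f assume f: "f \<in> C0"
  obtain B where B: "\<And>x. x \<ge> 0 \<Longrightarrow> \<bar>f x\<bar> \<le> B" using C0_bounded[OF f] by metis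
  have "bounded (f ` {0..})" using B by (intro boundedI[of _ B]) auto
  then show "f \<in> mspace (cfunspace (top_of_set {0::real..}) euclidean_metric)"
    using f by (auto simp: C0_def)
qed

lemma topspace_C0: "topspace C0_topology = C0"
  using C0_subset_cfunspace unfolding C0_topology_def topspace_mtopology_of mspace_submetric by blast

text \<open>In a product of two metric topologies, closure is tested on products of balls.\<close>

lemma in_closure_C0_iff:
  assumes S: "S \<subseteq> C0 \<times> C0"
  shows "(f, g) \<in> (prod_topology C0_topology C0_topology) closure_of S \<longleftrightarrow>
     f \<in> C0 \<and> g \<in> C0 \<and>
     (\<forall>e>0. \<exists>(f', g')\<in>S. (\<forall>x\<ge>0. \<bar>f' x - f x\<bar> \<le> e) \<and> (\<forall>x\<ge>0. \<bar>g' x - g x\<bar> \<le> e))" (is "?l \<longleftrightarrow> ?r")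
proof -
  let ?m = "submetric (cfunspace (top_of_set {0::real..}) euclidean_metric) C0"
  interpret Metric_space "mspace ?m" "mdist ?m" by (rule Metric_space_mspace_mdist)
  have sp: "mspace ?m = C0" using C0_subset_cfunspace by auto
  have top: "C0_topology = mtopology" by (simp add: C0_topology_def mtopology_of_def)
  have centre: "u \<in> mball u e" if "u \<in> C0" "e > 0" for u e
  proof -
    have "u \<in> mspace ?m" unfolding sp by (rule that(1))
    then show ?thesis using that(2) by (rule centre_in_mball_iff[THEN iffD2, OF conjI])
  qed
  have in_ball: "v \<in> mball u e" if "u \<in> C0" "v \<in> C0" "mdist ?m u v < e" for u v e
  proof -
    have "u \<in> mspace ?m" "v \<in> mspace ?m" unfolding sp by (rule that)+
    then show ?thesis using that(3) unfolding in_mball by blast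
  qed
  have le: "mdist ?m u v \<le> a \<longleftrightarrow> (\<forall>x\<ge>0. \<bar>u x - v x\<bar> \<le> a)" if "u \<in> C0" "v \<in> C0" for u v a
  proof -
    have "mdist (cfunspace (top_of_set {0::real..}) euclidean_metric) u v \<le> a \<longleftrightarrow> (\<forall>x\<in>{0..}. mdist euclidean_metric (u x) (v x) \<le> a)"
      using cfunspace_mdist_le[of u "top_of_set {0::real..}" euclidean_metric v a] that C0_subset_cfunspace by (auto simp: subset_eq simp del: mspace_cfunspace)
    then show ?thesis by (simp add: dist_real_def Ball_def)
  qed
  show ?thesis
  proof
    assume l: ?l
    have fg: "f \<in> C0" "g \<in> C0" using l in_closure_of[of "(f,g)"] by (auto simp: topspace_C0)
    moreover have "\<exists>(f', g')\<in>S. (\<forall>x\<ge>0. \<bar>f' x - f x\<bar> \<le> e) \<and> (\<forall>x\<ge>0. \<bar>g' x - g x\<bar> \<le> e)" if e: "e > 0" for e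
    proof -
      have "openin (prod_topology C0_topology C0_topology) (mball f e \<times> mball g e)"
        unfolding top openin_prod_Times_iff by blast
      moreover have "(f, g) \<in> mball f e \<times> mball g e"
        using centre[OF fg(1) e] centre[OF fg(2) e] by blast
      ultimately obtain p where p: "p \<in> S" "p \<in> mball f e \<times> mball g e" using l unfolding in_closure_of by metis
      obtain f' g' where pp: "p = (f', g')" by (cases p)
      have "f' \<in> C0" "g' \<in> C0" using p(1) S unfolding pp by blast+
      moreover have "mdist ?m f f' < e" "mdist ?m g g' < e"
        using p(2) unfolding pp mem_Times_iff fst_conv snd_conv in_mball by blast+
      ultimately have "\<forall>x\<ge>0. \<bar>f x - f' x\<bar> \<le> e" "\<forall>x\<ge>0. \<bar>g x - g' x\<bar> \<le> e"
        using le[OF fg(1), of f' e] le[OF fg(2), of g' e] by (meson less_imp_le)+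
      then show ?thesis using p(1) unfolding pp by (intro bexI[of _ "(f', g')"]) (auto simp: abs_minus_commute)
    qed
    ultimately show ?r by blast
  next
    assume r: ?r
    then have fg: "f \<in> C0" "g \<in> C0" by auto
    show ?l unfolding in_closure_of
    proof (intro conjI allI impI)
      show "(f, g) \<in> topspace (prod_topology C0_topology C0_topology)" using fg by (simp add: topspace_C0)
      fix T assume T: "(f, g) \<in> T \<and> openin (prod_topology C0_topology C0_topology) T"
      then obtain U V where UV: "openin mtopology U" "openin mtopology V" "f \<in> U" "g \<in> V" "U \<times> V \<subseteq> T"
        unfolding top openin_prod_topology_alt by blast
      obtain r1 where r1: "r1 > 0" "mball f r1 \<subseteq> U" using UV by (metis openin_mtopology)
      obtain r2 where r2: "r2 > 0" "mball g r2 \<subseteq> V" using UV by (metis openin_mtopology)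
      have "min r1 r2 / 2 > 0" using r1 r2 by auto
      then obtain f' g' where p: "(f', g') \<in> S" "\<forall>x\<ge>0. \<bar>f' x - f x\<bar> \<le> min r1 r2 / 2" "\<forall>x\<ge>0. \<bar>g' x - g x\<bar> \<le> min r1 r2 / 2"
        using r by blast
      have fg': "f' \<in> C0" "g' \<in> C0" using p S by auto
      have "mdist ?m f f' \<le> min r1 r2 / 2" "mdist ?m g g' \<le> min r1 r2 / 2"
        by (subst le[OF fg(1) fg'(1)] le[OF fg(2) fg'(2)], use p in \<open>simp only: abs_minus_commute\<close>)+
      then have "mdist ?m f f' < r1" "mdist ?m g g' < r2" using r1(1) r2(1) by linarith+
      then have "f' \<in> mball f r1" "g' \<in> mball g r2" using in_ball fg fg' by blast+
      then have "f' \<in> U" "g' \<in> V" using r1 r2 by blast+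
      then show "\<exists>y. y \<in> S \<and> y \<in> T" using p(1) UV(5) by blast
    qed
  qed
qed

section \<open>Measures with finite tails\<close>

locale tail_measure =
  fixes \<mu> :: "real measure"
  assumes sets_mu: "sets \<mu> = sets (restrict_space borel {0<..})"
    and finite_tail: "\<And>x. x > 0 \<Longrightarrow> emeasure \<mu> {x..} < \<infinity>"
begin

definition tail :: "real \<Rightarrow> real" where "tail x = measure \<mu> {x..}"

abbreviation tail_diverges :: bool where
  "tail_diverges \<equiv> (\<integral>\<^sup>+v\<in>{0<..1}. emeasure \<mu> {v..} \<partial>lborel) = \<infinity>"

text \<open>Applied to the derivative of \<open>f\<close>, this bounds the contribution of the jumps inside \<open>(0,1]\<close> to the
  generator at \<open>f\<close>.\<close>

abbreviation small_jump_norm :: "(real \<Rightarrow> real) \<Rightarrow> ennreal" where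
  "small_jump_norm h \<equiv> (\<integral>\<^sup>+v\<in>{0<..1}. ennreal \<bar>h v\<bar> * emeasure \<mu> {v..} \<partial>lborel)"

lemma space_mu: "space \<mu> = {0<..}"
  using sets_eq_imp_space_eq[OF sets_mu] by (simp add: space_restrict_space)

lemma sets_muI: "A \<in> sets borel \<Longrightarrow> A \<subseteq> {0<..} \<Longrightarrow> A \<in> sets \<mu>"
  unfolding sets_mu by (auto simp: sets_restrict_space image_iff intro!: bexI[of _ A])

lemma measurable_mu_borel: "f \<in> borel_measurable borel \<Longrightarrow> f \<in> borel_measurable \<mu>"
  by (subst measurable_cong_sets[OF sets_mu refl]) (auto intro: measurable_restrict_space1)

lemma emeasure_tail: "x > 0 \<Longrightarrow> emeasure \<mu> {x..} = ennreal (tail x)"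
  unfolding tail_def using finite_tail[of x] by (simp add: emeasure_eq_ennreal_measure)

lemma tail_nonneg: "0 \<le> tail x" by (simp add: tail_def)

lemma tail_antimono: "0 < x \<Longrightarrow> x \<le> y \<Longrightarrow> tail y \<le> tail x"
  unfolding tail_def using finite_tail[of x]
  by (intro measure_mono_fmeasurable) (auto simp: fmeasurable_def intro!: sets_muI)

lemma sigma_finite_mu: "sigma_finite_measure \<mu>"
proof
  define A where "A n = {inverse (real (Suc n))..}" for n
  have pos: "inverse (real (Suc n)) > 0" for n by simp
  have sub: "A n \<subseteq> {0<..}" for n
  proof
    fix x assume "x \<in> A n"
    then have "inverse (real (Suc n)) \<le> x" by (simp only: A_def atLeast_iff)
    then show "x \<in> {0<..}" using pos[of n] unfolding greaterThan_iff by (rule less_le_trans[rotated])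
  qed
  have "A n \<in> sets \<mu>" for n by (rule sets_muI[OF _ sub]) (simp add: A_def)
  then have A: "range A \<subseteq> sets \<mu>" "(\<Union>n. A n) \<subseteq> {0<..}" using sub by blast+
  have "x \<in> (\<Union>n. A n)" if "x > 0" for x :: real
    using reals_Archimedean[OF that] unfolding A_def by (blast intro: less_imp_le)
  then have "(\<Union>n. A n) = {0<..}" using A(2) by blast
  moreover have "emeasure \<mu> (A n) \<noteq> \<infinity>" for n
    using finite_tail[OF pos[of n]] unfolding A_def by (rule order.strict_implies_not_eq)
  ultimately show "\<exists>A. countable A \<and> A \<subseteq> sets \<mu> \<and> \<Union> A = space \<mu> \<and> (\<forall>a\<in>A. emeasure \<mu> a \<noteq> \<infinity>)"
    using A(1) unfolding space_mu by (intro exI[of _ "range A"]) auto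
qed

lemma tail_tendsto_0: "(\<lambda>n. tail (real n)) \<longlonglongrightarrow> 0"
proof -
  have "(\<lambda>n. measure \<mu> {real (Suc n)..}) \<longlonglongrightarrow> measure \<mu> (\<Inter>n. {real (Suc n)..})"
  proof (rule Lim_measure_decseq)
    show "emeasure \<mu> {real (Suc n)..} \<noteq> \<infinity>" for n using finite_tail[of "real (Suc n)"] by auto
  qed (auto simp: decseq_def intro!: sets_muI)
  moreover have "x \<notin> (\<Inter>n. {real (Suc n)..})" for x
  proof -
    obtain n where "x < real n" using reals_Archimedean2 by blast
    then show ?thesis by (auto intro!: exI[of _ n])
  qed
  then have "(\<Inter>n. {real (Suc n)..}) = {}" by blast
  ultimately have "(\<lambda>n. tail (real (Suc n))) \<longlonglongrightarrow> 0" by (simp add: tail_def)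
  then show ?thesis by (rule LIMSEQ_imp_Suc)
qed

lemma tail_measurable[measurable]: "tail \<in> borel_measurable borel"
proof -
  have m: "mono_on {0<..} (\<lambda>x. - tail x)" by (auto intro!: mono_onI tail_antimono)
  have "(\<lambda>x. - tail x) \<in> borel_measurable (restrict_space borel {0<..})"
    by (rule borel_measurable_mono_on_fnc[OF m])
  then have "(\<lambda>x. - (- tail x)) \<in> borel_measurable (restrict_space borel {0<..})" by measurable
  then have "(\<lambda>x. indicator {0<..} x *\<^sub>R tail x) \<in> borel_measurable borel"
    by (subst (asm) borel_measurable_restrict_space_iff) auto
  moreover have "tail x = 0" if "x \<le> 0" for x
  proof -
    have "{x..} \<notin> sets \<mu>" using sets.sets_into_space[of "{x..}" \<mu>] that by (auto simp: space_mu)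
    then show ?thesis by (simp add: tail_def measure_notin_sets)
  qed
  then have "(\<lambda>x. indicator {0<..} x *\<^sub>R tail x) = tail" by (auto simp: fun_eq_iff indicator_def not_less)
  ultimately show ?thesis by simp
qed

end

section \<open>The law at a fixed time\<close>

locale shot_noise = tail_measure \<mu> + prob_space \<Omega>
  for \<mu> :: "real measure" and \<Omega> :: "'w measure" +
  fixes b :: real and \<xi> :: "'w \<Rightarrow> real \<Rightarrow> real"
  assumes noise: "esn_noise \<Omega> \<mu> \<xi>"
begin

abbreviation "\<nu> \<equiv> esn_intensity \<mu>"

definition M0 :: "real \<Rightarrow> 'w \<Rightarrow> real" where "M0 t \<omega> = esn0 b (\<xi> \<omega>) t"

definition over :: "real \<Rightarrow> real \<Rightarrow> (real \<times> real) set" where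
  "over t y = {(s, z). 0 \<le> s \<and> s \<le> t \<and> 0 < z \<and> y + b * (t - s) < z}"

text \<open>The intensity of \<open>over t y\<close>. The formula keeps the time \<open>s\<close> of the atom as the variable, so that
  \<open>exceedance_add\<close> only has to split and translate the interval.\<close>

definition exceedance :: "real \<Rightarrow> real \<Rightarrow> ennreal" where
  "exceedance t y = (\<integral>\<^sup>+ s. emeasure \<mu> {max 0 (y + b * (t - s))<..} * indicator {0..t} s \<partial>lborel)"

definition height_cdf :: "real \<Rightarrow> real \<Rightarrow> real" where
  "height_cdf t y = prob {\<omega> \<in> space \<Omega>. M0 t \<omega> \<le> y}"

lemma space_nu: "space \<nu> = {0..} \<times> {0<..}"
  by (simp add: esn_intensity_def space_pair_measure space_restrict_space space_mu)

lemma fst_measurable_nu: "fst \<in> borel_measurable \<nu>"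
proof -
  have "(\<lambda>x. x) \<in> borel_measurable (restrict_space lborel {0::real..})" by (intro measurable_restrict_space1) simp
  from measurable_compose[OF measurable_fst this] show ?thesis by (simp add: esn_intensity_def)
qed

lemma snd_measurable_nu: "snd \<in> borel_measurable \<nu>"
proof -
  have "(\<lambda>x. x) \<in> borel_measurable \<mu>" by (intro measurable_mu_borel) simp
  from measurable_compose[OF measurable_snd this] show ?thesis by (simp add: esn_intensity_def)
qed

lemma over_sets: "over t y \<in> sets \<nu>"
proof -
  note [measurable] = fst_measurable_nu snd_measurable_nu
  have "over t y = {p \<in> space \<nu>. fst p \<le> t \<and> y + b * (t - fst p) < snd p}"
    by (auto simp: over_def space_nu)
  also have "\<dots> \<in> sets \<nu>" by measurable
  finally show ?thesis .
qed

lemma emeasure_over: "emeasure \<nu> (over t y) = exceedance t y"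
proof -
  interpret sigma_finite_measure \<mu> by (rule sigma_finite_mu)
  have "emeasure \<nu> (over t y) = (\<integral>\<^sup>+ s. emeasure \<mu> (Pair s -` over t y) \<partial>restrict_space lborel {0..})"
    unfolding esn_intensity_def by (rule emeasure_pair_measure_alt) (use over_sets in \<open>simp add: esn_intensity_def\<close>)
  also have "\<dots> = (\<integral>\<^sup>+ s. emeasure \<mu> (Pair s -` over t y) * indicator {0..} s \<partial>lborel)"
    by (rule nn_integral_restrict_space) simp
  also have "\<dots> = exceedance t y"
    unfolding exceedance_def
  proof (rule nn_integral_cong)
    fix s
    have "Pair s -` over t y = {max 0 (y + b * (t - s))<..}" if "0 \<le> s" "s \<le> t"
      using that by (auto simp: over_def)
    moreover have "Pair s -` over t y = {}" if "\<not> (0 \<le> s \<and> s \<le> t)"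
      using that by (auto simp: over_def)
    ultimately show "emeasure \<mu> (Pair s -` over t y) * indicator {0..} s = emeasure \<mu> {max 0 (y + b * (t - s))<..} * indicator {0..t} s"
      by (auto simp: indicator_def)
  qed
  finally show ?thesis .
qed

lemma exceedance_integrand_measurable[measurable]:
  "(\<lambda>s. emeasure \<mu> {max 0 (c + d * s)<..}) \<in> borel_measurable borel"
proof -
  have a: "antimono (\<lambda>z. emeasure \<mu> {max 0 z<..})"
    by (auto intro!: antimonoI emeasure_mono sets_muI)
  have "(\<lambda>z. emeasure \<mu> {max 0 z<..}) \<in> borel_measurable borel"
  proof (rule borel_measurableI_ge)
    fix c :: ennreal
    have "is_interval {z. c \<le> emeasure \<mu> {max 0 z<..}}"
      unfolding is_interval_1 using a by (auto simp: antimono_def intro: order_trans)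
    then show "{z \<in> space borel. c \<le> emeasure \<mu> {max 0 z<..}} \<in> sets borel"
      using real_interval_borel_measurable by simp
  qed
  then show ?thesis by (rule measurable_compose[rotated]) simp
qed

text \<open>The space-time region above the line that ends at height \<open>y\<close> at time \<open>s + t\<close> is the region above
  the same line up to time \<open>s\<close>, where the line is at height \<open>y + b t\<close>, and a translate of the region
  for \<open>t\<close>. This is the Markov property.\<close>

lemma exceedance_add:
  assumes "0 \<le> s" "0 \<le> t"
  shows "exceedance (s + t) y = exceedance s (y + b * t) + exceedance t y"
proof -
  define q where "q r = emeasure \<mu> {max 0 (y + b * (s + t - r))<..}" for r
  have q[measurable]: "q \<in> borel_measurable borel"
  proof -
    have "q = (\<lambda>r. emeasure \<mu> {max 0 ((y + b * (s + t)) + (- b) * r)<..})"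
      by (auto simp: q_def fun_eq_iff algebra_simps)
    then show ?thesis by (simp only: exceedance_integrand_measurable)
  qed
  have "exceedance (s + t) y = (\<integral>\<^sup>+ r. q r * indicator {0..s} r + q r * indicator {s<..s+t} r \<partial>lborel)"
    unfolding exceedance_def q_def using assms by (intro nn_integral_cong) (auto simp: indicator_def)
  also have "\<dots> = (\<integral>\<^sup>+ r. q r * indicator {0..s} r \<partial>lborel) + (\<integral>\<^sup>+ r. q r * indicator {s<..s+t} r \<partial>lborel)"
    by (intro nn_integral_add) auto
  also have "(\<integral>\<^sup>+ r. q r * indicator {0..s} r \<partial>lborel) = exceedance s (y + b * t)"
    unfolding exceedance_def q_def by (intro nn_integral_cong) (auto simp: algebra_simps)
  also have "(\<integral>\<^sup>+ r. q r * indicator {s<..s+t} r \<partial>lborel) = (\<integral>\<^sup>+ r. q (s + 1 * r) * indicator {s<..s+t} (s + 1 * r) \<partial>lborel)"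
    by (subst nn_integral_real_affine[where c=1 and t=s]) auto
  also have "\<dots> = exceedance t y"
    unfolding exceedance_def
  proof (rule nn_integral_cong_AE)
    show "AE r in lborel. q (s + 1 * r) * indicator {s<..s+t} (s + 1 * r) = emeasure \<mu> {max 0 (y + b * (t - r))<..} * indicator {0..t} r"
      using AE_lborel_singleton[of 0] by eventually_elim (auto simp: indicator_def q_def algebra_simps)
  qed
  finally show ?thesis .
qed

lemma exceedance_le:
  assumes "0 \<le> t" "\<bar>b\<bar> * t < y"
  shows "exceedance t y \<le> ennreal (t * tail (y - \<bar>b\<bar> * t))"
proof -
  have "exceedance t y \<le> (\<integral>\<^sup>+ s. ennreal (tail (y - \<bar>b\<bar> * t)) * indicator {0..t} s \<partial>lborel)"
    unfolding exceedance_def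
  proof (intro nn_integral_mono)
    fix s
    have "emeasure \<mu> {max 0 (y + b * (t - s))<..} \<le> ennreal (tail (y - \<bar>b\<bar> * t))" if "0 \<le> s" "s \<le> t"
    proof -
      have "\<bar>b * (t - s)\<bar> \<le> \<bar>b\<bar> * t" using that by (simp add: abs_mult mult_left_mono)
      then have "emeasure \<mu> {max 0 (y + b * (t - s))<..} \<le> emeasure \<mu> {y - \<bar>b\<bar> * t..}"
        using assms by (intro emeasure_mono sets_muI) auto
      then show ?thesis using assms by (simp add: emeasure_tail)
    qed
    then show "emeasure \<mu> {max 0 (y + b * (t - s))<..} * indicator {0..t} s \<le> ennreal (tail (y - \<bar>b\<bar> * t)) * indicator {0..t} s"
      by (auto simp: indicator_def)
  qed
  also have "\<dots> = ennreal (t * tail (y - \<bar>b\<bar> * t))"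
    using assms by (simp add: nn_integral_cmult_indicator ennreal_mult'' tail_nonneg mult.commute[of t])
  finally show ?thesis .
qed

lemma exceedance_ge:
  assumes "0 < t" "\<bar>b\<bar> * t < y" "\<bar>b\<bar> * t < a"
  shows "ennreal (t * tail (y + a)) \<le> exceedance t y"
proof -
  have "ennreal (t * tail (y + a)) = (\<integral>\<^sup>+ s. ennreal (tail (y + a)) * indicator {0..t} s \<partial>lborel)"
    using assms by (simp add: nn_integral_cmult_indicator ennreal_mult'' tail_nonneg mult.commute[of t])
  also have "\<dots> \<le> exceedance t y"
    unfolding exceedance_def
  proof (intro nn_integral_mono)
    fix s
    have "ennreal (tail (y + a)) \<le> emeasure \<mu> {max 0 (y + b * (t - s))<..}" if "0 \<le> s" "s \<le> t"
    proof -
      have *: "\<bar>b * (t - s)\<bar> \<le> \<bar>b\<bar> * t" using that by (simp add: abs_mult mult_left_mono)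
      have "0 \<le> \<bar>b\<bar> * t" using assms by simp
      then have y: "y + a > 0" using assms by linarith
      then have "emeasure \<mu> {y + a..} \<le> emeasure \<mu> {max 0 (y + b * (t - s))<..}"
        using assms * by (intro emeasure_mono sets_muI) auto
      then show ?thesis using y by (simp add: emeasure_tail)
    qed
    then show "ennreal (tail (y + a)) * indicator {0..t} s \<le> emeasure \<mu> {max 0 (y + b * (t - s))<..} * indicator {0..t} s"
      by (auto simp: indicator_def)
  qed
  finally show ?thesis .
qed

definition void :: "real \<Rightarrow> real \<Rightarrow> 'w set" where
  "void t y = {\<omega> \<in> space \<Omega>. emeasure (atom_measure \<mu> (\<xi> \<omega>)) (over t y) = 0}"

text \<open>The probability of no atom in a set of intensity \<open>x\<close>; it is \<open>0\<close> for infinite intensity, which can occur for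
  \<open>y = max 0 (- b t)\<close>.\<close>

definition void_prob :: "ennreal \<Rightarrow> real" where
  "void_prob x = (if x = \<infinity> then 0 else exp (- enn2real x))"

lemma void_prob_add: "void_prob (x + y) = void_prob x * void_prob y"
  by (auto simp: void_prob_def enn2real_plus less_top mult_exp_exp)

lemma ppp: "poisson_point_process \<Omega> \<nu> (\<lambda>\<omega>. atom_measure \<mu> (\<xi> \<omega>))"
  using noise by (simp add: esn_noise_def)

lemmas ppp_measurable = ppp[unfolded poisson_point_process_def, THEN conjunct2, THEN conjunct1, rule_format]
lemmas ppp_weights = ppp[unfolded poisson_point_process_def, THEN conjunct2, THEN conjunct2, THEN conjunct1, rule_format]
lemmas ppp_infinite = ppp[unfolded poisson_point_process_def, THEN conjunct2, THEN conjunct2, THEN conjunct2, THEN conjunct1, rule_format]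

lemma void_sets[measurable]: "void t y \<in> sets \<Omega>"
proof -
  have [measurable]: "(\<lambda>\<omega>. emeasure (atom_measure \<mu> (\<xi> \<omega>)) (over t y)) \<in> borel_measurable \<Omega>"
    by (rule ppp_measurable[OF over_sets])
  show ?thesis unfolding void_def by measurable
qed

text \<open>Only the void probabilities of the Poisson process enter the law at a fixed time.\<close>

lemma prob_void: "prob (void t y) = void_prob (exceedance t y)"
proof (cases "exceedance t y = \<infinity>")
  case True
  then have "AE \<omega> in \<Omega>. emeasure (atom_measure \<mu> (\<xi> \<omega>)) (over t y) = \<infinity>"
    by (intro ppp_infinite over_sets) (simp add: emeasure_over)
  then have "AE \<omega> in \<Omega>. \<omega> \<notin> void t y" by eventually_elim (auto simp: void_def)
  then have "emeasure \<Omega> {\<omega> \<in> space \<Omega>. \<omega> \<in> void t y} = 0" by (rule emeasure_eq_0_AE)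
  moreover have "{\<omega> \<in> space \<Omega>. \<omega> \<in> void t y} = void t y" by (auto simp: void_def)
  ultimately have "emeasure \<Omega> (void t y) = 0" by simp
  then show ?thesis using True by (simp add: void_prob_def emeasure_eq_measure)
next
  case False
  then have "measure \<Omega> {\<omega>\<in>space \<Omega>. emeasure (atom_measure \<mu> (\<xi> \<omega>)) (over t y) = of_nat 0} =
           exp (- measure \<nu> (over t y)) * measure \<nu> (over t y) ^ 0 / fact 0"
    by (intro ppp_weights over_sets) (simp add: emeasure_over less_top)
  then show ?thesis using False by (simp add: void_def void_prob_def measure_def emeasure_over)
qed

lemma void_iff:
  assumes "\<omega> \<in> space \<Omega>"
  shows "\<omega> \<in> void t y \<longleftrightarrow> (\<forall>s\<in>{0..t}. 0 < \<xi> \<omega> s \<longrightarrow> \<xi> \<omega> s \<le> y + b * (t - s))"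
proof -
  let ?S = "{s. 0 \<le> s \<and> 0 < \<xi> \<omega> s}"
  have m: "(\<lambda>s. (s, \<xi> \<omega> s)) \<in> measurable (count_space ?S) \<nu>" by (auto simp: space_nu)
  have "emeasure (atom_measure \<mu> (\<xi> \<omega>)) (over t y) = emeasure (count_space ?S) ((\<lambda>s. (s, \<xi> \<omega> s)) -` over t y \<inter> ?S)"
    unfolding atom_measure_def by (subst emeasure_distr[OF m over_sets]) simp
  also have "\<dots> = 0 \<longleftrightarrow> (\<lambda>s. (s, \<xi> \<omega> s)) -` over t y \<inter> ?S = {}"
    by (subst emeasure_count_space_eq_0) auto
  finally show ?thesis using assms by (auto simp: void_def over_def not_less)
qed

text \<open>The condition on \<open>y\<close> makes the line \<open>s \<mapsto> y + b (t - s)\<close> nonnegative on \<open>[0,t]\<close>, so that times without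
  an atom, where the mark is \<open>0\<close>, impose no constraint.\<close>

lemma void_iff_le:
  assumes "\<omega> \<in> space \<Omega>" "0 \<le> t" "max 0 (- b * t) \<le> y"
  shows "\<omega> \<in> void t y \<longleftrightarrow> (\<forall>s\<in>{0..t}. max (\<xi> \<omega> s - b * (t - s)) 0 \<le> y)"
proof -
  have "0 \<le> y + b * (t - s)" if "0 \<le> s" "s \<le> t" for s
  proof (cases "b \<ge> 0")
    case True then show ?thesis using assms that by simp
  next
    case False
    then have "- b * (t - s) \<le> - b * t" using that by (intro mult_left_mono) auto
    then show ?thesis using assms by simp
  qed
  moreover have "0 \<le> \<xi> \<omega> s" if "0 \<le> s" for s using noise assms that by (auto simp: esn_noise_def)
  ultimately have "(0 < \<xi> \<omega> s \<longrightarrow> \<xi> \<omega> s \<le> y + b * (t - s)) \<longleftrightarrow> max (\<xi> \<omega> s - b * (t - s)) 0 \<le> y"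
    if "0 \<le> s" "s \<le> t" for s
    using assms(3) that by (smt (verit))
  then show ?thesis unfolding void_iff[OF assms(1)] by (intro ball_cong refl) simp
qed

definition heights :: "real \<Rightarrow> 'w \<Rightarrow> real set" where
  "heights t \<omega> = (\<lambda>s. max (\<xi> \<omega> s - b * (t - s)) 0) ` {0..t}"

lemma M0_eq_Sup: "M0 t \<omega> = Sup (heights t \<omega>)"
  by (simp add: M0_def esn0_def heights_def)

text \<open>Boundedness of the heights is an event. Since the real supremum of an unbounded set is a fixed
  (unspecified) number, this makes \<open>M0 t\<close> a random variable on all of \<open>\<Omega>\<close>, null set included.\<close>

lemma bdd_heights_eq:
  assumes "0 \<le> t"
  shows "{\<omega> \<in> space \<Omega>. bdd_above (heights t \<omega>)} = (\<Union>n. void t (max 0 (- b * t) + real n))"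
proof (intro set_eqI iffI)
  fix \<omega> assume w: "\<omega> \<in> {\<omega> \<in> space \<Omega>. bdd_above (heights t \<omega>)}"
  then obtain B where B: "\<And>h. h \<in> heights t \<omega> \<Longrightarrow> h \<le> B" by (auto simp: bdd_above_def)
  obtain n :: nat where "B \<le> n" using real_arch_simple by blast
  then have "max (\<xi> \<omega> s - b * (t - s)) 0 \<le> max 0 (- b * t) + real n" if "s \<in> {0..t}" for s
    using B[of "max (\<xi> \<omega> s - b * (t - s)) 0"] that by (auto simp: heights_def)
  then have "\<omega> \<in> void t (max 0 (- b * t) + real n)"
    using w by (subst void_iff_le[OF _ assms]) auto
  then show "\<omega> \<in> (\<Union>n. void t (max 0 (- b * t) + real n))" by blast
next
  fix \<omega> assume "\<omega> \<in> (\<Union>n. void t (max 0 (- b * t) + real n))"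
  then obtain n where n: "\<omega> \<in> void t (max 0 (- b * t) + real n)" by blast
  then have w: "\<omega> \<in> space \<Omega>" by (simp add: void_def)
  then have "\<forall>s\<in>{0..t}. max (\<xi> \<omega> s - b * (t - s)) 0 \<le> max 0 (- b * t) + real n"
    using n void_iff_le[OF w assms, of "max 0 (- b * t) + real n"] by simp
  then have "bdd_above (heights t \<omega>)"
    unfolding heights_def by (intro bdd_aboveI[of _ "max 0 (- b * t) + real n"]) blast
  then show "\<omega> \<in> {\<omega> \<in> space \<Omega>. bdd_above (heights t \<omega>)}" using w by simp
qed

lemma bdd_heights_sets[measurable]: "0 \<le> t \<Longrightarrow> {\<omega> \<in> space \<Omega>. bdd_above (heights t \<omega>)} \<in> sets \<Omega>"
  by (simp add: bdd_heights_eq)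

lemma void_prob_ge: "x \<le> ennreal c \<Longrightarrow> 0 \<le> c \<Longrightarrow> 1 - c \<le> void_prob x"
proof -
  assume x: "x \<le> ennreal c" "0 \<le> c"
  have "x < \<infinity>" by (rule le_less_trans[OF x(1)]) simp
  moreover have "enn2real x \<le> c" by (rule enn2real_leI[OF x(2,1)])
  moreover have "1 + (- enn2real x) \<le> exp (- enn2real x)" by (rule exp_ge_add_one_self)
  ultimately show ?thesis by (auto simp: void_prob_def less_top[symmetric])
qed

text \<open>The void probability of the region above height \<open>n\<close> tends to \<open>1\<close>, because its intensity is at
  most \<open>t\<close> times the tail of \<open>\<mu>\<close> near \<open>n\<close>.\<close>

lemma AE_bdd_heights:
  assumes t: "0 \<le> t"
  shows "AE \<omega> in \<Omega>. bdd_above (heights t \<omega>)"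
proof -
  have "1 \<le> prob {\<omega> \<in> space \<Omega>. bdd_above (heights t \<omega>)}"
  proof (rule field_le_epsilon)
    fix e :: real assume e: "e > 0"
    define c where "c = max 0 (- b * t)"
    have "(\<lambda>n. t * tail (real n)) \<longlonglongrightarrow> t * 0" by (intro tendsto_intros tail_tendsto_0)
    then have "eventually (\<lambda>n. t * tail (real n) < e) sequentially" using e order_tendstoD(2) by force
    then obtain n where n: "n > 0" "t * tail (real n) < e"
      using eventually_conj[OF eventually_gt_at_top[of 0], of "\<lambda>n. t * tail (real n) < e"]
      by (auto simp: eventually_sequentially)
    obtain m :: nat where m: "real n + \<bar>b\<bar> * t \<le> real m" using real_arch_simple by blast
    have *: "real n \<le> c + real m - \<bar>b\<bar> * t" using m by (simp add: c_def)
    have pos: "\<bar>b\<bar> * t < c + real m" using * n by linarith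
    have "exceedance t (c + real m) \<le> ennreal (t * tail (c + real m - \<bar>b\<bar> * t))"
      by (rule exceedance_le[OF t pos])
    also have "\<dots> \<le> ennreal e"
      using tail_antimono[of "real n", OF _ *] n t by (intro ennreal_leI) (smt (verit) mult_left_mono of_nat_0_less_iff)
    finally have "1 - e \<le> prob (void t (c + real m))"
      unfolding prob_void using e by (intro void_prob_ge) auto
    also have "\<dots> \<le> prob {\<omega> \<in> space \<Omega>. bdd_above (heights t \<omega>)}"
      unfolding bdd_heights_eq[OF t] c_def by (intro finite_measure_mono) auto
    finally show "1 \<le> prob {\<omega> \<in> space \<Omega>. bdd_above (heights t \<omega>)} + e" by simp
  qed
  then have "prob {\<omega> \<in> space \<Omega>. bdd_above (heights t \<omega>)} = 1" by (simp add: antisym)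
  then show ?thesis using bdd_heights_sets[OF t] by (simp add: prob_Collect_eq_1)
qed

lemma Sup_le_iff_bdd:
  assumes "\<omega> \<in> space \<Omega>" "0 \<le> t" "bdd_above (heights t \<omega>)"
  shows "M0 t \<omega> \<le> y \<longleftrightarrow> max 0 (- b * t) \<le> y \<and> \<omega> \<in> void t y"
proof -
  have ne: "{0..t} \<noteq> {}" using assms by simp
  have le: "M0 t \<omega> \<le> y \<longleftrightarrow> (\<forall>s\<in>{0..t}. max (\<xi> \<omega> s - b * (t - s)) 0 \<le> y)" for y
    unfolding M0_def esn0_def by (rule cSUP_le_iff[OF ne assms(3)[unfolded heights_def]])
  have "max 0 (- b * t) \<le> M0 t \<omega>"
  proof -
    have "0 \<le> \<xi> \<omega> 0" using noise assms by (auto simp: esn_noise_def)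
    moreover have "\<forall>s\<in>{0..t}. max (\<xi> \<omega> s - b * (t - s)) 0 \<le> M0 t \<omega>" using le[of "M0 t \<omega>"] by simp
    then have "max (\<xi> \<omega> 0 - b * (t - 0)) 0 \<le> M0 t \<omega>" using assms by (meson atLeastAtMost_iff order_refl)
    ultimately show ?thesis by simp
  qed
  then show ?thesis using le[of y] void_iff_le[OF assms(1,2), of y] by auto
qed

lemma M0_measurable[measurable]:
  assumes t: "0 \<le> t"
  shows "M0 t \<in> borel_measurable \<Omega>"
proof (rule borel_measurableI_le)
  fix y :: real
  let ?B = "{\<omega> \<in> space \<Omega>. bdd_above (heights t \<omega>)}"
  define c where "c = (LEAST z::real. False)"
  have c: "M0 t \<omega> = c" if "\<not> bdd_above (heights t \<omega>)" for \<omega>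
    unfolding M0_eq_Sup Sup_real_def c_def using that by (intro arg_cong[of _ _ Least]) (auto simp: bdd_above_def fun_eq_iff)
  have "{\<omega> \<in> space \<Omega>. M0 t \<omega> \<le> y} =
      (if max 0 (- b * t) \<le> y then ?B \<inter> void t y else {}) \<union> (if c \<le> y then space \<Omega> - ?B else {})"
  proof (rule set_eqI)
    fix \<omega>
    show "\<omega> \<in> {\<omega> \<in> space \<Omega>. M0 t \<omega> \<le> y} \<longleftrightarrow> \<omega> \<in> (if max 0 (- b * t) \<le> y then ?B \<inter> void t y else {}) \<union> (if c \<le> y then space \<Omega> - ?B else {})"
      using Sup_le_iff_bdd[OF _ t, of \<omega> y] c[of \<omega>] by (cases "bdd_above (heights t \<omega>)") (auto simp del: max.bounded_iff)
  qed
  also have "\<dots> \<in> sets \<Omega>" using bdd_heights_sets[OF t] by auto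
  finally show "{\<omega> \<in> space \<Omega>. M0 t \<omega> \<le> y} \<in> sets \<Omega>" .
qed

text \<open>Below \<open>max 0 (- b t)\<close> the distribution function vanishes: the times \<open>s = t\<close> and \<open>s = 0\<close> alone force
  \<open>M0 t\<close> to be at least \<open>0\<close> and \<open>- b t\<close>.\<close>

lemma height_cdf_eq:
  assumes t: "0 \<le> t"
  shows "height_cdf t y = (if max 0 (- b * t) \<le> y then void_prob (exceedance t y) else 0)"
proof -
  let ?V = "if max 0 (- b * t) \<le> y then void t y else {}"
  have "height_cdf t y = prob ?V"
    unfolding height_cdf_def
  proof (rule measure_eq_AE)
    show "AE x in \<Omega>. (x \<in> {\<omega> \<in> space \<Omega>. M0 t \<omega> \<le> y}) = (x \<in> ?V)"
      using AE_bdd_heights[OF t] AE_space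
      by eventually_elim (use Sup_le_iff_bdd[OF _ t] in auto)
  qed (use M0_measurable[OF t] in \<open>auto simp: borel_measurable_iff_le\<close>)
  then show ?thesis by (simp add: prob_void)
qed

lemma height_cdf_zero: "0 \<le> t \<Longrightarrow> y < max 0 (- b * t) \<Longrightarrow> height_cdf t y = 0"
  by (simp only: height_cdf_eq if_False not_le[symmetric])

lemma height_cdf_void: "0 \<le> t \<Longrightarrow> max 0 (- b * t) \<le> y \<Longrightarrow> height_cdf t y = void_prob (exceedance t y)"
  by (simp only: height_cdf_eq if_True)

text \<open>Besides additivity of the exponents one has to check the values of \<open>y\<close> below the range of one of
  the processes, where both sides vanish.\<close>

lemma height_cdf_add:
  assumes "0 \<le> s" "0 \<le> t"
  shows "height_cdf (s + t) y = height_cdf s (y + b * t) * height_cdf t y"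
proof -
  have st: "0 \<le> s + t" using assms by simp
  have sg: "- b * t \<le> - b * (s + t)" if "b < 0" using that assms by (intro mult_left_mono) linarith+
  \<comment> \<open>The first two cases lie below the range of \<open>M0 t\<close> and of \<open>M0 s - b t\<close>, respectively.\<close>
  consider "y < max 0 (- b * t)" | "max 0 (- b * t) \<le> y" "y < - b * (s + t)" | "max 0 (- b * t) \<le> y" "- b * (s + t) \<le> y"
    by linarith
  then show ?thesis
  proof cases
    case 1
    have "y < max 0 (- b * (s + t))"
    proof (cases "y < 0")
      case False
      then have "y < - b * t" using 1 by auto
      moreover from this have "b < 0" using False assms by (smt (verit) mult_minus_left mult_nonneg_nonneg)
      ultimately have "y < - b * (s + t)" using sg by linarith
      then show ?thesis by (rule less_le_trans) (rule max.cobounded2)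
    qed auto
    then show ?thesis using height_cdf_zero[OF assms(2) 1] height_cdf_zero[OF st] by simp
  next
    case 2
    then have "y + b * t < max 0 (- b * s)" by (auto simp: algebra_simps)
    moreover have "y < max 0 (- b * (s + t))" by (rule less_le_trans[OF 2(2)]) (rule max.cobounded2)
    ultimately show ?thesis using height_cdf_zero[OF assms(1)] height_cdf_zero[OF st] by simp
  next
    case 3
    then have "max 0 (- b * s) \<le> y + b * t" by (auto simp: algebra_simps)
    moreover have "max 0 (- b * (s + t)) \<le> y" using 3 by simp
    ultimately show ?thesis
      using height_cdf_void[OF st] height_cdf_void[OF assms(1)] height_cdf_void[OF assms(2) 3(1)] by (simp add: exceedance_add assms void_prob_add)
  qed
qed

end

section \<open>The semigroup of the shot noise process\<close>

text \<open>Elements of \<open>C0\<close> are unspecified on the negative half-line; precomposing with \<open>z \<mapsto> max z 0\<close> gives a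
  continuous function on the whole line.\<close>

lemma C0_extend_continuous: "f \<in> C0 \<Longrightarrow> continuous_on UNIV (\<lambda>z. f (max z 0))"
  unfolding C0_def by (rule continuous_on_compose2[of "{0..}" f]) (auto intro!: continuous_intros)

lemma C0_extend_measurable: "f \<in> C0 \<Longrightarrow> (\<lambda>z. f (max z 0)) \<in> borel_measurable borel"
  by (intro borel_measurable_continuous_onI C0_extend_continuous)

context shot_noise
begin

abbreviation "P \<equiv> esn_semigroup \<Omega> b \<xi>"

definition M_from :: "real \<Rightarrow> real \<Rightarrow> 'w \<Rightarrow> real" where
  "M_from x t \<omega> = max (max (x - b * t) 0) (M0 t \<omega>)"

lemma M_from_nonneg: "0 \<le> M_from x t \<omega>" by (simp add: M_from_def)

lemma P_eq: "0 \<le> x \<Longrightarrow> P t f x = (\<integral>\<omega>. f (M_from x t \<omega>) \<partial>\<Omega>)"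
  by (simp add: esn_semigroup_def M_from_def esn_def M0_def)

lemma M_from_measurable[measurable]: "0 \<le> t \<Longrightarrow> M_from x t \<in> borel_measurable \<Omega>"
  unfolding M_from_def using M0_measurable[of t] by measurable

lemma C0_M_from_measurable:
  assumes "f \<in> C0" "0 \<le> t"
  shows "(\<lambda>\<omega>. f (M_from x t \<omega>)) \<in> borel_measurable \<Omega>"
  using measurable_compose[OF M_from_measurable[OF assms(2)] C0_extend_measurable[OF assms(1)], of x] by (simp add: M_from_nonneg max_absorb1)

lemma C0_M_from_integrable:
  assumes "f \<in> C0" "0 \<le> t"
  shows "integrable \<Omega> (\<lambda>\<omega>. f (M_from x t \<omega>))"
proof -
  obtain B where "\<And>x. x \<ge> 0 \<Longrightarrow> \<bar>f x\<bar> \<le> B" using C0_bounded[OF assms(1)] by metis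
  then show ?thesis by (intro integrable_const_bound[of _ B] C0_M_from_measurable assms) (simp add: M_from_nonneg)
qed

lemma prob_M_from_le:
  assumes "0 \<le> t"
  shows "prob {\<omega> \<in> space \<Omega>. M_from x t \<omega> \<le> y} = (if x - b * t \<le> y then height_cdf t y else 0)"
proof (cases "x - b * t \<le> y \<and> 0 \<le> y")
  case True
  then have "{\<omega> \<in> space \<Omega>. M_from x t \<omega> \<le> y} = {\<omega> \<in> space \<Omega>. M0 t \<omega> \<le> y}" by (auto simp: M_from_def)
  then show ?thesis using True by (simp add: height_cdf_def)
next
  case False
  then have e: "{\<omega> \<in> space \<Omega>. M_from x t \<omega> \<le> y} = {}" by (auto simp: M_from_def)
  have "height_cdf t y = 0" if "y < 0" using height_cdf_zero[OF assms, of y] that by (simp add: less_max_iff_disj)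
  then show ?thesis using False unfolding e by auto
qed

text \<open>The Markov property in law: both sides have the distribution function
  \<open>y \<mapsto> height_cdf s (y + b t) * height_cdf t y\<close>, cut off below \<open>x - b (s + t)\<close>.\<close>

lemma distr_M_from_add:
  assumes s: "0 \<le> s" and t: "0 \<le> t"
  shows "distr \<Omega> borel (M_from x (s + t)) =
    distr (\<Omega> \<Otimes>\<^sub>M \<Omega>) borel (\<lambda>(\<omega>, \<omega>'). M_from (M_from x s \<omega>) t \<omega>')"
proof -
  interpret PP: pair_prob_space \<Omega> \<Omega> ..
  have st: "0 \<le> s + t" using assms by simp
  have m[measurable]: "(\<lambda>(\<omega>, \<omega>'). M_from (M_from x s \<omega>) t \<omega>') \<in> borel_measurable (\<Omega> \<Otimes>\<^sub>M \<Omega>)"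
    using M_from_measurable[OF s, of x] M0_measurable[OF t] unfolding M_from_def by measurable
  interpret D1: real_distribution "distr \<Omega> borel (M_from x (s + t))"
    by (intro real_distribution_distr M_from_measurable st)
  interpret D2: real_distribution "distr (\<Omega> \<Otimes>\<^sub>M \<Omega>) borel (\<lambda>(\<omega>, \<omega>'). M_from (M_from x s \<omega>) t \<omega>')"
    by (intro PP.real_distribution_distr m)
  show ?thesis
  proof (rule cdf_unique)
    show "cdf (distr \<Omega> borel (M_from x (s + t))) = cdf (distr (\<Omega> \<Otimes>\<^sub>M \<Omega>) borel (\<lambda>(\<omega>, \<omega>'). M_from (M_from x s \<omega>) t \<omega>'))"
    proof
      fix y
      have "cdf (distr \<Omega> borel (M_from x (s + t))) y = prob {\<omega> \<in> space \<Omega>. M_from x (s + t) \<omega> \<le> y}"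
        unfolding cdf_def using M_from_measurable[OF st, of x]
        by (subst measure_distr) (auto intro!: arg_cong[of _ _ prob])
      then have 1: "cdf (distr \<Omega> borel (M_from x (s + t))) y = (if x - b * (s + t) \<le> y then height_cdf (s + t) y else 0)"
        by (simp add: prob_M_from_le[OF st])
      let ?A = "{\<omega> \<in> space \<Omega>. M_from x s \<omega> \<le> y + b * t}" and ?B = "{\<omega> \<in> space \<Omega>. M0 t \<omega> \<le> y}"
      have AB: "?A \<in> sets \<Omega>" "?B \<in> sets \<Omega>"
        using M_from_measurable[OF s, of x] M0_measurable[OF t] by measurable
      have "cdf (distr (\<Omega> \<Otimes>\<^sub>M \<Omega>) borel (\<lambda>(\<omega>, \<omega>'). M_from (M_from x s \<omega>) t \<omega>')) y =
          measure (\<Omega> \<Otimes>\<^sub>M \<Omega>) {p \<in> space (\<Omega> \<Otimes>\<^sub>M \<Omega>). M_from (M_from x s (fst p)) t (snd p) \<le> y}"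
        unfolding cdf_def by (subst measure_distr[OF m]) (auto intro!: arg_cong[of _ _ "measure (\<Omega> \<Otimes>\<^sub>M \<Omega>)"])
      also have "{p \<in> space (\<Omega> \<Otimes>\<^sub>M \<Omega>). M_from (M_from x s (fst p)) t (snd p) \<le> y} = (if 0 \<le> y then ?A \<times> ?B else {})"
        by (auto simp: M_from_def[of "M_from x s _"] space_pair_measure)
      also have "measure (\<Omega> \<Otimes>\<^sub>M \<Omega>) \<dots> = (if 0 \<le> y then prob ?A * height_cdf t y else 0)"
        by (simp add: measure_def emeasure_pair_measure_Times[OF AB] enn2real_mult height_cdf_def)
      also have "\<dots> = (if x - b * (s + t) \<le> y then height_cdf s (y + b * t) * height_cdf t y else 0)"
        using height_cdf_zero[OF t, of y] by (auto simp: prob_M_from_le[OF s] algebra_simps less_max_iff_disj)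
      finally show "cdf (distr \<Omega> borel (M_from x (s + t))) y = cdf (distr (\<Omega> \<Otimes>\<^sub>M \<Omega>) borel (\<lambda>(\<omega>, \<omega>'). M_from (M_from x s \<omega>) t \<omega>')) y"
        using 1 by (simp add: height_cdf_add[OF s t])
    qed
  qed (unfold_locales)
qed

text \<open>Through this bound the uniform continuity of \<open>f\<close> passes to \<open>P t f\<close>.\<close>

lemma M_from_lipschitz: "\<bar>M_from x t \<omega> - M_from y t \<omega>\<bar> \<le> \<bar>x - y\<bar>"
  by (auto simp: M_from_def max_def)

lemma P_maps_C0:
  assumes f: "f \<in> C0" and t: "0 \<le> t"
  shows "P t f \<in> C0"
proof -
  have diff: "\<bar>P t f x - P t f y\<bar> \<le> e" if "x \<ge> 0" "y \<ge> 0" "\<bar>x - y\<bar> \<le> d" and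
    d: "\<And>x y. x \<ge> 0 \<Longrightarrow> y \<ge> 0 \<Longrightarrow> \<bar>x - y\<bar> \<le> d \<Longrightarrow> \<bar>f x - f y\<bar> \<le> e" for x y e d
  proof -
    have "P t f x - P t f y = (\<integral>\<omega>. f (M_from x t \<omega>) - f (M_from y t \<omega>) \<partial>\<Omega>)"
      using that by (simp add: P_eq C0_M_from_integrable f t)
    moreover have "\<bar>\<integral>\<omega>. f (M_from x t \<omega>) - f (M_from y t \<omega>) \<partial>\<Omega>\<bar> \<le> (\<integral>\<omega>. \<bar>f (M_from x t \<omega>) - f (M_from y t \<omega>)\<bar> \<partial>\<Omega>)"
      by (rule integral_abs_bound)
    moreover have "\<dots> \<le> (\<integral>\<omega>. e \<partial>\<Omega>)"
    proof (rule integral_mono)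
      show "\<bar>f (M_from x t \<omega>) - f (M_from y t \<omega>)\<bar> \<le> e" for \<omega>
        using M_from_lipschitz[of x t \<omega> y] that(3) by (intro d M_from_nonneg) linarith
    qed (simp_all add: C0_M_from_integrable f t)
    ultimately have "\<bar>P t f x - P t f y\<bar> \<le> (\<integral>\<omega>. e \<partial>\<Omega>)" by linarith
    then show ?thesis by (simp add: prob_space)
  qed
  have "continuous_on {0..} (P t f)"
    unfolding continuous_on_iff
  proof (intro ballI allI impI)
    fix x e :: real assume x: "x \<in> {0..}" and e: "e > 0"
    obtain d where d: "d > 0" "\<And>x y. x \<ge> 0 \<Longrightarrow> y \<ge> 0 \<Longrightarrow> \<bar>x - y\<bar> \<le> d \<Longrightarrow> \<bar>f x - f y\<bar> \<le> e / 2"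
      using C0_uniformly_continuous[OF f, of "e/2"] e by auto
    have "dist (P t f y) (P t f x) < e" if "y \<in> {0..}" "dist y x < d" for y
      using diff[of y x d "e/2", OF _ _ _ d(2)] that x e by (auto simp: dist_real_def)
    then show "\<exists>d>0. \<forall>x'\<in>{0..}. dist x' x < d \<longrightarrow> dist (P t f x') (P t f x) < e" using d(1) by blast
  qed
  moreover have "(P t f \<longlongrightarrow> 0) at_top"
  proof (rule tendstoI)
    fix e :: real assume e: "e > 0"
    have "(f \<longlongrightarrow> 0) at_top" using f by (simp add: C0_def)
    then have "eventually (\<lambda>x. \<bar>f x\<bar> < e / 2) at_top" using tendstoD[of f 0 at_top "e/2"] e by (simp add: dist_real_def)
    then obtain R where R: "\<And>x. x \<ge> R \<Longrightarrow> \<bar>f x\<bar> < e / 2" by (auto simp: eventually_at_top_linorder)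
    have "dist (P t f x) 0 < e" if "x \<ge> max 0 (R + b * t)" for x
    proof -
      have XR: "\<bar>f (M_from x t \<omega>)\<bar> \<le> e / 2" for \<omega>
      proof -
        have "R \<le> M_from x t \<omega>" using that by (simp add: M_from_def le_max_iff_disj)
        then show ?thesis using R by (simp add: less_imp_le)
      qed
      have "\<bar>P t f x\<bar> \<le> (\<integral>\<omega>. \<bar>f (M_from x t \<omega>)\<bar> \<partial>\<Omega>)" using that by (simp add: P_eq)
      also have "\<dots> \<le> (\<integral>\<omega>. e / 2 \<partial>\<Omega>)" using XR by (intro integral_mono) (simp_all add: C0_M_from_integrable f t)
      finally show ?thesis using e by (simp add: prob_space)
    qed
    then show "\<forall>\<^sub>F x in at_top. dist (P t f x) 0 < e" unfolding eventually_at_top_linorder by blast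
  qed
  moreover have "P t f \<in> extensional {0..}" by (simp add: esn_semigroup_def)
  ultimately show ?thesis by (simp add: C0_def)
qed

lemma P_add:
  assumes f: "f \<in> C0" and s: "0 \<le> s" and t: "0 \<le> t"
  shows "P (s + t) f = P s (P t f)"
proof (rule C0_ext)
  show "P (s + t) f \<in> C0" "P s (P t f) \<in> C0" using assms by (intro P_maps_C0; simp)+
  fix x :: real assume x: "x \<ge> 0"
  interpret PP: pair_prob_space \<Omega> \<Omega> ..
  let ?f = "\<lambda>z. f (max z 0)"
  have st: "0 \<le> s + t" using assms by simp
  have m[measurable]: "(\<lambda>(\<omega>, \<omega>'). M_from (M_from x s \<omega>) t \<omega>') \<in> borel_measurable (\<Omega> \<Otimes>\<^sub>M \<Omega>)"
    using M_from_measurable[OF s, of x] M0_measurable[OF t] unfolding M_from_def by measurable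
  obtain B where B: "\<And>x. x \<ge> 0 \<Longrightarrow> \<bar>f x\<bar> \<le> B" using C0_bounded[OF f] by metis
  have mf: "(\<lambda>(\<omega>, \<omega>'). ?f (M_from (M_from x s \<omega>) t \<omega>')) \<in> borel_measurable (\<Omega> \<Otimes>\<^sub>M \<Omega>)"
    using measurable_compose[OF m C0_extend_measurable[OF f]] by (simp add: case_prod_beta)
  have int: "integrable (\<Omega> \<Otimes>\<^sub>M \<Omega>) (\<lambda>(\<omega>, \<omega>'). ?f (M_from (M_from x s \<omega>) t \<omega>'))"
    using mf by (intro PP.integrable_const_bound[of _ B]) (auto simp: B)
  have "P (s + t) f x = (\<integral>\<omega>. ?f (M_from x (s + t) \<omega>) \<partial>\<Omega>)"
    using x by (simp add: P_eq M_from_nonneg max_absorb1)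
  also have "\<dots> = (\<integral>z. ?f z \<partial>distr \<Omega> borel (M_from x (s + t)))"
    by (rule integral_distr[symmetric]) (auto intro!: M_from_measurable st C0_extend_measurable f)
  also have "\<dots> = (\<integral>z. ?f z \<partial>distr (\<Omega> \<Otimes>\<^sub>M \<Omega>) borel (\<lambda>(\<omega>, \<omega>'). M_from (M_from x s \<omega>) t \<omega>'))"
    by (simp only: distr_M_from_add[OF s t])
  also have "\<dots> = (\<integral>p. ?f (case p of (\<omega>, \<omega>') \<Rightarrow> M_from (M_from x s \<omega>) t \<omega>') \<partial>(\<Omega> \<Otimes>\<^sub>M \<Omega>))"
    by (rule integral_distr) (auto intro!: m C0_extend_measurable f)
  also have "\<dots> = (\<integral>p. (case p of (\<omega>, \<omega>') \<Rightarrow> ?f (M_from (M_from x s \<omega>) t \<omega>')) \<partial>(\<Omega> \<Otimes>\<^sub>M \<Omega>))"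
    by (simp add: case_prod_beta)
  also have "\<dots> = (\<integral>\<omega>. (\<integral>\<omega>'. ?f (M_from (M_from x s \<omega>) t \<omega>') \<partial>\<Omega>) \<partial>\<Omega>)"
    by (rule PP.integral_fst'[OF int, symmetric, unfolded prod.case])
  also have "\<dots> = P s (P t f) x"
    using x by (simp add: P_eq M_from_nonneg max_absorb1)
  finally show "P (s + t) f x = P s (P t f) x" .
qed

lemma one_minus_cdf_le:
  assumes "0 \<le> t" "\<bar>b\<bar> * t < y"
  shows "1 - height_cdf t y \<le> t * tail (y - \<bar>b\<bar> * t)"
proof -
  have "- b * t \<le> \<bar>b\<bar> * t" "0 \<le> \<bar>b\<bar> * t" using assms(1) by (intro mult_right_mono, simp_all)
  then have "max 0 (- b * t) \<le> y" using assms by linarith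
  then show ?thesis
    using void_prob_ge[OF exceedance_le[OF assms]] assms(1) by (simp add: height_cdf_void tail_nonneg)
qed

text \<open>Started from \<open>x\<close>, the process stays within \<open>r\<close> of \<open>x\<close> for a short time, except when \<open>M0 t\<close>
  exceeds \<open>r\<close>; the probability of that event does not depend on \<open>x\<close>.\<close>

lemma P_strongly_continuous:
  assumes f: "f \<in> C0" and e: "0 < e"
  shows "\<exists>d>0. \<forall>t. 0 \<le> t \<and> t \<le> d \<longrightarrow> (\<forall>x\<ge>0. \<bar>P t f x - f x\<bar> \<le> e)"
proof -
  obtain r where r: "r > 0" "\<And>x y. x \<ge> 0 \<Longrightarrow> y \<ge> 0 \<Longrightarrow> \<bar>x - y\<bar> \<le> r \<Longrightarrow> \<bar>f x - f y\<bar> \<le> e / 2"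
    using C0_uniformly_continuous[OF f, of "e/2"] e by auto
  obtain B where B: "B \<ge> 0" "\<And>x. x \<ge> 0 \<Longrightarrow> \<bar>f x\<bar> \<le> B" using C0_bounded[OF f] by metis
  \<comment> \<open>Chosen such that \<open>t * c \<le> e\<close> gives \<open>2 * B * P(M0 t > r) \<le> e / 2\<close>.\<close>
  define c where "c = 4 * (B + 1) * (tail (r / 2) + 1)"
  have c: "c > 0" using B(1) tail_nonneg[of "r/2"] by (simp add: c_def)
  define d where "d = min (r / 2 / (\<bar>b\<bar> + 1)) (e / c)"
  have d: "d > 0" using r e c by (simp add: d_def)
  have "\<bar>P t f x - f x\<bar> \<le> e" if t: "0 \<le> t" "t \<le> d" and x: "x \<ge> 0" for t x
  proof -
    have "t \<le> r / 2 / (\<bar>b\<bar> + 1)" using t by (simp add: d_def)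
    then have "t * (\<bar>b\<bar> + 1) \<le> r / 2" by (subst (asm) pos_le_divide_eq) auto
    then have bt: "\<bar>b\<bar> * t \<le> r / 2" using t(1) by (simp add: algebra_simps)
    have bt2: "\<bar>b * t\<bar> \<le> r / 2" using bt t by (simp add: abs_mult)
    have tc: "t * c \<le> e" using t c by (simp add: d_def pos_le_divide_eq)
    have M1: "{\<omega> \<in> space \<Omega>. M0 t \<omega> \<le> r} \<in> sets \<Omega>" using M0_measurable[OF t(1)] by measurable
    let ?A = "{\<omega> \<in> space \<Omega>. \<not> M0 t \<omega> \<le> r}"
    have A: "?A \<in> sets \<Omega>" using M0_measurable[OF t(1)] by measurable
    have "prob ?A = 1 - height_cdf t r" unfolding height_cdf_def by (rule prob_neg[OF M1])
    also have "\<dots> \<le> t * tail (r - \<bar>b\<bar> * t)" using bt r(1) by (intro one_minus_cdf_le t) linarith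
    also have "\<dots> \<le> t * tail (r / 2)" using bt r(1) t by (intro mult_left_mono tail_antimono) auto
    finally have pA: "prob ?A \<le> t * tail (r / 2)" .
    have pt: "\<bar>f (M_from x t \<omega>) - f x\<bar> \<le> e / 2 + 2 * B * indicator ?A \<omega>" if w: "\<omega> \<in> space \<Omega>" for \<omega>
    proof (cases "M0 t \<omega> \<le> r")
      case True
      then have "\<bar>M_from x t \<omega> - x\<bar> \<le> r" using bt2 x r(1) by (auto simp: M_from_def max_def)
      then show ?thesis using r(2)[OF M_from_nonneg[of x t \<omega>] x] True by simp
    next
      case False
      then show ?thesis using B(2)[OF M_from_nonneg[of x t \<omega>]] B(2)[OF x] e w by (simp add: indicator_def)
    qed
    have "P t f x - f x = (\<integral>\<omega>. f (M_from x t \<omega>) - f x \<partial>\<Omega>)"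
      using x t by (simp add: P_eq C0_M_from_integrable f prob_space)
    also have "\<bar>\<dots>\<bar> \<le> (\<integral>\<omega>. \<bar>f (M_from x t \<omega>) - f x\<bar> \<partial>\<Omega>)" by (rule integral_abs_bound)
    also have "\<dots> \<le> (\<integral>\<omega>. e / 2 + 2 * B * indicator ?A \<omega> \<partial>\<Omega>)"
      using t A pt by (intro integral_mono) (simp_all add: C0_M_from_integrable f emeasure_eq_measure)
    also have "\<dots> = e / 2 + 2 * B * prob ?A" using A by (simp add: prob_space emeasure_eq_measure)
    also have "2 * B * prob ?A \<le> 2 * (B + 1) * (t * (tail (r / 2) + 1))"
      using pA B(1) t(1) tail_nonneg[of "r/2"] by (intro mult_mono) (auto simp: algebra_simps)
    also have "2 * (B + 1) * (t * (tail (r / 2) + 1)) = t * c / 2" by (simp add: c_def algebra_simps)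
    finally show ?thesis using tc by linarith
  qed
  then show ?thesis using d by blast
qed

sublocale esn: C0_contraction_semigroup P
proof
  fix f assume f: "f \<in> C0"
  show "P t f \<in> C0" if "0 \<le> t" for t using f that by (rule P_maps_C0)
  show "P (s + t) f = P s (P t f)" if "0 \<le> s" "0 \<le> t" for s t using f that by (rule P_add)
  show "\<exists>d>0. \<forall>t. 0 \<le> t \<and> t \<le> d \<longrightarrow> (\<forall>x\<ge>0. \<bar>P t f x - f x\<bar> \<le> e)" if "0 < e" for e
    using f that by (rule P_strongly_continuous)
  show "\<bar>P t f x\<bar> \<le> B" if "0 \<le> t" "\<And>x. x \<ge> 0 \<Longrightarrow> \<bar>f x\<bar> \<le> B" "0 \<le> x" for t x B
  proof -
    have "\<bar>P t f x\<bar> \<le> (\<integral>\<omega>. \<bar>f (M_from x t \<omega>)\<bar> \<partial>\<Omega>)" using that by (simp add: P_eq)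
    also have "\<dots> \<le> (\<integral>\<omega>. B \<partial>\<Omega>)" using that by (intro integral_mono) (simp_all add: M_from_nonneg C0_M_from_integrable f)
    finally show ?thesis by (simp add: prob_space)
  qed
  show "P t (\<lambda>x\<in>{0..}. a * f x + c * g x) x = a * P t f x + c * P t g x"
    if "g \<in> C0" "0 \<le> t" "0 \<le> x" for g a c t x
    using that by (simp add: P_eq M_from_nonneg C0_M_from_integrable f)
  show "P 0 f = f"
  proof (rule C0_ext[OF P_maps_C0[OF f order_refl] f])
    fix x :: real assume x: "x \<ge> 0"
    have "1 - height_cdf 0 y \<le> 0" if "0 < y" for y using one_minus_cdf_le[of 0 y] that by simp
    have cdf0: "height_cdf 0 0 = 1"
    proof -
      have "exceedance 0 0 = 0"
      proof -
        have "exceedance 0 0 = (\<integral>\<^sup>+ s. 0 \<partial>(lborel :: real measure))"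
          unfolding exceedance_def
        proof (rule nn_integral_cong_AE)
          show "AE s in lborel. emeasure \<mu> {max 0 (0 + b * (0 - s))<..} * indicator {0..0} s = 0"
            using AE_lborel_singleton[of 0] by eventually_elim auto
        qed
        then show ?thesis by simp
      qed
      then show ?thesis by (simp add: height_cdf_void void_prob_def)
    qed
    have "AE \<omega> in \<Omega>. M0 0 \<omega> \<le> 0"
      using cdf0 M0_measurable[of 0] unfolding height_cdf_def by (subst (asm) prob_Collect_eq_1) auto
    then have "AE \<omega> in \<Omega>. f (M_from x 0 \<omega>) = f x" by eventually_elim (use x in \<open>simp add: M_from_def\<close>)
    then have "(\<integral>\<omega>. f (M_from x 0 \<omega>) \<partial>\<Omega>) = (\<integral>\<omega>. f x \<partial>\<Omega>)"
      by (intro integral_cong_AE) (simp_all add: C0_M_from_measurable f)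
    then show "P 0 f x = f x" using x by (simp add: P_eq prob_space)
  qed
qed

end

section \<open>Primitives of compactly supported functions\<close>

definition cont_supp :: "real \<Rightarrow> real \<Rightarrow> (real \<Rightarrow> real) \<Rightarrow> bool" where
  "cont_supp a c g \<longleftrightarrow> continuous_on UNIV g \<and> (\<forall>x. x \<notin> {a..c} \<longrightarrow> g x = 0)"

text \<open>The primitive of \<open>g\<close> that vanishes at \<open>\<infinity>\<close>. It is defined on the whole line, and its constancy to
  the left of the support of \<open>g\<close> removes the boundary at \<open>0\<close> from most computations.\<close>

definition prim :: "(real \<Rightarrow> real) \<Rightarrow> real \<Rightarrow> real" where
  "prim g x = - (\<integral>v. indicator {x..} v * g v \<partial>lborel)"

definition bdd_supp :: "real \<Rightarrow> real \<Rightarrow> (real \<Rightarrow> real) \<Rightarrow> bool" where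
  "bdd_supp a c h \<longleftrightarrow> h \<in> borel_measurable borel \<and> (\<exists>C. \<forall>x. \<bar>h x\<bar> \<le> C) \<and> (\<forall>x. x \<notin> {a..c} \<longrightarrow> h x = 0)"

abbreviation hprim :: "(real \<Rightarrow> real) \<Rightarrow> real \<Rightarrow> real" where
  "hprim g \<equiv> (\<lambda>x\<in>{0..}. prim g x)"

lemma cont_supp_continuous: "cont_supp a c g \<Longrightarrow> continuous_on S g"
  unfolding cont_supp_def by (rule continuous_on_subset[OF conjunct1]) auto

lemma cont_supp_bounded:
  assumes "cont_supp a c g"
  obtains G where "G \<ge> 0" "\<And>x. \<bar>g x\<bar> \<le> G"
proof -
  have "continuous_on {a..c} g" by (rule cont_supp_continuous[OF assms])
  then have "bounded (g ` {a..c})" by (intro compact_imp_bounded compact_continuous_image) auto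
  then obtain G where "\<forall>y\<in>g ` {a..c}. \<bar>y\<bar> \<le> G" unfolding bounded_real by blast
  then have G: "\<And>x. x \<in> {a..c} \<Longrightarrow> \<bar>g x\<bar> \<le> G" by blast
  have "\<bar>g x\<bar> \<le> max G 0" for x
    using G[of x] assms by (cases "x \<in> {a..c}") (auto simp: cont_supp_def)
  then show ?thesis using that[of "max G 0"] by auto
qed

lemma cont_supp_imp_bdd_supp:
  assumes "cont_supp a c g"
  shows "bdd_supp a c g"
proof -
  obtain G where "\<And>x. \<bar>g x\<bar> \<le> G" using cont_supp_bounded[OF assms] by blast
  moreover have "g \<in> borel_measurable borel"
    by (intro borel_measurable_continuous_onI cont_supp_continuous[OF assms])
  ultimately show ?thesis using assms unfolding bdd_supp_def cont_supp_def by blast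
qed

lemma bdd_supp_mult:
  assumes g: "bdd_supp a c g" and h: "h \<in> borel_measurable borel" "\<And>x. x \<in> {a..c} \<Longrightarrow> \<bar>h x\<bar> \<le> H"
  shows "bdd_supp a c (\<lambda>x. g x * h x)"
proof -
  obtain C where C: "\<And>x. \<bar>g x\<bar> \<le> C" using g by (auto simp: bdd_supp_def)
  have "\<bar>g x * h x\<bar> \<le> C * max H 0" for x
  proof (cases "x \<in> {a..c}")
    case True
    then show ?thesis unfolding abs_mult using C[of x] h(2)[OF True] by (intro mult_mono) auto
  next
    case False
    then have "g x = 0" using g by (auto simp: bdd_supp_def)
    then show ?thesis using C[of x] by simp
  qed
  then show ?thesis using g h(1) unfolding bdd_supp_def by auto
qed

lemma bdd_supp_integrable:
  assumes "bdd_supp a c h"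
  shows "integrable lborel h"
proof -
  obtain C where C: "\<And>x. \<bar>h x\<bar> \<le> C" using assms by (auto simp: bdd_supp_def)
  show ?thesis
    using assms C unfolding bdd_supp_def
    by (intro integrableI_bounded_set[of "{a..c}" _ _ C]) (auto simp: emeasure_lborel_Icc_eq)
qed

lemma bdd_supp_integrable_tail: "bdd_supp a c h \<Longrightarrow> integrable lborel (\<lambda>v. indicator {x..} v * h v)"
  using integrable_mult_indicator[OF _ bdd_supp_integrable, of "{x..}" a c h] by simp

lemma prim_diff:
  assumes "bdd_supp a c h" "x \<le> y"
  shows "prim h y - prim h x = (\<integral>v. indicator {x..<y} v * h v \<partial>lborel)"
proof -
  have "prim h y - prim h x = (\<integral>v. indicator {x..} v * h v - indicator {y..} v * h v \<partial>lborel)"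
    unfolding prim_def using assms by (subst Bochner_Integration.integral_diff) (auto intro: bdd_supp_integrable_tail)
  also have "\<dots> = (\<integral>v. indicator {x..<y} v * h v \<partial>lborel)"
    using assms by (intro Bochner_Integration.integral_cong) (auto simp: indicator_def)
  finally show ?thesis .
qed

lemma prim_diff_bound:
  assumes h: "bdd_supp a c h" and C: "\<And>v. \<bar>h v\<bar> \<le> C"
  shows "\<bar>prim h y - prim h x\<bar> \<le> C * \<bar>y - x\<bar>"
proof -
  have *: "\<bar>prim h y - prim h x\<bar> \<le> C * \<bar>y - x\<bar>" if "x \<le> y" for x y
  proof -
    have "\<bar>\<integral>v. indicator {x..<y} v * h v \<partial>lborel\<bar> \<le> (\<integral>v. \<bar>indicator {x..<y} v * h v\<bar> \<partial>lborel)" by (rule integral_abs_bound)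
    also have "\<dots> \<le> (\<integral>v. C * indicator {x..<y} v \<partial>lborel)"
    proof (rule integral_mono)
      show "integrable lborel (\<lambda>v. \<bar>indicator {x..<y} v * h v\<bar>)"
        using integrable_mult_indicator[OF _ bdd_supp_integrable[OF h], of "{x..<y}"] by (intro integrable_abs) simp
      show "integrable lborel (\<lambda>v. C * indicator {x..<y} v)"
        using that by (intro integrable_mult_right integrable_real_indicator) auto
      show "\<bar>indicator {x..<y} v * h v\<bar> \<le> C * indicator {x..<y} v" for v
        using C[of v] by (simp add: indicator_def)
    qed
    also have "\<dots> = C * \<bar>y - x\<bar>" using that by simp
    finally show ?thesis using prim_diff[OF h that] by simp
  qed
  show ?thesis using *[of x y] *[of y x] by (cases "x \<le> y") (auto simp: abs_minus_commute)
qed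

lemma prim_right:
  assumes "bdd_supp a c h" "c < x"
  shows "prim h x = 0"
proof -
  have "indicator {x..} v * h v = 0" for v
    using assms by (cases "x \<le> v") (auto simp: bdd_supp_def)
  then have "(\<lambda>v. indicator {x..} v * h v) = (\<lambda>v. 0)" by blast
  then show ?thesis unfolding prim_def by (simp only:) simp
qed

lemma prim_left:
  assumes h: "bdd_supp a c h" and "x \<le> a"
  shows "prim h x = prim h a"
proof -
  have "prim h a - prim h x = 0"
    unfolding prim_diff[OF assms] using h by (intro integral_eq_zero_AE) (auto simp: indicator_def bdd_supp_def)
  then show ?thesis by simp
qed

lemma prim_continuous:
  assumes "bdd_supp a c h"
  shows "continuous_on UNIV (prim h)"
proof -
  obtain C where C: "\<And>x. \<bar>h x\<bar> \<le> C" using assms by (auto simp: bdd_supp_def)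
  then have "C \<ge> 0" using abs_ge_zero order_trans by blast
  then have "C-lipschitz_on UNIV (prim h)"
    using prim_diff_bound[OF assms C] by (intro lipschitz_onI) (auto simp: dist_real_def abs_minus_commute)
  then show ?thesis by (rule lipschitz_on_continuous_on)
qed

lemma prim_C0:
  assumes "bdd_supp a c h"
  shows "(hprim h) \<in> C0"
proof -
  have "continuous_on {0..} (hprim h)"
    by (rule continuous_on_eq[OF continuous_on_subset[OF prim_continuous[OF assms]]]) auto
  moreover have "((hprim h) \<longlongrightarrow> 0) at_top"
    by (intro tendsto_eventually eventually_mono[OF eventually_gt_at_top[of "max c 0"]])
       (auto simp: prim_right[OF assms])
  ultimately show ?thesis by (simp add: C0_def)
qed

lemma cont_supp_C0:
  assumes "cont_supp a c g"
  shows "(\<lambda>x\<in>{0..}. g x) \<in> C0"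
proof -
  have "continuous_on {0..} (\<lambda>x\<in>{0..}. g x)"
    by (rule continuous_on_eq[OF cont_supp_continuous[OF assms]]) auto
  moreover have "((\<lambda>x\<in>{0..}. g x) \<longlongrightarrow> 0) at_top"
    using assms by (intro tendsto_eventually eventually_mono[OF eventually_gt_at_top[of "max c 0"]])
       (auto simp: cont_supp_def)
  ultimately show ?thesis by (simp add: C0_def)
qed

lemma prim_eq_integral:
  assumes g: "cont_supp a c g" and "A \<le> x" "x \<le> B" "c < B"
  shows "prim g x = integral {A..x} g - integral {A..B} g"
proof -
  have cont: "continuous_on S g" for S by (rule cont_supp_continuous[OF g])
  have "(\<integral>v. indicator {x..} v * g v \<partial>lborel) = (LINT v:{x..B}|lborel. g v)"
    unfolding set_lebesgue_integral_def using g assms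
    by (intro Bochner_Integration.integral_cong) (auto simp: indicator_def cont_supp_def)
  also have "\<dots> = integral {x..B} g"
    by (intro set_borel_integral_eq_integral borel_integrable_atLeastAtMost' cont)
  finally have "prim g x = - integral {x..B} g" by (simp add: prim_def)
  moreover have "integral {A..x} g + integral {x..B} g = integral {A..B} g"
    using assms by (intro Henstock_Kurzweil_Integration.integral_combine integrable_continuous_real cont) auto
  ultimately show ?thesis by simp
qed

lemma prim_has_derivative:
  assumes g: "cont_supp a c g"
  shows "(prim g has_real_derivative g x) (at x)"
proof -
  have cont: "continuous_on S g" for S by (rule cont_supp_continuous[OF g])
  define A B where "A = x - 1" and "B = max c x + 1"
  have "((\<lambda>y. integral {A..y} g) has_real_derivative g x) (at x within {A..B})"
    by (intro integral_has_real_derivative cont) (auto simp: A_def B_def)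
  then have "((\<lambda>y. integral {A..y} g) has_real_derivative g x) (at x)"
    by (simp add: at_within_Icc_at A_def B_def)
  then have "((\<lambda>y. integral {A..y} g - integral {A..B} g) has_real_derivative g x - 0) (at x)"
    by (intro derivative_intros)
  then have d: "((\<lambda>y. integral {A..y} g - integral {A..B} g) has_real_derivative g x) (at x)" by simp
  have "integral {A..y} g - integral {A..B} g = prim g y" if "y \<in> {A<..<B}" for y
    using prim_eq_integral[OF g, of A y B] that by (simp add: B_def)
  then show ?thesis
    by (intro has_field_derivative_transform_within_open[OF d, of "{A<..<B}"]) (auto simp: A_def B_def)
qed

lemma prim_linear_approx:
  assumes g: "cont_supp a c g" and e: "\<And>z. \<bar>z - x\<bar> \<le> \<bar>y - x\<bar> \<Longrightarrow> \<bar>g z - g x\<bar> \<le> e"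
  shows "\<bar>prim g y - prim g x - (y - x) * g x\<bar> \<le> \<bar>y - x\<bar> * e"
proof -
  have "\<exists>z. \<bar>z - x\<bar> \<le> \<bar>y - x\<bar> \<and> prim g y - prim g x = (y - x) * g z"
  proof (cases x y rule: linorder_cases)
    case less
    then obtain z where "x < z" "z < y" "prim g y - prim g x = (y - x) * g z"
      using MVT2[of x y "prim g" g] prim_has_derivative[OF g] by blast
    then show ?thesis by (intro exI[of _ z]) auto
  next
    case greater
    then obtain z where "y < z" "z < x" "prim g x - prim g y = (x - y) * g z"
      using MVT2[of y x "prim g" g] prim_has_derivative[OF g] by blast
    then show ?thesis by (intro exI[of _ z]) (auto simp: algebra_simps)
  qed auto
  then obtain z where z: "\<bar>z - x\<bar> \<le> \<bar>y - x\<bar>" "prim g y - prim g x = (y - x) * g z" by blast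
  have "prim g y - prim g x - (y - x) * g x = (y - x) * (g z - g x)" using z by (simp add: algebra_simps)
  then show ?thesis using e[OF z(1)] by (simp add: abs_mult mult_left_mono)
qed

lemma cont_supp_uniformly_continuous:
  assumes g: "cont_supp a c g" and e: "e > 0"
  obtains d where "d > 0" "\<And>x y. \<bar>x - y\<bar> \<le> d \<Longrightarrow> \<bar>g x - g y\<bar> \<le> e"
proof -
  have "uniformly_continuous_on {a - 1..c + 1} g"
    by (intro compact_uniformly_continuous cont_supp_continuous[OF g]) auto
  then obtain d where d: "d > 0" "\<And>x y. x \<in> {a - 1..c + 1} \<Longrightarrow> y \<in> {a - 1..c + 1} \<Longrightarrow> dist x y < d \<Longrightarrow> dist (g x) (g y) < e"
    unfolding uniformly_continuous_on_def using e by metis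
  show ?thesis
  proof (rule that[of "min (d / 2) 1"])
    show "min (d / 2) 1 > 0" using d by simp
    fix x y :: real assume xy: "\<bar>x - y\<bar> \<le> min (d / 2) 1"
    show "\<bar>g x - g y\<bar> \<le> e"
    proof (cases "x \<in> {a..c} \<or> y \<in> {a..c}")
      case True
      then have "x \<in> {a - 1..c + 1}" "y \<in> {a - 1..c + 1}" using xy by auto
      then show ?thesis using d(2)[of x y] xy d(1) by (auto simp: dist_real_def)
    next
      case False
      then show ?thesis using g e by (simp add: cont_supp_def)
    qed
  qed
qed

section \<open>The generator on primitives\<close>

context tail_measure
begin

lemma bdd_supp_mult_tail:
  assumes "0 < a" "bdd_supp a c g"
  shows "bdd_supp a c (\<lambda>v. g v * tail v)"
proof (rule bdd_supp_mult[OF assms(2) tail_measurable])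
  show "\<bar>tail x\<bar> \<le> tail a" if "x \<in> {a..c}" for x
    using tail_antimono[OF assms(1), of x] that by (simp add: tail_nonneg)
qed

lemma tail_shift_integrable:
  assumes "a + p > 0"
  shows "integrable lborel (\<lambda>v. indicator {a..c} v * tail (v + p))"
  using assms by (intro integrableI_bounded_set[of "{a..c}" _ _ "tail (a + p)"])
    (auto simp: tail_nonneg indicator_def emeasure_lborel_Icc_eq intro!: tail_antimono AE_I2)

text \<open>The integrals of two shifts of a function over \<open>[a, c]\<close> differ by boundary terms only, and
  monotonicity gives the difference of the shifts a sign. This \<open>L\<^sup>1\<close> estimate is what allows \<open>\<mu>\<close> to have
  atoms, at which the tail jumps.\<close>

lemma tail_shift_integral:
  assumes "0 < a + p" "p \<le> q"
  shows "(\<integral>v. indicator {a..c} v * (tail (v + p) - tail (v + q)) \<partial>lborel) \<le> (q - p) * tail (a + p)"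
proof -
  have shift: "(\<integral>v. indicator {a..c} v * tail (v + r) \<partial>lborel) = (\<integral>v. indicator {a + r..c + r} v * tail v \<partial>lborel)" for r
    by (subst lborel_integral_real_affine[where c=1 and t=r, of "\<lambda>v. indicator {a + r..c + r} v * tail v"])
       (auto simp: add.commute indicator_def intro!: Bochner_Integration.integral_cong)
  have int: "integrable lborel (\<lambda>v. indicator {a + r..c + r} v * tail v)" if "p \<le> r" for r
    using tail_shift_integrable[of "a + r" 0 "c + r"] that assms by simp
  have "(\<integral>v. indicator {a..c} v * (tail (v + p) - tail (v + q)) \<partial>lborel) =
      (\<integral>v. indicator {a..c} v * tail (v + p) \<partial>lborel) - (\<integral>v. indicator {a..c} v * tail (v + q) \<partial>lborel)"
    unfolding right_diff_distrib using assms
    by (intro Bochner_Integration.integral_diff tail_shift_integrable) auto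
  also have "\<dots> = (\<integral>v. indicator {a + p..c + p} v * tail v - indicator {a + q..c + q} v * tail v \<partial>lborel)"
    unfolding shift using assms by (intro Bochner_Integration.integral_diff[symmetric] int) auto
  also have "\<dots> \<le> (\<integral>v. tail (a + p) * indicator {a + p..a + q} v \<partial>lborel)"
  proof (rule integral_mono)
    show "indicator {a + p..c + p} v * tail v - indicator {a + q..c + q} v * tail v \<le> tail (a + p) * indicator {a + p..a + q} v" for v
      using assms tail_nonneg[of v] tail_nonneg[of "a + p"] tail_antimono[of "a + p" v] by (auto simp: indicator_def)
    show "integrable lborel (\<lambda>v. indicator {a + p..c + p} v * tail v - indicator {a + q..c + q} v * tail v)"
      by (intro Bochner_Integration.integrable_diff int order_refl assms(2))
    show "integrable lborel (\<lambda>v. tail (a + p) * indicator {a + p..a + q} v)"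
      by (intro integrable_mult_right integrable_real_indicator) (auto simp: emeasure_lborel_Icc_eq)
  qed
  also have "\<dots> = (q - p) * tail (a + p)" using assms by simp
  finally show ?thesis .
qed

end

context shot_noise
begin

text \<open>With \<open>i\<close> the exponent of the void probability, \<open>i - i\<^sup>2 \<le> 1 - exp (- i) \<le> i\<close>, and monotonicity of
  the tail encloses \<open>i / t\<close> between two shifts of it.\<close>

lemma one_minus_cdf_approx:
  assumes a: "0 < a" "a \<le> v" and t: "0 < t" and \<alpha>: "\<alpha> = (\<bar>b\<bar> + 1) * t" "\<alpha> \<le> a / 2"
  shows "\<bar>(1 - height_cdf t v) / t - tail v\<bar> \<le> tail (v - \<alpha>) - tail (v + \<alpha>) + t * (tail (a / 2))\<^sup>2"
proof -
  have bt: "\<bar>b\<bar> * t < \<alpha>" "0 \<le> \<bar>b\<bar> * t" "0 < \<alpha>" using t mult_pos_pos[of "\<bar>b\<bar> + 1" t] by (auto simp: \<alpha>(1) distrib_right)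
  have v: "\<bar>b\<bar> * t < v" using bt a \<alpha>(2) by linarith
  have "- b * t \<le> \<bar>b\<bar> * t" using t by (intro mult_right_mono) auto
  then have mx: "max 0 (- b * t) \<le> v" using v a by linarith
  define i where "i = enn2real (exceedance t v)"
  have Ile: "exceedance t v \<le> ennreal (t * tail (v - \<bar>b\<bar> * t))" using t v by (intro exceedance_le) auto
  then have fin: "exceedance t v < \<infinity>" by (rule le_less_trans) simp
  have Fi: "height_cdf t v = exp (- i)" using height_cdf_void[OF _ mx] t fin by (simp add: void_prob_def i_def)
  have i0: "0 \<le> i" by (simp add: i_def)
  have "i \<le> t * tail (v - \<bar>b\<bar> * t)" unfolding i_def using Ile t by (intro enn2real_leI) (auto simp: tail_nonneg)
  also have "\<dots> \<le> t * tail (v - \<alpha>)" using t bt a \<alpha>(2) by (intro mult_left_mono tail_antimono) auto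
  finally have i1: "i \<le> t * tail (v - \<alpha>)" .
  have "ennreal (t * tail (v + \<alpha>)) \<le> ennreal i"
    using exceedance_ge[OF t v bt(1)] fin by (simp add: i_def)
  then have i2: "t * tail (v + \<alpha>) \<le> i" using i0 by (simp add: ennreal_le_iff)
  have T: "tail (v - \<alpha>) \<le> tail (a / 2)" using a \<alpha>(2) by (intro tail_antimono) auto
  have "t * tail (v - \<alpha>) \<le> t * tail (a / 2)" using T t by (intro mult_left_mono) auto
  then have "i \<le> t * tail (a / 2)" using i1 by linarith
  then have "i\<^sup>2 \<le> (t * tail (a / 2))\<^sup>2" using i0 by (intro power_mono) auto
  then have i3: "i\<^sup>2 / t \<le> t * (tail (a / 2))\<^sup>2" using t by (simp add: power2_eq_square field_simps)
  have up: "1 - height_cdf t v \<le> i" using exp_ge_add_one_self[of "- i"] by (simp add: Fi)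
  have "1 + i \<le> exp i" by (rule exp_ge_add_one_self)
  then have "exp (- i) \<le> 1 / (1 + i)" using i0 by (simp add: exp_minus field_simps)
  also have "\<dots> \<le> 1 - i + i\<^sup>2" using i0 by (simp add: field_simps power2_eq_square)
  finally have low: "i - i\<^sup>2 \<le> 1 - height_cdf t v" by (simp add: Fi)
  have "(1 - height_cdf t v) / t \<le> tail (v - \<alpha>)" using up i1 t by (simp add: field_simps)
  moreover have "tail (v + \<alpha>) - i\<^sup>2 / t \<le> (1 - height_cdf t v) / t"
  proof -
    have "(t * tail (v + \<alpha>) - i\<^sup>2) / t \<le> (1 - height_cdf t v) / t" using low i2 t by (intro divide_right_mono) auto
    then show ?thesis using t by (simp add: diff_divide_distrib)
  qed
  moreover have "tail (v + \<alpha>) \<le> tail v" "tail v \<le> tail (v - \<alpha>)" using a \<alpha>(2) bt by (auto intro!: tail_antimono)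
  moreover have "0 \<le> t * (tail (a / 2))\<^sup>2" using t by simp
  ultimately show ?thesis using i3 by (simp only: abs_le_iff) linarith
qed

lemma height_cdf_measurable[measurable]: "0 \<le> t \<Longrightarrow> height_cdf t \<in> borel_measurable borel"
proof (rule borel_measurable_mono, rule monoI)
  fix x y :: real assume t: "0 \<le> t" and "x \<le> y"
  note [measurable] = M0_measurable[OF t]
  show "height_cdf t x \<le> height_cdf t y"
    unfolding height_cdf_def using \<open>x \<le> y\<close> by (intro finite_measure_mono) auto
qed

lemma integral_less_M0:
  assumes t: "0 \<le> t"
  shows "(\<integral>\<omega>. (if v < M0 t \<omega> then 1 else 0) \<partial>\<Omega>) = 1 - height_cdf t v"
proof -
  have ms: "{\<omega> \<in> space \<Omega>. M0 t \<omega> \<le> v} \<in> sets \<Omega>"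
    using M0_measurable[OF t] by (simp add: borel_measurable_iff_le)
  have ms': "space \<Omega> - {\<omega> \<in> space \<Omega>. M0 t \<omega> \<le> v} \<in> sets \<Omega>" using ms by (rule sets.compl_sets)
  have "(\<integral>\<omega>. (if v < M0 t \<omega> then 1 else 0) \<partial>\<Omega>) = (\<integral>\<omega>. indicator (space \<Omega> - {\<omega> \<in> space \<Omega>. M0 t \<omega> \<le> v}) \<omega> \<partial>\<Omega>)"
    by (intro Bochner_Integration.integral_cong) (auto simp: indicator_def)
  also have "\<dots> = prob (space \<Omega> - {\<omega> \<in> space \<Omega>. M0 t \<omega> \<le> v})" using ms' by simp
  also have "\<dots> = 1 - height_cdf t v" unfolding height_cdf_def by (rule prob_compl[OF ms])
  finally show ?thesis .
qed

text \<open>Write \<open>f (max z m) - f z\<close> as the integral of \<open>g\<close> over \<open>[z, m)\<close> and apply Fubini. The positive part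
  in the definition of the process is harmless because \<open>f\<close> is constant on \<open>(-\<infinity>, a]\<close>.\<close>

lemma P_prim:
  assumes g: "cont_supp a c g" and a: "0 < a" and t: "0 \<le> t" and x: "0 \<le> x"
  shows "P t (hprim g) x = prim g (x - b * t) + (\<integral>v. indicator {x - b * t..} v * (g v * (1 - height_cdf t v)) \<partial>lborel)"
proof -
  interpret PP: pair_sigma_finite \<Omega> "lborel :: real measure" ..
  note [measurable] = M0_measurable[OF t]
  have bs: "bdd_supp a c g" by (rule cont_supp_imp_bdd_supp[OF g])
  then have [measurable]: "g \<in> borel_measurable borel" by (simp add: bdd_supp_def)
  obtain G where G: "\<And>x. \<bar>g x\<bar> \<le> G" using cont_supp_bounded[OF g] by metis
  let ?z = "x - b * t"
  let ?k = "\<lambda>(\<omega>, v). indicator {?z..} v * (g v * (if v < M0 t \<omega> then 1 else 0))"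
  have pos: "prim g (max y 0) = prim g y" for y
    using prim_left[OF bs, of y] prim_left[OF bs, of 0] a by (cases "y \<le> 0") auto
  have eq: "prim g (M_from x t \<omega>) - prim g ?z = (\<integral>v. ?k (\<omega>, v) \<partial>lborel)" for \<omega>
  proof -
    have "M_from x t \<omega> = max (max ?z (M0 t \<omega>)) 0" by (auto simp: M_from_def max_def)
    then have "prim g (M_from x t \<omega>) - prim g ?z = prim g (max ?z (M0 t \<omega>)) - prim g ?z" by (simp only: pos)
    also have "\<dots> = (\<integral>v. indicator {?z..<max ?z (M0 t \<omega>)} v * g v \<partial>lborel)" by (rule prim_diff[OF bs]) simp
    also have "\<dots> = (\<integral>v. ?k (\<omega>, v) \<partial>lborel)"
      by (intro Bochner_Integration.integral_cong) (auto simp: indicator_def)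
    finally show ?thesis .
  qed
  have km[measurable]: "?k \<in> borel_measurable (\<Omega> \<Otimes>\<^sub>M lborel)" by measurable
  have "integrable (\<Omega> \<Otimes>\<^sub>M lborel) ?k"
  proof (rule integrableI_bounded_set[of "space \<Omega> \<times> {a..c}" _ _ G])
    show "emeasure (\<Omega> \<Otimes>\<^sub>M lborel) (space \<Omega> \<times> {a..c}) < \<infinity>"
      by (subst lborel.emeasure_pair_measure_Times) (auto simp: emeasure_space_1 emeasure_lborel_Icc_eq)
    show "AE p in \<Omega> \<Otimes>\<^sub>M lborel. p \<in> space \<Omega> \<times> {a..c} \<longrightarrow> norm (?k p) \<le> G"
    proof (intro AE_I2 impI)
      fix p :: "'w \<times> real"
      have "norm (?k p) \<le> \<bar>g (snd p)\<bar>" by (simp add: case_prod_beta indicator_def)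
      then show "norm (?k p) \<le> G" using G[of "snd p"] by linarith
    qed
    show "AE p in \<Omega> \<Otimes>\<^sub>M lborel. p \<notin> space \<Omega> \<times> {a..c} \<longrightarrow> ?k p = 0"
    proof (intro AE_I2 impI)
      fix p :: "'w \<times> real" assume "p \<in> space (\<Omega> \<Otimes>\<^sub>M lborel)" "p \<notin> space \<Omega> \<times> {a..c}"
      then have "snd p \<notin> {a..c}" by (auto simp: space_pair_measure)
      then have "g (snd p) = 0" using g by (simp add: cont_supp_def)
      then show "?k p = 0" by (simp add: case_prod_beta)
    qed
    show "space \<Omega> \<times> {a..c} \<in> sets (\<Omega> \<Otimes>\<^sub>M lborel)" by (intro pair_measureI) auto
  qed (rule km)
  note Fub = PP.Fubini_integral[OF this] and int = this
  have "P t (hprim g) x = (\<integral>\<omega>. prim g (M_from x t \<omega>) \<partial>\<Omega>)"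
    using x by (simp add: P_eq M_from_nonneg)
  also have "\<dots> = (\<integral>\<omega>. prim g ?z + (\<integral>v. ?k (\<omega>, v) \<partial>lborel) \<partial>\<Omega>)"
  proof (rule Bochner_Integration.integral_cong[OF refl])
    fix \<omega>
    show "prim g (M_from x t \<omega>) = prim g ?z + (\<integral>v. ?k (\<omega>, v) \<partial>lborel)" using eq[of \<omega>] by linarith
  qed
  also have "\<dots> = (\<integral>\<omega>. prim g ?z \<partial>\<Omega>) + (\<integral>\<omega>. (\<integral>v. ?k (\<omega>, v) \<partial>lborel) \<partial>\<Omega>)"
    by (rule Bochner_Integration.integral_add[OF _ PP.integrable_fst'[OF int]]) simp
  also have "(\<integral>\<omega>. prim g ?z \<partial>\<Omega>) = prim g ?z" by (simp add: prob_space)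
  also have "(\<integral>\<omega>. (\<integral>v. ?k (\<omega>, v) \<partial>lborel) \<partial>\<Omega>) = (\<integral>v. (\<integral>\<omega>. ?k (\<omega>, v) \<partial>\<Omega>) \<partial>lborel)"
    unfolding prod.case by (rule Fub[symmetric])
  also have "\<dots> = (\<integral>v. indicator {?z..} v * (g v * (1 - height_cdf t v)) \<partial>lborel)"
  proof (rule Bochner_Integration.integral_cong[OF refl])
    fix v :: real
    have "(\<integral>\<omega>. ?k (\<omega>, v) \<partial>\<Omega>) = indicator {?z..} v * (g v * (\<integral>\<omega>. (if v < M0 t \<omega> then 1 else 0) \<partial>\<Omega>))"
      unfolding prod.case by (simp only: integral_mult_right_zero)
    then show "(\<integral>\<omega>. ?k (\<omega>, v) \<partial>\<Omega>) = indicator {?z..} v * (g v * (1 - height_cdf t v))"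
      by (simp only: integral_less_M0[OF t])
  qed
  finally show ?thesis .
qed

text \<open>The value of the generator at \<open>prim g\<close>, written in terms of \<open>g\<close>; \<open>esn_operator_prim\<close> below
  identifies it with the integro-differential operator of the theorem.\<close>

definition prim_operator :: "(real \<Rightarrow> real) \<Rightarrow> real \<Rightarrow> real" where
  "prim_operator g = (\<lambda>x\<in>{0..}. - prim (\<lambda>v. g v * tail v) x - b * g x)"

lemma prim_operator_C0:
  assumes g: "cont_supp a c g" and a: "0 < a"
  shows "prim_operator g \<in> C0"
proof -
  have "(\<lambda>x\<in>{0..}. (- 1) * (\<lambda>x\<in>{0..}. prim (\<lambda>v. g v * tail v) x) x + (- b) * (\<lambda>x\<in>{0..}. g x) x) \<in> C0"
    by (rule C0_linear[OF prim_C0[OF bdd_supp_mult_tail[OF a cont_supp_imp_bdd_supp[OF g]]] cont_supp_C0[OF g]])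
  moreover have "prim_operator g = (\<lambda>x\<in>{0..}. (- 1) * (\<lambda>x\<in>{0..}. prim (\<lambda>v. g v * tail v) x) x + (- b) * (\<lambda>x\<in>{0..}. g x) x)"
    unfolding prim_operator_def by (rule restrict_ext) simp
  ultimately show ?thesis by (simp only:)
qed

text \<open>The difference quotient splits into the drift \<open>(f (x - b t) - f x) / t\<close>, the replacement of
  \<open>(1 - height_cdf t) / t\<close> by the tail under the integral, and the shift of the lower integration limit
  from \<open>x - b t\<close> to \<open>x\<close>. The last two errors are at most a constant times \<open>t\<close>, uniformly in \<open>x\<close>.\<close>

lemma generator_prim:
  assumes g: "cont_supp a c g" and a: "0 < a" and ac: "a \<le> c"
  shows "is_generator_value P (hprim g) (prim_operator g)"
  unfolding is_generator_value_iff
proof (intro conjI prim_operator_C0[OF g a] allI impI)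
  fix e :: real assume e: "e > 0"
  have bs: "bdd_supp a c g" by (rule cont_supp_imp_bdd_supp[OF g])
  have bt: "bdd_supp a c (\<lambda>v. g v * tail v)" by (rule bdd_supp_mult_tail[OF a bs])
  then obtain C where C: "\<And>v. \<bar>g v * tail v\<bar> \<le> C" by (auto simp: bdd_supp_def)
  have C0: "C \<ge> 0" by (rule order_trans[OF abs_ge_zero C])
  obtain G where G: "G \<ge> 0" "\<And>x. \<bar>g x\<bar> \<le> G" using cont_supp_bounded[OF g] by metis
  have iI: "integrable lborel (indicator {a..c} :: real \<Rightarrow> real)"
    by (intro integrable_real_indicator) (auto simp: emeasure_lborel_Icc_eq)
  define T where "T = tail (a / 2)"
  have T0: "T \<ge> 0" by (simp add: T_def tail_nonneg)
  have e': "e / (2 * (\<bar>b\<bar> + 1)) > 0" using e by (intro divide_pos_pos) auto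
  obtain r where r: "r > 0" "\<And>x y. \<bar>x - y\<bar> \<le> r \<Longrightarrow> \<bar>g x - g y\<bar> \<le> e / (2 * (\<bar>b\<bar> + 1))"
    using cont_supp_uniformly_continuous[OF g e'] by blast
  \<comment> \<open>\<open>t * K\<close> bounds the two errors in the jump part. The bound \<open>d\<close> on \<open>t\<close> keeps the shift \<open>\<alpha>\<close> below the
    modulus of continuity \<open>r\<close> and below \<open>a / 2\<close>, and these errors below \<open>e / 2\<close>.\<close>
  define K where "K = G * (2 * (\<bar>b\<bar> + 1) * T + (c - a) * T\<^sup>2) + C * \<bar>b\<bar>"
  have K0: "K \<ge> 0" unfolding K_def using G C0 T0 ac by (intro add_nonneg_nonneg mult_nonneg_nonneg) auto
  define d where "d = min (min (r / (\<bar>b\<bar> + 1)) (a / 2 / (\<bar>b\<bar> + 1))) (e / 2 / (K + 1))"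
  have d: "d > 0" using r a e K0 by (simp add: d_def)
  have "\<bar>(P t (hprim g) x - (hprim g) x) / t - prim_operator g x\<bar> \<le> e"
    if t: "0 < t" "t < d" and x: "x \<ge> 0" for t x
  proof -
    define \<alpha> where "\<alpha> = (\<bar>b\<bar> + 1) * t"
    have b1: "\<bar>b\<bar> + 1 > 0" by simp
    have "t \<le> r / (\<bar>b\<bar> + 1)" "t \<le> a / 2 / (\<bar>b\<bar> + 1)" "t \<le> e / 2 / (K + 1)" using t by (auto simp: d_def)
    then have "t * (\<bar>b\<bar> + 1) \<le> r" "t * (\<bar>b\<bar> + 1) \<le> a / 2" "t * (K + 1) \<le> e / 2"
      using K0 by (simp_all only: pos_le_divide_eq[OF b1]) (subst (asm) pos_le_divide_eq; simp)
    then have \<alpha>: "\<alpha> \<le> r" "\<alpha> \<le> a / 2" "t * K \<le> e / 2" using t by (auto simp: \<alpha>_def algebra_simps)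
    have bta: "\<bar>b * t\<bar> \<le> \<alpha>" using t by (simp add: abs_mult \<alpha>_def algebra_simps)
    let ?z = "x - b * t"
    have A: "\<bar>(prim g ?z - prim g x) / t + b * g x\<bar> \<le> e / 2"
    proof -
      have "\<bar>prim g ?z - prim g x - (?z - x) * g x\<bar> \<le> \<bar>?z - x\<bar> * (e / (2 * (\<bar>b\<bar> + 1)))"
        by (rule prim_linear_approx[OF g r(2)]) (use bta \<alpha>(1) in auto)
      then have "\<bar>prim g ?z - prim g x - t * (- (b * g x))\<bar> \<le> t * (\<bar>b\<bar> * (e / (2 * (\<bar>b\<bar> + 1))))"
        using t by (simp add: abs_mult algebra_simps)
      also have "\<bar>b\<bar> * (e / (2 * (\<bar>b\<bar> + 1))) \<le> e / 2" using e by (simp add: field_simps)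
      finally have "t * \<bar>(prim g ?z - prim g x) / t - (- (b * g x))\<bar> \<le> t * (e / 2)"
        using t unfolding mult_abs_quotient[OF t(1)] by (simp add: mult_left_mono)
      then show ?thesis using t by simp
    qed
    define q where "q v = (1 - height_cdf t v) / t - tail v" for v
    have qm[measurable]: "q \<in> borel_measurable borel" unfolding q_def using height_cdf_measurable[OF less_imp_le[OF t(1)]] tail_measurable
      by (intro borel_measurable_diff borel_measurable_divide) auto
    have q: "\<bar>q v\<bar> \<le> tail (v - \<alpha>) - tail (v + \<alpha>) + t * T\<^sup>2" if "a \<le> v" for v
      unfolding q_def T_def using one_minus_cdf_approx[OF a that t(1) \<alpha>_def \<alpha>(2)] .
    have qb: "\<bar>q v\<bar> \<le> T + t * T\<^sup>2" if "a \<le> v" for v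
    proof -
      have "tail (v - \<alpha>) \<le> T" unfolding T_def using that a \<alpha>(2) by (intro tail_antimono) auto
      then show ?thesis using q[OF that] tail_nonneg[of "v + \<alpha>"] by linarith
    qed
    have bq: "bdd_supp a c (\<lambda>v. g v * q v)" by (rule bdd_supp_mult[OF bs qm]) (rule qb, simp)
    have "(\<integral>v. indicator {?z..} v * (g v * (1 - height_cdf t v)) \<partial>lborel) / t
        = (\<integral>v. indicator {?z..} v * (g v * q v) + indicator {?z..} v * (g v * tail v) \<partial>lborel)"
      using t by (subst integral_divide_zero[symmetric], intro Bochner_Integration.integral_cong) (auto simp: q_def field_simps)
    also have "\<dots> = - prim (\<lambda>v. g v * q v) ?z - prim (\<lambda>v. g v * tail v) ?z"
      unfolding prim_def by (subst Bochner_Integration.integral_add) (auto intro: bdd_supp_integrable_tail bq bt)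
    finally have B: "(\<integral>v. indicator {?z..} v * (g v * (1 - height_cdf t v)) \<partial>lborel) / t = - prim (\<lambda>v. g v * q v) ?z - prim (\<lambda>v. g v * tail v) ?z" .
    let ?D = "\<lambda>v. indicator {a..c} v * (tail (v + (- \<alpha>)) - tail (v + \<alpha>))"
    have "\<bar>prim (\<lambda>v. g v * q v) ?z\<bar> \<le> (\<integral>v. \<bar>indicator {?z..} v * (g v * q v)\<bar> \<partial>lborel)"
      unfolding prim_def abs_minus_cancel by (rule integral_abs_bound)
    also have "\<dots> \<le> (\<integral>v. G * (?D v + t * T\<^sup>2 * indicator {a..c} v) \<partial>lborel)"
    proof (rule integral_mono)
      show "integrable lborel (\<lambda>v. \<bar>indicator {?z..} v * (g v * q v)\<bar>)" by (intro integrable_abs bdd_supp_integrable_tail[OF bq])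
      show "integrable lborel (\<lambda>v. G * (?D v + t * T\<^sup>2 * indicator {a..c} v))"
        unfolding right_diff_distrib[of "indicator _ _"] using iI a \<alpha>(2) bta
        by (intro integrable_mult_right Bochner_Integration.integrable_add Bochner_Integration.integrable_diff tail_shift_integrable) auto
      show "\<bar>indicator {?z..} v * (g v * q v)\<bar> \<le> G * (?D v + t * T\<^sup>2 * indicator {a..c} v)" for v
      proof (cases "v \<in> {a..c}")
        case True
        have "\<bar>indicator {?z..} v * (g v * q v)\<bar> \<le> \<bar>g v\<bar> * \<bar>q v\<bar>" by (simp add: indicator_def abs_mult)
        also have "\<dots> \<le> G * (tail (v - \<alpha>) - tail (v + \<alpha>) + t * T\<^sup>2)"
          using True G q[of v] by (intro mult_mono) auto
        finally show ?thesis using True by simp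
      next
        case False
        then show ?thesis using bs by (simp add: bdd_supp_def)
      qed
    qed
    also have "\<dots> = G * ((\<integral>v. ?D v \<partial>lborel) + t * T\<^sup>2 * (c - a))"
    proof -
      have "integrable lborel (\<lambda>v. ?D v)"
        unfolding right_diff_distrib[of "indicator _ _"] using iI a \<alpha>(2) bta
        by (intro Bochner_Integration.integrable_diff tail_shift_integrable) auto
      then show ?thesis using ac iI by (subst integral_mult_right_zero) simp
    qed
    also have "\<dots> \<le> G * (2 * \<alpha> * T + t * T\<^sup>2 * (c - a))"
    proof -
      have "(\<integral>v. ?D v \<partial>lborel) \<le> (\<alpha> - (- \<alpha>)) * tail (a + (- \<alpha>))"
        using a \<alpha>(2) bta by (intro tail_shift_integral) auto
      also have "\<dots> \<le> (\<alpha> - (- \<alpha>)) * T"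
        unfolding T_def using a \<alpha>(2) bta by (intro mult_left_mono tail_antimono) auto
      finally show ?thesis using G by (intro mult_left_mono add_right_mono) auto
    qed
    finally have Q: "\<bar>prim (\<lambda>v. g v * q v) ?z\<bar> \<le> t * (G * (2 * (\<bar>b\<bar> + 1) * T + (c - a) * T\<^sup>2))"
      by (simp add: \<alpha>_def algebra_simps)
    have "\<bar>prim (\<lambda>v. g v * tail v) ?z - prim (\<lambda>v. g v * tail v) x\<bar> \<le> C * \<bar>?z - x\<bar>"
      by (rule prim_diff_bound[OF bt C])
    also have "\<dots> = t * (C * \<bar>b\<bar>)" using t by (simp add: abs_mult)
    finally have R: "\<bar>prim (\<lambda>v. g v * tail v) ?z - prim (\<lambda>v. g v * tail v) x\<bar> \<le> t * (C * \<bar>b\<bar>)" .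
    have "(P t (hprim g) x - (hprim g) x) / t - prim_operator g x =
       ((prim g ?z - prim g x) / t + b * g x) - prim (\<lambda>v. g v * q v) ?z
        - (prim (\<lambda>v. g v * tail v) ?z - prim (\<lambda>v. g v * tail v) x)"
      using x t by (simp add: P_prim[OF g a _ x] prim_operator_def add_divide_distrib diff_divide_distrib B)
    moreover have "t * (G * (2 * (\<bar>b\<bar> + 1) * T + (c - a) * T\<^sup>2)) + t * (C * \<bar>b\<bar>) = t * K" by (simp add: K_def algebra_simps)
    ultimately show ?thesis using A Q R \<alpha>(3) by linarith
  qed
  then show "\<exists>d>0. \<forall>t. 0 < t \<and> t < d \<longrightarrow> (\<forall>x\<ge>0. \<bar>(P t (hprim g) x - (hprim g) x) / t - prim_operator g x\<bar> \<le> e)"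
    using d by blast
qed

end

section \<open>Density of the range of one minus the generator\<close>

lemma cont_supp_widen: "cont_supp a c g \<Longrightarrow> a' \<le> a \<Longrightarrow> c \<le> c' \<Longrightarrow> cont_supp a' c' g"
  by (auto simp: cont_supp_def)

lemma prim_unique:
  assumes k: "cont_supp a c k"
    and V: "\<And>x. x \<ge> 0 \<Longrightarrow> (V has_real_derivative k x) (at x)"
    and B: "\<And>x. x \<ge> B \<Longrightarrow> V x = 0" and x: "x \<ge> 0"
  shows "prim k x = V x"
proof -
  have "\<exists>d. \<forall>x\<in>{0..}. prim k x - V x = d"
  proof (rule has_field_derivative_zero_constant)
    show "((\<lambda>x. prim k x - V x) has_field_derivative 0) (at x within {0..})" if "x \<in> {0..}" for x
      using DERIV_diff[OF prim_has_derivative[OF k] V, of x] that by (auto intro: has_field_derivative_at_within)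
  qed simp
  then obtain d where d: "\<And>x. x \<ge> 0 \<Longrightarrow> prim k x - V x = d" by auto
  have "d = 0" using d[of "max 0 (max B (c + 1))"] B prim_right[OF cont_supp_imp_bdd_supp[OF k]] by simp
  then show ?thesis using d[OF x] by simp
qed

text \<open>Shift \<open>h\<close> to the right, which makes it constant near \<open>0\<close>, truncate its small values to \<open>0\<close>, which
  makes it vanish near \<open>\<infinity>\<close>, and average over short intervals, which makes it differentiable.\<close>

lemma prims_dense_in_C0:
  assumes h: "h \<in> C0" and e: "e > 0"
  obtains a c k where "0 < a" "a \<le> c" "cont_supp a c k" "\<And>x. x \<ge> 0 \<Longrightarrow> \<bar>prim k x - h x\<bar> \<le> e"
proof -
  have e2: "e / 2 > 0" using e by simp
  obtain d where d: "d > 0" "\<And>x y. x \<ge> 0 \<Longrightarrow> y \<ge> 0 \<Longrightarrow> \<bar>x - y\<bar> \<le> d \<Longrightarrow> \<bar>h x - h y\<bar> \<le> e / 2"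
    using C0_uniformly_continuous[OF h e2] by blast
  define s where "s = d / 2"
  have s: "s > 0" "2 * s \<le> d" using d by (auto simp: s_def)
  have "(h \<longlongrightarrow> 0) at_top" using h by (simp add: C0_def)
  then have "eventually (\<lambda>x. \<bar>h x\<bar> < e / 2) at_top" using tendstoD[of h 0 at_top "e/2"] e2 by (simp add: dist_real_def)
  then obtain R0 where R0: "\<And>x. x \<ge> R0 \<Longrightarrow> \<bar>h x\<bar> < e / 2" by (auto simp: eventually_at_top_linorder)
  define R where "R = max R0 0 + 2 * s"
  define h' where "h' x = h (max (x - 2 * s) 0)" for x
  have h'_cont: "continuous_on UNIV h'"
    unfolding h'_def
    by (rule continuous_on_compose2[OF C0_extend_continuous[OF h], of UNIV "\<lambda>x. x - 2 * s"]) (auto intro!: continuous_intros)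
  define H where "H x = h' x - max (- (e / 2)) (min (e / 2) (h' x))" for x
  have H_cont: "continuous_on UNIV H" unfolding H_def by (intro continuous_intros h'_cont)
  have Hh: "\<bar>H x - h' x\<bar> \<le> e / 2" for x using e2 by (auto simp: H_def)
  have H_right: "H x = 0" if "x \<ge> R" for x
  proof -
    have "\<bar>h' x\<bar> < e / 2" unfolding h'_def by (rule R0) (use that in \<open>auto simp: R_def\<close>)
    then show ?thesis by (auto simp: H_def)
  qed
  have H_left: "H x = H 0" if "x \<le> 2 * s" for x using that s by (simp add: H_def h'_def)
  define k where "k x = (H (x + s) - H x) / s" for x
  have R: "R \<ge> s" using s by (simp add: R_def)
  have "continuous_on UNIV (\<lambda>x. H (x + s))"
    by (rule continuous_on_compose2[OF H_cont]) (auto intro!: continuous_intros)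
  then have kc: "continuous_on UNIV k"
    unfolding k_def using s by (intro continuous_on_divide continuous_on_diff H_cont) auto
  have k: "cont_supp s R k"
    unfolding cont_supp_def
  proof (intro conjI kc allI impI)
    fix x assume "x \<notin> {s..R}"
    then consider "x < s" | "x > R" by force
    then show "k x = 0"
    proof cases
      case 1
      then show ?thesis using H_left[of x] H_left[of "x + s"] s by (simp add: k_def)
    next
      case 2
      then show ?thesis using H_right[of x] H_right[of "x + s"] s by (simp add: k_def)
    qed
  qed
  \<comment> \<open>\<open>K\<close> agrees with \<open>H\<close> on the half-line but has compact support, so \<open>prim K\<close> is an antiderivative of \<open>H\<close> there.\<close>
  define K where "K x = H x * max 0 (min 1 (x + 2))" for x
  have K: "cont_supp (- 2) R K"
    unfolding cont_supp_def K_def using H_right by (auto intro!: continuous_intros H_cont)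
  have KH: "K x = H x" if "x \<ge> 0" for x using that by (simp add: K_def)
  define V where "V x = (prim K (x + s) - prim K x) / s" for x
  have Vk: "prim k x = V x" if "x \<ge> 0" for x
  proof (rule prim_unique[OF k _ _ that])
    fix x :: real assume x: "x \<ge> 0"
    have "((\<lambda>x. prim K (x + s)) has_real_derivative K (x + s)) (at x)"
      using prim_has_derivative[OF K, of "x + s"] by (simp add: DERIV_shift)
    then have "(V has_real_derivative (K (x + s) - K x) / s) (at x)"
      unfolding V_def by (intro DERIV_cdivide DERIV_diff prim_has_derivative[OF K])
    then show "(V has_real_derivative k x) (at x)" using x s by (simp add: KH k_def)
  next
    fix x assume "x \<ge> R + 1"
    then show "V x = 0" using prim_right[OF cont_supp_imp_bdd_supp[OF K]] s by (simp add: V_def)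
  qed
  have "\<bar>prim k x - h x\<bar> \<le> e" if x: "x \<ge> 0" for x
  proof -
    have "\<exists>z. z > x \<and> z < x + s \<and> prim K (x + s) - prim K x = (x + s - x) * K z"
      by (rule MVT2) (use s prim_has_derivative[OF K] in auto)
    then obtain z where z: "x < z" "z < x + s" "prim K (x + s) - prim K x = s * K z" by auto
    then have "prim k x = H z" using Vk[OF x] x s KH[of z] by (simp add: V_def)
    moreover have "\<bar>h' z - h x\<bar> \<le> e / 2" unfolding h'_def by (rule d(2)) (use z x s in auto)
    ultimately show ?thesis using Hh[of z] by linarith
  qed
  then show ?thesis using that[OF s(1) R k] by blast
qed

lemma prim_mono:
  assumes "bdd_supp a c w" "\<And>x. 0 \<le> w x" "x \<le> y"
  shows "prim w x \<le> prim w y"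
proof -
  have "0 \<le> (\<integral>v. indicator {x..<y} v * w v \<partial>lborel)" using assms(2) by (intro integral_nonneg_AE) auto
  then show ?thesis using prim_diff[OF assms(1,3)] by simp
qed

text \<open>Variation of constants for \<open>b g' + w g = k\<close>. With \<open>\<Phi> = prim (k e\<^sup>Q)\<close>, the function
  \<open>g = \<Phi> e\<^bsup>-Q\<^esup> / b\<close> solves the equation, and it vanishes on the left of the support of \<open>k\<close> because of
  the orthogonality assumption. The bound on \<open>g\<close> does not depend on \<open>w\<close>: one integrates \<open>k e\<^sup>Q\<close> from the side on
  which \<open>Q\<close> is smaller than at \<open>x\<close>.\<close>

lemma exact_solution:
  assumes w: "cont_supp p q w" "\<And>x. 0 \<le> w x" and b: "b \<noteq> 0"
    and k: "cont_supp a c k" and ac: "0 < a" "a \<le> c"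
    and Q: "Q = (\<lambda>x. prim w x / b)"
    and orth: "(\<integral>v. k v * exp (Q v) \<partial>lborel) = 0"
  obtains g where "cont_supp a c g" "\<And>x. \<bar>g x\<bar> \<le> (\<integral>v. \<bar>k v\<bar> \<partial>lborel) / \<bar>b\<bar>"
    "\<And>x. x \<ge> 0 \<Longrightarrow> prim (\<lambda>v. g v * w v) x + b * g x = prim k x"
proof -
  have Qd: "(Q has_real_derivative w x / b) (at x)" for x
    unfolding Q using b by (intro DERIV_cdivide prim_has_derivative[OF w(1)])
  have Qc: "continuous_on S Q" for S
    by (rule DERIV_continuous_on[OF has_field_derivative_at_within[OF Qd]])
  define kE where "kE v = k v * exp (Q v)" for v
  have kE: "cont_supp a c kE"
    unfolding cont_supp_def kE_def using k
    by (auto simp: cont_supp_def intro!: continuous_intros Qc cont_supp_continuous[OF k])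
  have bkE: "bdd_supp a c kE" by (rule cont_supp_imp_bdd_supp[OF kE])
  have bk: "bdd_supp a c k" by (rule cont_supp_imp_bdd_supp[OF k])
  define \<Phi> where "\<Phi> = prim kE"
  define g where "g x = \<Phi> x * exp (- Q x) / b" for x
  have \<Phi>d: "(\<Phi> has_real_derivative kE x) (at x)" for x
    unfolding \<Phi>_def by (rule prim_has_derivative[OF kE])
  have \<Phi>_left: "\<Phi> x = 0" if "x \<le> a" for x
  proof -
    have "prim kE a = - (\<integral>v. kE v \<partial>lborel)"
      unfolding prim_def using kE
      by (intro arg_cong[of _ _ uminus] Bochner_Integration.integral_cong) (auto simp: indicator_def cont_supp_def)
    then show ?thesis using orth prim_left[OF bkE that] by (simp add: \<Phi>_def kE_def)
  qed
  have \<Phi>_right: "\<Phi> x = 0" if "x > c" for x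
    unfolding \<Phi>_def by (rule prim_right[OF bkE that])
  have gd: "(g has_real_derivative (k x - w x * g x) / b) (at x)" for x
  proof -
    have "((\<lambda>x. \<Phi> x * exp (- Q x) / b) has_real_derivative (kE x * exp (- Q x) + \<Phi> x * (exp (- Q x) * (- (w x / b)))) / b) (at x)"
      by (rule DERIV_cdivide) (auto intro!: derivative_eq_intros \<Phi>d Qd)
    then have "(g has_real_derivative (kE x * exp (- Q x) + \<Phi> x * (exp (- Q x) * (- (w x / b)))) / b) (at x)"
      unfolding g_def .
    moreover have "kE x * exp (- Q x) = k x" by (simp add: kE_def exp_minus field_simps)
    moreover have "\<Phi> x * (exp (- Q x) * (- (w x / b))) = - (w x * g x)" by (simp add: g_def)
    ultimately show ?thesis by simp
  qed
  have gc: "continuous_on S g" for S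
    by (rule DERIV_continuous_on[OF has_field_derivative_at_within[OF gd]])
  have g: "cont_supp a c g"
    unfolding cont_supp_def using gc \<Phi>_left \<Phi>_right by (auto simp: g_def not_le)
  have gw: "cont_supp a c (\<lambda>v. g v * w v)"
    unfolding cont_supp_def using g by (auto simp: cont_supp_def intro!: continuous_intros gc cont_supp_continuous[OF w(1)])
  have sol: "prim (\<lambda>v. g v * w v) x + b * g x = prim k x" if "x \<ge> 0" for x
  proof (rule prim_unique[OF k _ _ that, symmetric])
    fix x :: real
    have "((\<lambda>x. prim (\<lambda>v. g v * w v) x + b * g x) has_real_derivative g x * w x + b * ((k x - w x * g x) / b)) (at x)"
      by (intro DERIV_add DERIV_cmult gd prim_has_derivative[OF gw])
    then show "((\<lambda>x. prim (\<lambda>v. g v * w v) x + b * g x) has_real_derivative k x) (at x)" using b by simp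
  next
    fix x assume "x \<ge> c + 1"
    then show "prim (\<lambda>v. g v * w v) x + b * g x = 0"
      using prim_right[OF cont_supp_imp_bdd_supp[OF gw]] g by (simp add: cont_supp_def)
  qed
  have Qmono: "(x \<le> y \<Longrightarrow> b > 0 \<Longrightarrow> Q x \<le> Q y)" "(x \<le> y \<Longrightarrow> b < 0 \<Longrightarrow> Q y \<le> Q x)" for x y
  proof -
    have "prim w x \<le> prim w y" if "x \<le> y"
      by (rule prim_mono[OF cont_supp_imp_bdd_supp[OF w(1)] w(2) that])
    then show "(x \<le> y \<Longrightarrow> b > 0 \<Longrightarrow> Q x \<le> Q y)" "(x \<le> y \<Longrightarrow> b < 0 \<Longrightarrow> Q y \<le> Q x)"
      by (auto simp: Q divide_right_mono divide_right_mono_neg)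
  qed
  have bnd: "\<bar>\<integral>v. indicator S v * kE v \<partial>lborel\<bar> \<le> exp (Q x) * (\<integral>v. \<bar>k v\<bar> \<partial>lborel)"
    if "S \<in> sets borel" "\<And>v. v \<in> S \<Longrightarrow> Q v \<le> Q x" for S x
  proof -
    have "\<bar>\<integral>v. indicator S v * kE v \<partial>lborel\<bar> \<le> (\<integral>v. \<bar>indicator S v * kE v\<bar> \<partial>lborel)" by (rule integral_abs_bound)
    also have "\<dots> \<le> (\<integral>v. exp (Q x) * \<bar>k v\<bar> \<partial>lborel)"
    proof (rule integral_mono)
      show "integrable lborel (\<lambda>v. \<bar>indicator S v * kE v\<bar>)"
        using integrable_mult_indicator[OF _ bdd_supp_integrable[OF bkE], of S] that(1) by (intro integrable_abs) simp
      show "integrable lborel (\<lambda>v. exp (Q x) * \<bar>k v\<bar>)" by (intro integrable_mult_right integrable_abs bdd_supp_integrable[OF bk])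
      show "\<bar>indicator S v * kE v\<bar> \<le> exp (Q x) * \<bar>k v\<bar>" for v
        using that(2)[of v] by (auto simp: indicator_def kE_def abs_mult mult.commute[of "exp _"] intro!: mult_left_mono)
    qed
    finally show ?thesis by simp
  qed
  have \<Phi>b: "\<bar>\<Phi> x\<bar> \<le> exp (Q x) * (\<integral>v. \<bar>k v\<bar> \<partial>lborel)" for x
  proof (cases "b > 0")
    case True
    have "\<Phi> x = prim kE x - prim kE (min a x)" using \<Phi>_left[of "min a x"] by (simp add: \<Phi>_def)
    also have "\<dots> = (\<integral>v. indicator {min a x..<x} v * kE v \<partial>lborel)" by (rule prim_diff[OF bkE]) simp
    finally show ?thesis using bnd[of "{min a x..<x}" x] Qmono(1)[OF _ True] by auto
  next
    case False
    then have "b < 0" using b by simp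
    then show ?thesis unfolding \<Phi>_def prim_def abs_minus_cancel using Qmono(2) by (intro bnd) auto
  qed
  have "\<bar>g x\<bar> \<le> (\<integral>v. \<bar>k v\<bar> \<partial>lborel) / \<bar>b\<bar>" for x
  proof -
    have "\<bar>g x\<bar> = \<bar>\<Phi> x\<bar> * exp (- Q x) / \<bar>b\<bar>" by (simp add: g_def abs_mult)
    also have "\<dots> \<le> (exp (Q x) * (\<integral>v. \<bar>k v\<bar> \<partial>lborel)) * exp (- Q x) / \<bar>b\<bar>"
      by (intro divide_right_mono mult_right_mono \<Phi>b) auto
    also have "\<dots> = (\<integral>v. \<bar>k v\<bar> \<partial>lborel) / \<bar>b\<bar>" by (simp add: exp_minus field_simps)
    finally show ?thesis .
  qed
  then show ?thesis using that[OF g _ sol] by blast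
qed

lemma bump_exists:
  fixes p q :: real
  assumes "p < q"
  obtains \<psi> where "cont_supp p q \<psi>" "\<And>x. 0 \<le> \<psi> x" "(\<integral>v. \<psi> v \<partial>lborel) > 0"
proof -
  define \<psi> where "\<psi> x = max 0 (min (x - p) (q - x))" for x
  define r where "r = (q - p) / 4"
  have \<psi>: "cont_supp p q \<psi>" unfolding cont_supp_def \<psi>_def by (auto intro!: continuous_intros)
  have r: "r > 0" using assms by (simp add: r_def)
  have "0 < r * (2 * r)" using r by simp
  also have "r * (2 * r) = (\<integral>v. r * indicator {p + r..q - r} v \<partial>lborel)" using r by (simp add: r_def field_simps)
  also have "\<dots> \<le> (\<integral>v. \<psi> v \<partial>lborel)"
  proof (rule integral_mono)
    show "integrable lborel (\<lambda>v. r * indicator {p + r..q - r} v)"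
      by (intro integrable_mult_right integrable_real_indicator) (auto simp: emeasure_lborel_Icc_eq)
    show "integrable lborel \<psi>" by (rule bdd_supp_integrable[OF cont_supp_imp_bdd_supp[OF \<psi>]])
    show "r * indicator {p + r..q - r} v \<le> \<psi> v" for v by (auto simp: indicator_def \<psi>_def)
  qed
  finally show ?thesis using that[OF \<psi>] by (simp add: \<psi>_def)
qed

context tail_measure
begin

text \<open>Averaging the decreasing tail over \<open>[x - s, x]\<close> gives a continuous function between \<open>tail x\<close> and
  \<open>tail (x - s)\<close>. Staying above the tail is what \<open>bump_location\<close> needs; a cutoff outside \<open>[a, c]\<close> makes
  the support compact, so that \<open>prim w\<close> makes sense.\<close>

lemma continuous_majorant:
  assumes a: "0 < a" "a \<le> c" and e: "e > 0"
  obtains p q w where "cont_supp p q w" "\<And>x. 0 \<le> w x" "\<And>x. x \<in> {a..c} \<Longrightarrow> 1 + tail x \<le> w x"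
    "(\<integral>v. indicator {a..c} v * (w v - 1 - tail v) \<partial>lborel) \<le> e"
proof -
  define s where "s = min (a / 2) (e / (tail (a / 2) + 1))"
  have t1: "tail (a / 2) + 1 > 0" using tail_nonneg[of "a/2"] by simp
  have s: "s > 0" "s \<le> a / 2" using a e t1 unfolding s_def by (simp, intro min.cobounded1)
  have "s \<le> e / (tail (a / 2) + 1)" by (simp add: s_def)
  then have st: "s * (tail (a / 2) + 1) \<le> e" using t1 by (simp add: pos_le_divide_eq)
  define tl where "tl v = indicator {a / 2..c} v * tail v" for v
  have tl: "bdd_supp (a / 2) c tl"
    unfolding bdd_supp_def
  proof (intro conjI exI[of _ "tail (a/2)"] allI impI)
    show "tl \<in> borel_measurable borel" unfolding tl_def by measurable
    show "\<bar>tl x\<bar> \<le> tail (a / 2)" for x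
      using tail_nonneg[of x] tail_nonneg[of "a / 2"] tail_antimono[of "a / 2" x] a by (simp add: tl_def indicator_def)
  qed (simp add: tl_def)
  define avg where "avg x = (prim tl x - prim tl (x - s)) / s" for x
  have avg: "avg x = (\<integral>v. indicator {x - s..<x} v * tl v \<partial>lborel) / s" for x
    unfolding avg_def using s by (subst prim_diff[OF tl]) auto
  have avg_nonneg: "0 \<le> avg x" for x
    unfolding avg using s by (intro divide_nonneg_pos integral_nonneg_AE) (auto simp: tl_def tail_nonneg)
  have avg_le: "avg x \<le> tail (x - s)" and avg_ge: "tail x \<le> avg x" if x: "x \<in> {a..c}" for x
  proof -
    have int: "integrable lborel (\<lambda>v. indicator {x - s..<x} v * tl v)"
      using integrable_mult_indicator[OF _ bdd_supp_integrable[OF tl], of "{x - s..<x}"] by simp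
    have int': "integrable lborel (\<lambda>v. C * indicator {x - s..<x} v)" for C :: real
      using s by (intro integrable_mult_right integrable_real_indicator) auto
    have "(\<integral>v. indicator {x - s..<x} v * tl v \<partial>lborel) \<le> (\<integral>v. tail (x - s) * indicator {x - s..<x} v \<partial>lborel)"
      using x s a by (intro integral_mono int int') (auto simp: tl_def indicator_def tail_nonneg intro!: tail_antimono)
    also have "\<dots> = tail (x - s) * s" using s by simp
    finally show "avg x \<le> tail (x - s)" unfolding avg using s by (simp add: field_simps)
    have "tail x * s = (\<integral>v. tail x * indicator {x - s..<x} v \<partial>lborel)" using s by simp
    also have "\<dots> \<le> (\<integral>v. indicator {x - s..<x} v * tl v \<partial>lborel)"
      using x s a by (intro integral_mono int int') (auto simp: tl_def indicator_def tail_nonneg intro!: tail_antimono)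
    finally show "tail x \<le> avg x" unfolding avg using s by (simp add: field_simps)
  qed
  define cut where "cut x = max 0 (min 1 (min (x - (a - 1)) (c + 1 - x)))" for x
  define w where "w x = (1 + avg x) * cut x" for x
  have avg_cont: "continuous_on UNIV avg"
  proof -
    have "continuous_on UNIV (\<lambda>x. prim tl (x - s))"
      by (rule continuous_on_compose2[OF prim_continuous[OF tl]]) (auto intro!: continuous_intros)
    then show ?thesis
      unfolding avg_def using s by (intro continuous_on_divide continuous_on_diff prim_continuous[OF tl]) auto
  qed
  have w: "cont_supp (a - 1) (c + 1) w"
    unfolding cont_supp_def w_def cut_def by (auto intro!: continuous_intros avg_cont)
  have w0: "0 \<le> w x" for x using avg_nonneg[of x] by (simp add: w_def cut_def)
  have w1: "w x = 1 + avg x" if "x \<in> {a..c}" for x using that by (simp add: w_def cut_def)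
  have tailint: "integrable lborel (\<lambda>v. indicator {a..c} v * (tail (v + (- s)) - tail (v + 0)))"
    unfolding right_diff_distrib using s a by (intro Bochner_Integration.integrable_diff tail_shift_integrable) auto
  have "(\<integral>v. indicator {a..c} v * (w v - 1 - tail v) \<partial>lborel) \<le> (\<integral>v. indicator {a..c} v * (tail (v + (- s)) - tail (v + 0)) \<partial>lborel)"
  proof (rule integral_mono'[OF tailint])
    show "indicator {a..c} v * (w v - 1 - tail v) \<le> indicator {a..c} v * (tail (v + (- s)) - tail (v + 0))" for v
      using w1[of v] avg_le[of v] by (auto simp: indicator_def)
    show "0 \<le> indicator {a..c} v * (tail (v + (- s)) - tail (v + 0))" for v
      using s a by (auto simp: indicator_def intro!: tail_antimono)
  qed
  also have "\<dots> \<le> (0 - (- s)) * tail (a + (- s))" by (rule tail_shift_integral) (use s a in auto)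
  also have "\<dots> \<le> s * tail (a / 2)" using s a by (auto intro!: mult_left_mono tail_antimono)
  also have "\<dots> \<le> e" using st s by (simp add: algebra_simps)
  finally show ?thesis using that[OF w w0] w1 avg_ge by fastforce
qed

lemma tail_integral_unbounded:
  assumes inf: "tail_diverges" and a: "0 < a"
  obtains q where "0 < q" "q < a" "K \<le> (\<integral>v. indicator {q..<a} v * tail v \<partial>lborel)"
proof (rule ccontr)
  note found = that
  assume "\<not> thesis"
  have less: "(\<integral>v. indicator {q..<a} v * tail v \<partial>lborel) < K" if "0 < q" "q < a" for q
  proof (rule ccontr)
    assume "\<not> (\<integral>v. indicator {q..<a} v * tail v \<partial>lborel) < K"
    then have "K \<le> (\<integral>v. indicator {q..<a} v * tail v \<partial>lborel)" by simp
    then show False using found[OF that] \<open>\<not> thesis\<close> by blast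
  qed
  define r where "r n = inverse (real (Suc n))" for n
  have r: "0 < r n" "r (Suc n) \<le> r n" for n unfolding r_def by (simp, intro le_imp_inverse_le) auto
  have r_small: "\<exists>n. r n < v" if "0 < v" for v unfolding r_def by (rule reals_Archimedean[OF that])
  define f where "f n v = ennreal (indicator {r n..<a} v * tail v)" for n v
  have fm[measurable]: "f n \<in> borel_measurable borel" for n unfolding f_def by measurable
  have inc: "incseq f"
  proof (rule incseq_SucI, rule le_funI)
    fix n v
    show "f n v \<le> f (Suc n) v"
      unfolding f_def using r(2)[of n] by (intro ennreal_leI) (auto simp: indicator_def tail_nonneg)
  qed
  have fK: "(\<integral>\<^sup>+v. f n v \<partial>lborel) \<le> ennreal \<bar>K\<bar>" for n
  proof (cases "r n < a")
    case True
    have "bdd_supp (r n) a (\<lambda>v. indicator {r n..<a} v * tail v)"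
      unfolding bdd_supp_def
    proof (intro conjI exI[of _ "tail (r n)"] allI impI)
      show "\<bar>indicator {r n..<a} x * tail x\<bar> \<le> tail (r n)" for x
        using tail_nonneg[of x] tail_nonneg[of "r n"] tail_antimono[OF r(1), of n x] by (simp add: indicator_def)
      show "indicator {r n..<a} x * tail x = 0" if "x \<notin> {r n..a}" for x
        using that by (auto simp: indicator_def)
    qed measurable
    then have "integrable lborel (\<lambda>v. indicator {r n..<a} v * tail v)" by (rule bdd_supp_integrable)
    then have "(\<integral>\<^sup>+v. f n v \<partial>lborel) = ennreal (\<integral>v. indicator {r n..<a} v * tail v \<partial>lborel)"
      unfolding f_def by (intro nn_integral_eq_integral) (auto simp: tail_nonneg)
    also have "\<dots> \<le> ennreal \<bar>K\<bar>" using less[OF r(1) True] by (intro ennreal_leI) linarith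
    finally show ?thesis .
  next
    case False
    then have "f n v = 0" for v by (auto simp: f_def indicator_def)
    then show ?thesis by simp
  qed
  have "(\<integral>\<^sup>+v. (SUP n. f n v) \<partial>lborel) = (SUP n. \<integral>\<^sup>+v. f n v \<partial>lborel)"
    by (rule nn_integral_monotone_convergence_SUP[OF inc]) simp
  also have "\<dots> \<le> ennreal \<bar>K\<bar>" by (intro SUP_least fK)
  finally have 1: "(\<integral>\<^sup>+v. (SUP n. f n v) \<partial>lborel) < \<infinity>" by (rule le_less_trans) simp
  have 2: "(\<integral>\<^sup>+v. ennreal (tail a) * indicator {0..1} v \<partial>(lborel :: real measure)) < \<infinity>"
    by (simp add: nn_integral_cmult_indicator)
  have "(\<integral>\<^sup>+v\<in>{0<..1}. emeasure \<mu> {v..} \<partial>lborel) \<le> (\<integral>\<^sup>+v. (SUP n. f n v) + ennreal (tail a) * indicator {0..1} v \<partial>lborel)"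
  proof (rule nn_integral_mono)
    fix v :: real
    show "emeasure \<mu> {v..} * indicator {0<..1} v \<le> (SUP n. f n v) + ennreal (tail a) * indicator {0..1} v"
    proof (cases "0 < v \<and> v \<le> 1")
      case True
      show ?thesis
      proof (cases "v < a")
        case vt: True
        obtain n where "r n < v" using r_small True by blast
        then have "emeasure \<mu> {v..} = f n v" using True vt by (simp add: f_def emeasure_tail)
        also have "\<dots> \<le> (SUP n. f n v)" by (rule SUP_upper) simp
        also have "\<dots> \<le> (SUP n. f n v) + ennreal (tail a) * indicator {0..1} v" by (rule add_increasing2) simp_all
        finally show ?thesis using True by (simp only: greaterThanAtMost_iff indicator_simps mult_1_right simp_thms)
      next
        case False
        then have "emeasure \<mu> {v..} \<le> ennreal (tail a)" using True a False by (simp add: emeasure_tail ennreal_leI tail_antimono)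
        then have "emeasure \<mu> {v..} \<le> (SUP n. f n v) + ennreal (tail a)" by (rule add_increasing[rotated]) simp
        then show ?thesis using True by simp
      qed
    qed auto
  qed
  also have "\<dots> = (\<integral>\<^sup>+v. (SUP n. f n v) \<partial>lborel) + (\<integral>\<^sup>+v. ennreal (tail a) * indicator {0..1} v \<partial>(lborel :: real measure))"
    by (intro nn_integral_add) measurable
  also have "\<dots> < \<infinity>" using 1 2 by simp
  finally show False using inf by simp
qed

text \<open>The error made by solving the equation with the continuous \<open>w\<close> instead of \<open>1 + tail\<close>.\<close>

lemma range_dense_aux:
  assumes k: "cont_supp a c k" and g: "cont_supp a c g" and ac: "0 < a" "a \<le> c"
    and w: "cont_supp p q w" "\<And>x. x \<in> {a..c} \<Longrightarrow> 1 + tail x \<le> w x"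
       "(\<integral>v. indicator {a..c} v * (w v - 1 - tail v) \<partial>lborel) \<le> e"
    and C: "\<And>x. \<bar>g x\<bar> \<le> C"
    and sol: "prim (\<lambda>v. g v * w v) x + b * g x = prim k x"
  shows "\<bar>prim g x + prim (\<lambda>v. g v * tail v) x + b * g x - prim k x\<bar> \<le> C * e"
proof -
  have bg: "bdd_supp a c g" by (rule cont_supp_imp_bdd_supp[OF g])
  have bt: "bdd_supp a c (\<lambda>v. g v * tail v)" by (rule bdd_supp_mult_tail[OF ac(1) bg])
  obtain W where W: "\<And>x. \<bar>w x\<bar> \<le> W" using cont_supp_bounded[OF w(1)] by blast
  have bw: "bdd_supp a c (\<lambda>v. g v * w v)"
    by (rule bdd_supp_mult[OF bg borel_measurable_continuous_onI[OF cont_supp_continuous[OF w(1)]] W])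
  have C0: "0 \<le> C" by (rule order_trans[OF abs_ge_zero C])
  note i1 = bdd_supp_integrable_tail[OF bg, of x] and i2 = bdd_supp_integrable_tail[OF bt, of x] and i3 = bdd_supp_integrable_tail[OF bw, of x]
  note i12 = Bochner_Integration.integrable_add[OF i1 i2]
  let ?d = "\<lambda>v. indicator {x..} v * g v + indicator {x..} v * (g v * tail v) - indicator {x..} v * (g v * w v)"
  have eq: "prim g x + prim (\<lambda>v. g v * tail v) x - prim (\<lambda>v. g v * w v) x
      = - (\<integral>v. ?d v \<partial>lborel)"
    unfolding prim_def Bochner_Integration.integral_diff[OF i12 i3] Bochner_Integration.integral_add[OF i1 i2] by simp
  have "\<bar>prim g x + prim (\<lambda>v. g v * tail v) x - prim (\<lambda>v. g v * w v) x\<bar>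
    \<le> (\<integral>v. \<bar>?d v\<bar> \<partial>lborel)"
    unfolding eq abs_minus_cancel by (rule integral_abs_bound)
  also have "\<dots> \<le> (\<integral>v. C * (indicator {a..c} v * (w v - 1 - tail v)) \<partial>lborel)"
  proof (rule integral_mono)
    show "integrable lborel (\<lambda>v. \<bar>?d v\<bar>)"
      by (rule integrable_abs[OF Bochner_Integration.integrable_diff[OF i12 i3]])
    have "bdd_supp a c (\<lambda>v. indicator {a..c} v * (w v - 1 - tail v))"
    proof (rule bdd_supp_mult)
      show "bdd_supp a c (indicator {a..c})" unfolding bdd_supp_def
        by (intro conjI exI[of _ 1] allI impI) (simp_all add: indicator_def)
      show "(\<lambda>v. w v - 1 - tail v) \<in> borel_measurable borel"
        using borel_measurable_continuous_onI[OF cont_supp_continuous[OF w(1)]] by measurable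
      show "\<bar>w v - 1 - tail v\<bar> \<le> W + 1 + tail a" if "v \<in> {a..c}" for v
        using W[of v] tail_antimono[OF ac(1), of v] tail_nonneg[of v] that by auto
    qed
    then show "integrable lborel (\<lambda>v. C * (indicator {a..c} v * (w v - 1 - tail v)))"
      by (intro integrable_mult_right bdd_supp_integrable)
    show "\<bar>?d v\<bar> \<le> C * (indicator {a..c} v * (w v - 1 - tail v))" for v
    proof (cases "v \<in> {a..c}")
      case True
      have "?d v
          = - (indicator {x..} v * (g v * (w v - 1 - tail v)))" by (simp add: algebra_simps)
      then have "\<bar>?d v\<bar>
         = indicator {x..} v * (\<bar>g v\<bar> * (w v - 1 - tail v))"
        using w(2)[OF True] by (simp add: abs_mult)
      also have "\<dots> \<le> \<bar>g v\<bar> * (w v - 1 - tail v)" using w(2)[OF True] by (simp add: indicator_def)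
      also have "\<dots> \<le> C * (w v - 1 - tail v)" using w(2)[OF True] by (intro mult_right_mono C) auto
      finally show ?thesis using True by simp
    next
      case False
      then show ?thesis using g by (simp add: cont_supp_def)
    qed
  qed
  also have "\<dots> \<le> C * e" using w(3) C0 by (simp add: mult_left_mono)
  finally show ?thesis using sol by linarith
qed

text \<open>A place \<open>[p, q]\<close> where the exponent \<open>prim w / b\<close> exceeds its maximum over \<open>[a, c]\<close> by \<open>D\<close>: far to the
  right if \<open>b > 0\<close>, where \<open>w \<ge> 1\<close> suffices, and close to \<open>0\<close> if \<open>b < 0\<close>, where \<open>w \<ge> tail\<close> and the divergence
  of the integral of the tail at \<open>0\<close> are used. The place is chosen before \<open>w\<close>, since the quality
  required of \<open>w\<close> depends on it.\<close>

lemma bump_location: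
  assumes b: "b \<noteq> 0" "0 < b \<or> tail_diverges"
    and ac: "0 < a" "a \<le> c" and D: "0 \<le> D"
  obtains p q where "0 < p" "p < q"
    "\<And>w p' q'. cont_supp p' q' w \<Longrightarrow> (\<And>x. 0 \<le> w x) \<Longrightarrow>
        (\<And>x. x \<in> {min a p..max c q} \<Longrightarrow> 1 + tail x \<le> w x) \<Longrightarrow>
        \<exists>A. (\<forall>v\<in>{a..c}. prim w v / b \<le> A) \<and> (\<forall>v\<in>{p..q}. A + D \<le> prim w v / b)"
proof (cases "b > 0")
  case True
  define p where "p = c + b * D + 1"
  have "0 \<le> b * D" using True D by simp
  then have p: "p \<ge> c" "0 < p" "b * D \<le> p - c" using ac by (auto simp: p_def)
  have gap: "\<exists>A. (\<forall>v\<in>{a..c}. prim w v / b \<le> A) \<and> (\<forall>v\<in>{p..p + 1}. A + D \<le> prim w v / b)"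
    if w: "cont_supp p' q' w" "\<And>x. 0 \<le> w x" "\<And>x. x \<in> {min a p..max c (p + 1)} \<Longrightarrow> 1 + tail x \<le> w x" for w p' q'
  proof -
    note bw = cont_supp_imp_bdd_supp[OF w(1)]
    have mono: "prim w x / b \<le> prim w y / b" if "x \<le> y" for x y
      using prim_mono[OF bw w(2) that] True by (intro divide_right_mono) auto
    have "p - c = (\<integral>v. indicator {c..<p} v \<partial>lborel)" using p by simp
    also have "\<dots> \<le> (\<integral>v. indicator {c..<p} v * w v \<partial>lborel)"
    proof (rule integral_mono)
      show "integrable lborel (\<lambda>v. indicator {c..<p} v * w v)"
        using integrable_mult_indicator[OF _ bdd_supp_integrable[OF bw], of "{c..<p}"] by simp
      show "integrable lborel (indicator {c..<p} :: real \<Rightarrow> real)" using p by (intro integrable_real_indicator) auto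
      show "indicator {c..<p} v \<le> indicator {c..<p} v * w v" for v
        using w(3)[of v] tail_nonneg[of v] ac p by (auto simp: indicator_def)
    qed
    also have "\<dots> = prim w p - prim w c" using prim_diff[OF bw p(1)] by simp
    finally have "b * D \<le> prim w p - prim w c" using p by simp
    then have "D \<le> (prim w p - prim w c) / b" using True by (simp add: pos_le_divide_eq mult.commute)
    then have gap: "prim w c / b + D \<le> prim w p / b" by (simp add: diff_divide_distrib)
    show ?thesis
    proof (intro exI[of _ "prim w c / b"] conjI ballI)
      show "prim w v / b \<le> prim w c / b" if "v \<in> {a..c}" for v using that by (intro mono) simp
      show "prim w c / b + D \<le> prim w v / b" if "v \<in> {p..p + 1}" for v using that by (intro order_trans[OF gap] mono) simp
    qed
  qed
  show ?thesis by (rule that[OF p(2) _ gap]) simp_all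
next
  case False
  then have b: "b < 0" "tail_diverges" using b by auto
  obtain q where q: "0 < q" "q < a" "- b * D \<le> (\<integral>v. indicator {q..<a} v * tail v \<partial>lborel)"
    using tail_integral_unbounded[OF b(2) ac(1)] by blast
  have gap: "\<exists>A. (\<forall>v\<in>{a..c}. prim w v / b \<le> A) \<and> (\<forall>v\<in>{q / 2..q}. A + D \<le> prim w v / b)"
    if w: "cont_supp p' q' w" "\<And>x. 0 \<le> w x" "\<And>x. x \<in> {min a (q / 2)..max c q} \<Longrightarrow> 1 + tail x \<le> w x" for w p' q'
  proof -
    note bw = cont_supp_imp_bdd_supp[OF w(1)]
    have mono: "prim w y / b \<le> prim w x / b" if "x \<le> y" for x y
      using prim_mono[OF bw w(2) that] b(1) by (intro divide_right_mono_neg) auto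
    have "(\<integral>v. indicator {q..<a} v * tail v \<partial>lborel) \<le> (\<integral>v. indicator {q..<a} v * w v \<partial>lborel)"
    proof (rule integral_mono')
      show "integrable lborel (\<lambda>v. indicator {q..<a} v * w v)"
        using integrable_mult_indicator[OF _ bdd_supp_integrable[OF bw], of "{q..<a}"] by simp
      show "indicator {q..<a} v * tail v \<le> indicator {q..<a} v * w v" for v
        using w(3)[of v] ac q by (auto simp: indicator_def)
      show "0 \<le> indicator {q..<a} v * w v" for v using w(2) by simp
    qed
    also have "\<dots> = prim w a - prim w q" using prim_diff[OF bw, of q a] q by simp
    finally have "- b * D \<le> prim w a - prim w q" using q(3) by linarith
    then have "D \<le> (prim w a - prim w q) / (- b)" using b(1) by (subst pos_le_divide_eq) (auto simp: mult.commute)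
    then have gap: "prim w a / b + D \<le> prim w q / b" by (simp add: diff_divide_distrib)
    show ?thesis
    proof (intro exI[of _ "prim w a / b"] conjI ballI)
      show "prim w v / b \<le> prim w a / b" if "v \<in> {a..c}" for v using that by (intro mono) simp
      show "prim w a / b + D \<le> prim w v / b" if "v \<in> {q / 2..q}" for v using that by (intro order_trans[OF gap] mono) simp
    qed
  qed
  show ?thesis by (rule that[OF _ _ gap]) (use q in simp_all)
qed

text \<open>Approximate \<open>h\<close> by \<open>prim k\<close>. If \<open>b \<noteq> 0\<close>, subtract from \<open>k\<close> the multiple \<open>\<kappa> \<psi>\<close> of a bump that makes
  \<open>exact_solution\<close> applicable; by \<open>bump_location\<close> its mass is at most \<open>N / exp (3 N / e) \<le> e / 3\<close>, where
  \<open>N\<close> is the \<open>L\<^sup>1\<close> norm of \<open>k\<close>.\<close>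

lemma range_dense:
  assumes b: "0 \<le> b \<or> tail_diverges"
    and h: "h \<in> C0" and e: "e > 0"
  obtains a c g where "0 < a" "a \<le> c" "cont_supp a c g"
    "\<And>x. x \<ge> 0 \<Longrightarrow> \<bar>prim g x + prim (\<lambda>v. g v * tail v) x + b * g x - h x\<bar> \<le> e"
proof -
  have e3: "e / 3 > 0" using e by simp
  obtain a0 c0 k where k: "0 < a0" "a0 \<le> c0" "cont_supp a0 c0 k" "\<And>x. x \<ge> 0 \<Longrightarrow> \<bar>prim k x - h x\<bar> \<le> e / 3"
    using prims_dense_in_C0[OF h e3] by blast
  have bk: "bdd_supp a0 c0 k" by (rule cont_supp_imp_bdd_supp[OF k(3)])
  define N where "N = (\<integral>v. \<bar>k v\<bar> \<partial>lborel)"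
  have N0: "N \<ge> 0" by (simp add: N_def)
  show ?thesis
  proof (cases "b = 0")
    case True
    obtain C where C: "C \<ge> 0" "\<And>x. \<bar>k x\<bar> \<le> C" using cont_supp_bounded[OF k(3)] by blast
    have eC: "e / 3 / (C + 1) > 0" using e3 C by simp
    obtain p q w where w: "cont_supp p q w" "\<And>x. 0 \<le> w x" "\<And>x. x \<in> {a0..c0} \<Longrightarrow> 1 + tail x \<le> w x"
      "(\<integral>v. indicator {a0..c0} v * (w v - 1 - tail v) \<partial>lborel) \<le> e / 3 / (C + 1)"
      using continuous_majorant[OF k(1,2) eC] by blast
    \<comment> \<open>On the support of \<open>k\<close> the maximum is \<open>w x\<close>; elsewhere it only keeps the quotient continuous.\<close>
    define g where "g x = k x / max 1 (w x)" for x
    have g: "cont_supp a0 c0 g"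
      unfolding cont_supp_def g_def using k(3)
      by (auto simp: cont_supp_def intro!: continuous_intros cont_supp_continuous[OF k(3)] cont_supp_continuous[OF w(1)])
    have gC: "\<bar>g x\<bar> \<le> C" for x
    proof -
      have "\<bar>g x\<bar> \<le> \<bar>k x\<bar>" by (simp add: g_def abs_divide divide_le_eq mult_le_cancel_left1)
      then show ?thesis using C(2)[of x] by linarith
    qed
    have "g v * w v = k v" for v
    proof (cases "v \<in> {a0..c0}")
      case True
      then have "w v \<ge> 1" using w(3)[OF True] tail_nonneg[of v] by linarith
      then show ?thesis by (simp add: g_def)
    qed (use k(3) in \<open>simp add: g_def cont_supp_def\<close>)
    then have sol: "prim (\<lambda>v. g v * w v) x + b * g x = prim k x" for x using True by simp
    have "C * (e / 3 / (C + 1)) \<le> e / 3" using C e3 by (simp add: field_simps)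
    then have "\<bar>prim g x + prim (\<lambda>v. g v * tail v) x + b * g x - h x\<bar> \<le> e" if "x \<ge> 0" for x
      using range_dense_aux[OF k(3) g k(1,2) w(1,3,4) gC sol, of x] k(4)[OF that] e3 by linarith
    then show ?thesis using that[OF k(1,2) g] by blast
  next
    case b0: False
    have D0: "0 \<le> N / (e / 3)" using N0 e3 by simp
    have b': "0 < b \<or> tail_diverges" using b b0 by auto
    obtain p q where pq: "0 < p" "p < q" and bump: "\<And>w p' q'. cont_supp p' q' w \<Longrightarrow> (\<And>x. 0 \<le> w x) \<Longrightarrow>
        (\<And>x. x \<in> {min a0 p..max c0 q} \<Longrightarrow> 1 + tail x \<le> w x) \<Longrightarrow>
        \<exists>A. (\<forall>v\<in>{a0..c0}. prim w v / b \<le> A) \<and> (\<forall>v\<in>{p..q}. A + N / (e / 3) \<le> prim w v / b)"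
      using bump_location[OF b0 b' k(1,2) D0] by blast
    obtain \<psi> where \<psi>: "cont_supp p q \<psi>" "\<And>x. 0 \<le> \<psi> x" "(\<integral>v. \<psi> v \<partial>lborel) > 0" using bump_exists[OF pq(2)] by blast
    define a c where "a = min a0 p" and "c = max c0 q"
    have ac: "0 < a" "a \<le> c" using k pq by (auto simp: a_def c_def)
    define C where "C = (N + e / 3) / \<bar>b\<bar>"
    have C0: "C \<ge> 0" unfolding C_def using N0 e3 by (intro divide_nonneg_nonneg) auto
    have eC: "e / 3 / (C + 1) > 0" using e3 C0 by simp
    obtain p' q' w where w: "cont_supp p' q' w" "\<And>x. 0 \<le> w x" "\<And>x. x \<in> {a..c} \<Longrightarrow> 1 + tail x \<le> w x"
      "(\<integral>v. indicator {a..c} v * (w v - 1 - tail v) \<partial>lborel) \<le> e / 3 / (C + 1)"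
      using continuous_majorant[OF ac eC] by blast
    define Q where "Q = (\<lambda>x. prim w x / b)"
    obtain A where A: "\<And>v. v \<in> {a0..c0} \<Longrightarrow> Q v \<le> A" "\<And>v. v \<in> {p..q} \<Longrightarrow> A + N / (e / 3) \<le> Q v"
      using bump[OF w(1,2) w(3)[unfolded a_def c_def]] unfolding Q_def by blast
    have Qc: "continuous_on S Q" for S
      unfolding Q_def using b0 by (intro continuous_intros continuous_on_subset[OF prim_continuous[OF cont_supp_imp_bdd_supp[OF w(1)]]]) auto
    have times_exp: "cont_supp a' c' (\<lambda>v. f v * exp (Q v))" if "cont_supp a' c' f" for a' c' f
      using that unfolding cont_supp_def by (auto intro!: continuous_intros Qc)
    define I1 where "I1 = (\<integral>v. k v * exp (Q v) \<partial>lborel)"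
    define I2 where "I2 = (\<integral>v. \<psi> v * exp (Q v) \<partial>lborel)"
    define S where "S = (\<integral>v. \<psi> v \<partial>lborel)"
    have int: "integrable lborel k" "integrable lborel \<psi>" "integrable lborel (\<lambda>v. k v * exp (Q v))" "integrable lborel (\<lambda>v. \<psi> v * exp (Q v))"
      by (rule bdd_supp_integrable cont_supp_imp_bdd_supp k(3) \<psi>(1) times_exp)+
    have I1: "\<bar>I1\<bar> \<le> exp A * N"
    proof -
      have "\<bar>I1\<bar> \<le> (\<integral>v. \<bar>k v * exp (Q v)\<bar> \<partial>lborel)" unfolding I1_def by (rule integral_abs_bound)
      also have "\<dots> \<le> (\<integral>v. exp A * \<bar>k v\<bar> \<partial>lborel)"
      proof (rule integral_mono)
        show "\<bar>k v * exp (Q v)\<bar> \<le> exp A * \<bar>k v\<bar>" for v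
          using A(1)[of v] k(3) by (cases "v \<in> {a0..c0}") (auto simp: abs_mult cont_supp_def mult.commute[of "exp _"] intro!: mult_left_mono)
      qed (use int in auto)
      finally show ?thesis by (simp add: N_def)
    qed
    have I2: "exp (A + N / (e / 3)) * S \<le> I2"
    proof -
      have "exp (A + N / (e / 3)) * S = (\<integral>v. exp (A + N / (e / 3)) * \<psi> v \<partial>lborel)" by (simp add: S_def)
      also have "\<dots> \<le> I2"
        unfolding I2_def
      proof (rule integral_mono)
        show "exp (A + N / (e / 3)) * \<psi> v \<le> \<psi> v * exp (Q v)" for v
          using A(2)[of v] \<psi> by (cases "v \<in> {p..q}") (auto simp: cont_supp_def mult.commute[of "exp _"] intro!: mult_left_mono)
      qed (use int in auto)
      finally show ?thesis .
    qed
    have S: "S > 0" using \<psi> by (simp add: S_def)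
    have "0 < exp (A + N / (e / 3)) * S" using S by simp
    then have I2p: "I2 > 0" using I2 by linarith
    define \<kappa> where "\<kappa> = I1 / I2"
    have \<kappa>: "\<bar>\<kappa>\<bar> * S \<le> e / 3"
    proof -
      have "\<bar>\<kappa>\<bar> * S = \<bar>I1\<bar> * S / I2" using I2p by (simp add: \<kappa>_def abs_divide)
      also have "\<dots> \<le> (exp A * N) * S / (exp (A + N / (e / 3)) * S)"
        using I1 I2 S N0 by (intro frac_le mult_right_mono mult_nonneg_nonneg) auto
      also have "\<dots> = N / exp (N / (e / 3))" using S by (simp add: exp_add)
      also have "\<dots> \<le> N / (1 + N / (e / 3))"
        using N0 e3 exp_ge_add_one_self[of "N / (e / 3)"] by (intro divide_left_mono mult_pos_pos add_pos_nonneg) auto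
      also have "\<dots> \<le> e / 3" using N0 e by (simp add: divide_le_eq add_pos_nonneg field_simps)
      finally show ?thesis .
    qed
    define k' where "k' v = k v - \<kappa> * \<psi> v" for v
    have k0: "cont_supp a c k" by (rule cont_supp_widen[OF k(3)]) (auto simp: a_def c_def)
    have \<psi>0: "cont_supp a c \<psi>" by (rule cont_supp_widen[OF \<psi>(1)]) (auto simp: a_def c_def)
    have k': "cont_supp a c k'"
      using k0 \<psi>0 unfolding k'_def cont_supp_def by (auto intro!: continuous_intros)
    have orth: "(\<integral>v. k' v * exp (Q v) \<partial>lborel) = 0"
    proof -
      have "(\<integral>v. k' v * exp (Q v) \<partial>lborel) = (\<integral>v. k v * exp (Q v) - \<kappa> * (\<psi> v * exp (Q v)) \<partial>lborel)"
        by (simp add: k'_def algebra_simps)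
      also have "\<dots> = I1 - \<kappa> * I2" using int by (simp add: I1_def I2_def)
      finally show ?thesis using I2p by (simp add: \<kappa>_def)
    qed
    obtain g where g: "cont_supp a c g" "\<And>x. \<bar>g x\<bar> \<le> (\<integral>v. \<bar>k' v\<bar> \<partial>lborel) / \<bar>b\<bar>"
      "\<And>x. x \<ge> 0 \<Longrightarrow> prim (\<lambda>v. g v * w v) x + b * g x = prim k' x"
      using exact_solution[OF w(1,2) b0 k' ac Q_def orth] by blast
    have gC: "\<bar>g x\<bar> \<le> C" for x
    proof -
      have "(\<integral>v. \<bar>k' v\<bar> \<partial>lborel) \<le> (\<integral>v. \<bar>k v\<bar> + \<bar>\<kappa>\<bar> * \<psi> v \<partial>lborel)"
      proof (rule integral_mono)
        show "integrable lborel (\<lambda>v. \<bar>k' v\<bar>)" by (rule integrable_abs[OF bdd_supp_integrable[OF cont_supp_imp_bdd_supp[OF k']]])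
        show "\<bar>k' v\<bar> \<le> \<bar>k v\<bar> + \<bar>\<kappa>\<bar> * \<psi> v" for v
          using abs_triangle_ineq4[of "k v" "\<kappa> * \<psi> v"] \<psi>(2)[of v] by (simp add: k'_def abs_mult)
      qed (use int in auto)
      also have "\<dots> = N + \<bar>\<kappa>\<bar> * S" using int by (simp add: N_def S_def)
      also have "\<dots> \<le> N + e / 3" using \<kappa> by simp
      finally have "(\<integral>v. \<bar>k' v\<bar> \<partial>lborel) / \<bar>b\<bar> \<le> C" unfolding C_def by (intro divide_right_mono) auto
      then show ?thesis using g(2)[of x] by linarith
    qed
    have Ce: "C * (e / 3 / (C + 1)) \<le> e / 3" using C0 e3 by (simp add: field_simps)
    have "\<bar>prim g x + prim (\<lambda>v. g v * tail v) x + b * g x - h x\<bar> \<le> e" if x: "x \<ge> 0" for x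
    proof -
      have "prim k' x - prim k x = - \<kappa> * prim \<psi> x"
      proof -
        have "prim k' x = - (\<integral>v. indicator {x..} v * k v - \<kappa> * (indicator {x..} v * \<psi> v) \<partial>lborel)"
          by (simp add: prim_def k'_def algebra_simps)
        also have "\<dots> = prim k x - \<kappa> * prim \<psi> x"
          unfolding prim_def using bdd_supp_integrable_tail[OF bk] bdd_supp_integrable_tail[OF cont_supp_imp_bdd_supp[OF \<psi>(1)]] by simp
        finally show ?thesis by simp
      qed
      moreover have "\<bar>prim \<psi> x\<bar> \<le> S"
      proof -
        have "\<bar>prim \<psi> x\<bar> \<le> (\<integral>v. \<bar>indicator {x..} v * \<psi> v\<bar> \<partial>lborel)" unfolding prim_def abs_minus_cancel by (rule integral_abs_bound)
        also have "\<dots> \<le> S" unfolding S_def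
          using bdd_supp_integrable_tail[OF cont_supp_imp_bdd_supp[OF \<psi>(1)]] int \<psi>(2) by (intro integral_mono) (auto simp: indicator_def)
        finally show ?thesis .
      qed
      then have "\<bar>\<kappa> * prim \<psi> x\<bar> \<le> \<bar>\<kappa>\<bar> * S" by (simp add: abs_mult mult_left_mono)
      ultimately have "\<bar>prim k' x - prim k x\<bar> \<le> e / 3" using \<kappa> by simp
      then show ?thesis
        using range_dense_aux[OF k' g(1) ac w(1,3,4) gC g(3)[OF x]] k(4)[OF x] Ce by linarith
    qed
    then show ?thesis using that[OF ac g(1)] by blast
  qed
qed

end

section \<open>The spaces D0 and D1\<close>

lemma at_within_halfline_nontrivial: "0 \<le> (x::real) \<Longrightarrow> at x within {0..} \<noteq> bot"
proof -
  assume x: "0 \<le> x"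
  have "x \<in> closure {x<..}" by simp
  moreover have "closure {x<..} \<subseteq> closure ({0..} - {x})" using x by (intro closure_mono) auto
  ultimately show ?thesis by (auto simp: at_within_eq_bot_iff)
qed

lemma hderivI:
  assumes "(f has_real_derivative D) (at x within {0..})" "0 \<le> x"
  shows "hderiv f x = D"
  unfolding hderiv_def using assms
  by (intro vector_derivative_within at_within_halfline_nontrivial) (simp_all add: has_real_derivative_iff_has_vector_derivative)

lemma C10_deriv:
  assumes "f \<in> C10" "0 \<le> x"
  shows "(f has_real_derivative hderiv f x) (at x within {0..})"
proof -
  have "f differentiable (at x within {0..})" using assms by (auto simp: C10_def differentiable_on_def)
  then have "(f has_vector_derivative vector_derivative f (at x within {0..})) (at x within {0..})"
    by (simp add: vector_derivative_works)
  then show ?thesis by (simp add: has_real_derivative_iff_has_vector_derivative hderiv_def)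
qed

lemma C10_I:
  assumes f: "f \<in> C0" and d: "\<And>x. 0 \<le> x \<Longrightarrow> (f has_real_derivative f' x) (at x within {0..})"
    and c: "continuous_on {0..} f'" and l: "(f' \<longlongrightarrow> 0) at_top"
  shows "f \<in> C10"
proof -
  have h: "hderiv f x = f' x" if "0 \<le> x" for x by (rule hderivI[OF d[OF that] that])
  have "f differentiable_on {0..}"
    unfolding differentiable_on_def
    using differentiableI[OF has_field_derivative_imp_has_derivative[OF d]] by simp
  moreover have "continuous_on {0..} (hderiv f)" by (rule continuous_on_eq[OF c]) (simp add: h)
  moreover have "(hderiv f \<longlongrightarrow> 0) at_top"
    by (rule Lim_transform_eventually[OF l]) (auto intro!: eventually_mono[OF eventually_ge_at_top[of 0]] simp: h)
  ultimately show ?thesis using f by (simp add: C10_def)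
qed

lemma C10_linear:
  assumes f: "f \<in> C10" and g: "g \<in> C10"
  shows "(\<lambda>x\<in>{0..}. a * f x + c * g x) \<in> C10"
    and "0 \<le> x \<Longrightarrow> hderiv (\<lambda>x\<in>{0..}. a * f x + c * g x) x = a * hderiv f x + c * hderiv g x"
proof -
  have d: "((\<lambda>x\<in>{0..}. a * f x + c * g x) has_real_derivative a * hderiv f x + c * hderiv g x) (at x within {0..})"
    if "0 \<le> x" for x
  proof (rule has_field_derivative_transform_within[of _ _ _ _ 1])
    show "((\<lambda>x. a * f x + c * g x) has_real_derivative a * hderiv f x + c * hderiv g x) (at x within {0..})"
      by (intro DERIV_add DERIV_cmult C10_deriv f g that)
  qed (use that in auto)
  show "0 \<le> x \<Longrightarrow> hderiv (\<lambda>x\<in>{0..}. a * f x + c * g x) x = a * hderiv f x + c * hderiv g x"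
    by (rule hderivI[OF d])
  have "((\<lambda>x. a * hderiv f x + c * hderiv g x) \<longlongrightarrow> a * 0 + c * 0) at_top"
    using f g unfolding C10_def by (intro tendsto_intros) auto
  then have l: "((\<lambda>x. a * hderiv f x + c * hderiv g x) \<longlongrightarrow> 0) at_top" by simp
  show "(\<lambda>x\<in>{0..}. a * f x + c * g x) \<in> C10"
    by (rule C10_I[OF C0_linear d _ l]) (use f g in \<open>auto simp: C10_def intro!: continuous_intros\<close>)
qed

lemma prim_in_D0:
  assumes g: "cont_supp a c g" and a: "0 < a"
  shows "(hprim g) \<in> D0" and "0 \<le> x \<Longrightarrow> hderiv (hprim g) x = g x"
proof -
  have d: "((hprim g) has_real_derivative g x) (at x within {0..})" if "0 \<le> x" for x
    by (rule has_field_derivative_transform_within[OF has_field_derivative_at_within[OF prim_has_derivative[OF g]], of 1])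
       (use that in auto)
  show "0 \<le> x \<Longrightarrow> hderiv (hprim g) x = g x" by (rule hderivI[OF d])
  have "(g \<longlongrightarrow> 0) at_top"
    using g by (intro tendsto_eventually eventually_mono[OF eventually_gt_at_top[of c]]) (auto simp: cont_supp_def)
  then have "(hprim g) \<in> C10"
    by (intro C10_I[OF prim_C0[OF cont_supp_imp_bdd_supp[OF g]] d cont_supp_continuous[OF g]])
  moreover have "(hprim g) constant_on {0..a}"
    unfolding constant_on_def
  proof (intro exI[of _ "prim g a"] ballI)
    fix x assume x: "x \<in> {0..a}"
    then have "prim g x = prim g a" by (intro prim_left[OF cont_supp_imp_bdd_supp[OF g]]) simp
    then show "(hprim g) x = prim g a" using x by simp
  qed
  ultimately show "(hprim g) \<in> D0" using a by (auto simp: D0_def)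
qed

lemma hderiv_measurable:
  assumes "f \<in> C10"
  shows "(\<lambda>v. indicator {0<..1} v * hderiv f v) \<in> borel_measurable borel"
proof -
  have "continuous_on UNIV (\<lambda>v. hderiv f (max v 0))"
    using assms unfolding C10_def
    by (intro continuous_on_compose2[of "{0..}" "hderiv f" UNIV "\<lambda>v. max v 0"]) (auto intro!: continuous_intros)
  then have [measurable]: "(\<lambda>v. hderiv f (max v 0)) \<in> borel_measurable borel"
    by (rule borel_measurable_continuous_onI)
  have "(\<lambda>v. indicator {0<..1} v * hderiv f (max v 0)) \<in> borel_measurable borel" by measurable
  also have "(\<lambda>v. indicator {0<..1} v * hderiv f (max v 0)) = (\<lambda>v. indicator {0<..1} v * hderiv f v)"
    by (auto simp: indicator_def fun_eq_iff)
  finally show ?thesis .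
qed

text \<open>The fundamental theorem of calculus, in a form to which Tonelli's theorem applies.\<close>

lemma C10_increment:
  assumes f: "f \<in> C10" and xy: "0 \<le> x" "x \<le> y" "y \<le> 1"
  shows "ennreal \<bar>f y - f x\<bar> \<le> (\<integral>\<^sup>+v. ennreal \<bar>indicator {0<..1} v * hderiv f v\<bar> * indicator {v..} y \<partial>lborel)"
proof -
  have cont: "continuous_on {x..y} (hderiv f)"
    using f xy by (auto simp: C10_def elim!: continuous_on_subset)
  have "(hderiv f has_integral f y - f x) {x..y}"
  proof (rule fundamental_theorem_of_calculus[OF xy(2)])
    fix z assume "z \<in> {x..y}"
    then show "(f has_vector_derivative hderiv f z) (at z within {x..y})"
      using C10_deriv[OF f, of z] xy
      by (auto simp: has_real_derivative_iff_has_vector_derivative intro: has_vector_derivative_within_subset)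
  qed
  then have "f y - f x = integral {x..y} (hderiv f)" by (simp add: integral_unique)
  also have "\<dots> = (LINT v:{x..y}|lborel. hderiv f v)"
    by (intro set_borel_integral_eq_integral(2)[symmetric] borel_integrable_atLeastAtMost' cont)
  finally have "ennreal \<bar>f y - f x\<bar> = ennreal (norm (LINT v:{x..y}|lborel. hderiv f v))" by simp
  also have "\<dots> \<le> (\<integral>\<^sup>+v. norm (indicator {x..y} v *\<^sub>R hderiv f v) \<partial>lborel)"
    using borel_integrable_atLeastAtMost'[OF cont] unfolding set_lebesgue_integral_def set_integrable_def
    by (rule integral_norm_bound_ennreal)
  also have "\<dots> \<le> (\<integral>\<^sup>+v. ennreal \<bar>indicator {0<..1} v * hderiv f v\<bar> * indicator {v..} y \<partial>lborel)"
  proof (rule nn_integral_mono_AE)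
    show "AE v in lborel. ennreal (norm (indicator {x..y} v *\<^sub>R hderiv f v)) \<le> ennreal \<bar>indicator {0<..1} v * hderiv f v\<bar> * indicator {v..} y"
      using AE_lborel_singleton[of 0]
    proof eventually_elim
      case (elim v)
      then show ?case using xy by (auto simp: indicator_def)
    qed
  qed
  finally show ?thesis .
qed

context tail_measure
begin

text \<open>Jumps beyond \<open>1\<close> are bounded by the sup norm; for the others, write the increment as an integral
  of the derivative and exchange the order of integration.\<close>

lemma jump_bound:
  assumes f: "f \<in> C10" and B: "\<And>x. 0 \<le> x \<Longrightarrow> \<bar>f x\<bar> \<le> B" and x: "0 \<le> x"
  shows "(\<integral>\<^sup>+y. ennreal \<bar>indicator {x<..} y * (f y - f x)\<bar> \<partial>\<mu>)
    \<le> ennreal (2 * B * tail 1) + small_jump_norm (hderiv f)"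
proof -
  interpret PP: pair_sigma_finite "lborel :: real measure" \<mu>
    by (intro pair_sigma_finite.intro sigma_finite_mu lborel.sigma_finite_measure_axioms)
  have B0: "0 \<le> B" using B[of 0] by simp
  define h where "h v = \<bar>indicator {0<..1} v * hderiv f v\<bar>" for v
  have hm[measurable]: "h \<in> borel_measurable borel"
    unfolding h_def using hderiv_measurable[OF f] by measurable
  have idm: "(\<lambda>y. y) \<in> borel_measurable \<mu>" by (intro measurable_mu_borel) simp
  have sm[measurable]: "(\<lambda>p. snd p) \<in> borel_measurable (lborel \<Otimes>\<^sub>M \<mu>)"
    using measurable_compose[OF measurable_snd idm] .
  have fm[measurable]: "(\<lambda>p. fst p) \<in> borel_measurable (lborel \<Otimes>\<^sub>M \<mu>)"
    using measurable_fst by simp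
  have m: "(\<lambda>(v, y). ennreal (h v) * (if v \<le> y then 1 else 0)) \<in> borel_measurable (lborel \<Otimes>\<^sub>M \<mu>)"
    unfolding case_prod_beta by measurable
  have one: "{1..} \<in> sets \<mu>" by (rule sets_muI) auto
  have "(\<integral>\<^sup>+y. ennreal \<bar>indicator {x<..} y * (f y - f x)\<bar> \<partial>\<mu>)
      \<le> (\<integral>\<^sup>+y. ennreal (2 * B) * indicator {1..} y + (\<integral>\<^sup>+v. ennreal (h v) * (if v \<le> y then 1 else 0) \<partial>lborel) \<partial>\<mu>)"
  proof (rule nn_integral_mono)
    fix y
    show "ennreal \<bar>indicator {x<..} y * (f y - f x)\<bar> \<le> ennreal (2 * B) * indicator {1..} y + (\<integral>\<^sup>+v. ennreal (h v) * (if v \<le> y then 1 else 0) \<partial>lborel)"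
    proof -
      consider "y \<le> x" | "x < y" "1 \<le> y" | "x < y" "y < 1" by linarith
      then show ?thesis
      proof cases
        case 1
        then show ?thesis by simp
      next
        case 2
        then have "\<bar>f y - f x\<bar> \<le> 2 * B" using B[of y] B[OF x] x by linarith
        then have "ennreal \<bar>indicator {x<..} y * (f y - f x)\<bar> \<le> ennreal (2 * B)" using 2 by (simp add: ennreal_leI)
        then show ?thesis using 2 by (simp add: add_increasing2)
      next
        case 3
        then have "ennreal \<bar>f y - f x\<bar> \<le> (\<integral>\<^sup>+v. ennreal (h v) * indicator {v..} y \<partial>lborel)"
          unfolding h_def using x by (intro C10_increment f) auto
        also have "(\<lambda>v. ennreal (h v) * indicator {v..} y) = (\<lambda>v. ennreal (h v) * (if v \<le> y then 1 else 0))"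
          by (auto simp: indicator_def)
        finally show ?thesis using 3 by simp
      qed
    qed
  qed
  also have "\<dots> = (\<integral>\<^sup>+y. ennreal (2 * B) * indicator {1..} y \<partial>\<mu>) + (\<integral>\<^sup>+y. (\<integral>\<^sup>+v. ennreal (h v) * (if v \<le> y then 1 else 0) \<partial>lborel) \<partial>\<mu>)"
  proof (rule nn_integral_add)
    show "(\<lambda>y. ennreal (2 * B) * indicator {1..} y) \<in> borel_measurable \<mu>" using one by measurable
    show "(\<lambda>y. \<integral>\<^sup>+v. ennreal (h v) * (if v \<le> y then 1 else 0) \<partial>lborel) \<in> borel_measurable \<mu>"
    proof (rule lborel.borel_measurable_nn_integral)
      have [measurable]: "(\<lambda>p. fst p) \<in> borel_measurable (\<mu> \<Otimes>\<^sub>M lborel)"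
        using measurable_compose[OF measurable_fst idm] .
      have [measurable]: "(\<lambda>p. snd p) \<in> borel_measurable (\<mu> \<Otimes>\<^sub>M lborel)"
        using measurable_snd by simp
      show "(\<lambda>(y, v). ennreal (h v) * (if v \<le> y then 1 else 0)) \<in> borel_measurable (\<mu> \<Otimes>\<^sub>M lborel)"
        unfolding case_prod_beta by measurable
    qed
  qed
  also have "(\<integral>\<^sup>+y. ennreal (2 * B) * indicator {1..} y \<partial>\<mu>) = ennreal (2 * B * tail 1)"
    using one B0 by (simp add: nn_integral_cmult_indicator emeasure_tail ennreal_mult'' tail_nonneg)
  also have "(\<integral>\<^sup>+y. (\<integral>\<^sup>+v. ennreal (h v) * (if v \<le> y then 1 else 0) \<partial>lborel) \<partial>\<mu>)
     = (\<integral>\<^sup>+v. (\<integral>\<^sup>+y. ennreal (h v) * (if v \<le> y then 1 else 0) \<partial>\<mu>) \<partial>lborel)"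
    using PP.Fubini'[OF m] by simp
  also have "\<dots> = small_jump_norm (hderiv f)"
  proof (rule nn_integral_cong)
    fix v :: real
    show "(\<integral>\<^sup>+y. ennreal (h v) * (if v \<le> y then 1 else 0) \<partial>\<mu>) = ennreal \<bar>hderiv f v\<bar> * emeasure \<mu> {v..} * indicator {0<..1} v"
    proof (cases "v \<in> {0<..1}")
      case True
      then have vs: "{v..} \<in> sets \<mu>" by (intro sets_muI) auto
      have "(\<integral>\<^sup>+y. ennreal (h v) * (if v \<le> y then 1 else 0) \<partial>\<mu>) = (\<integral>\<^sup>+y. ennreal (h v) * indicator {v..} y \<partial>\<mu>)"
        by (intro nn_integral_cong) (auto simp: indicator_def)
      also have "\<dots> = ennreal (h v) * emeasure \<mu> {v..}" using vs by (simp add: nn_integral_cmult_indicator)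
      finally show ?thesis using True by (simp add: h_def)
    qed (simp add: h_def)
  qed
  finally show ?thesis .
qed

lemma C0_measurable_mu:
  assumes "f \<in> C0"
  shows "f \<in> borel_measurable \<mu>"
proof -
  have "(\<lambda>z. f (max z 0)) \<in> borel_measurable \<mu>" by (intro measurable_mu_borel C0_extend_measurable assms)
  then show ?thesis by (rule measurable_cong[THEN iffD1, rotated]) (simp add: space_mu)
qed

lemma jump_integrable:
  assumes f: "f \<in> D1 \<mu>" and x: "0 \<le> x"
  shows "set_integrable \<mu> {x<..} (\<lambda>y. f y - f x)"
proof -
  have f10: "f \<in> C10" and fin: "small_jump_norm (hderiv f) < \<infinity>"
    using f by (auto simp: D1_def)
  have f0: "f \<in> C0" using f10 by (simp add: C10_def)
  obtain B where B: "B \<ge> 0" "\<And>x. 0 \<le> x \<Longrightarrow> \<bar>f x\<bar> \<le> B" using C0_bounded[OF f0] by blast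
  have "{x<..} \<in> sets \<mu>" using x by (intro sets_muI) auto
  then have m: "(\<lambda>y. indicator {x<..} y * (f y - f x)) \<in> borel_measurable \<mu>"
    using C0_measurable_mu[OF f0] by measurable
  have "(\<integral>\<^sup>+y. ennreal \<bar>indicator {x<..} y * (f y - f x)\<bar> \<partial>\<mu>) < \<infinity>"
  proof (rule le_less_trans)
    show "(\<integral>\<^sup>+y. ennreal \<bar>indicator {x<..} y * (f y - f x)\<bar> \<partial>\<mu>)
      \<le> ennreal (2 * B * tail 1) + small_jump_norm (hderiv f)"
      by (rule jump_bound[OF f10 B(2) x])
  qed (use fin in simp)
  then show ?thesis unfolding set_integrable_def using m by (intro integrableI_bounded) simp_all
qed

lemma jump_integral_bound:
  assumes f: "f \<in> C10" and x: "0 \<le> x" and B: "\<And>x. 0 \<le> x \<Longrightarrow> \<bar>f x\<bar> \<le> B"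
    and W: "0 \<le> W" "small_jump_norm (hderiv f) \<le> ennreal W"
    and int: "set_integrable \<mu> {x<..} (\<lambda>y. f y - f x)"
  shows "\<bar>LINT y:{x<..}|\<mu>. f y - f x\<bar> \<le> 2 * B * tail 1 + W"
proof -
  have B0: "0 \<le> B" using B[of 0] by simp
  have "ennreal (norm (LINT y:{x<..}|\<mu>. f y - f x)) \<le> (\<integral>\<^sup>+y. norm (indicator {x<..} y *\<^sub>R (f y - f x)) \<partial>\<mu>)"
    using int unfolding set_lebesgue_integral_def set_integrable_def by (rule integral_norm_bound_ennreal)
  also have "\<dots> = (\<integral>\<^sup>+y. ennreal \<bar>indicator {x<..} y * (f y - f x)\<bar> \<partial>\<mu>)" by simp
  also have "\<dots> \<le> ennreal (2 * B * tail 1) + ennreal W"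
    by (rule order_trans[OF jump_bound[OF f B x] add_left_mono[OF W(2)]])
  also have "\<dots> = ennreal (2 * B * tail 1 + W)" using B0 W(1) by (simp add: ennreal_plus tail_nonneg)
  finally show ?thesis using B0 W(1) by (subst (asm) ennreal_le_iff) (auto simp: tail_nonneg)
qed

lemma D0_subset_D1: "D0 \<subseteq> D1 \<mu>"
proof
  fix f assume "f \<in> D0"
  then obtain e where f: "f \<in> C10" and e: "e > 0" "f constant_on {0..e}" by (auto simp: D0_def)
  obtain k where k: "\<And>x. x \<in> {0..e} \<Longrightarrow> f x = k" using e(2) by (auto simp: constant_on_def)
  have z: "hderiv f x = 0" if "0 \<le> x" "x < e" for x
  proof (rule hderivI[OF _ that(1)])
    show "(f has_real_derivative 0) (at x within {0..})"
      by (rule has_field_derivative_transform_within[OF DERIV_const, of "e - x" _ _ k])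
         (use that in \<open>auto simp: dist_real_def intro!: k[symmetric]\<close>)
  qed
  have "continuous_on {0..1} (hderiv f)" using f by (auto simp: C10_def elim!: continuous_on_subset)
  then have "bounded (hderiv f ` {0..1})" by (intro compact_imp_bounded compact_continuous_image) auto
  then obtain C where "\<forall>y\<in>hderiv f ` {0..1}. \<bar>y\<bar> \<le> C" unfolding bounded_real by blast
  then have C: "\<And>v. v \<in> {0..1} \<Longrightarrow> \<bar>hderiv f v\<bar> \<le> C" by blast
  have C0: "0 \<le> C" using C[of 0] by simp
  have "small_jump_norm (hderiv f) \<le> (\<integral>\<^sup>+v. ennreal (C * tail e) * indicator {0..1::real} v \<partial>lborel)"
  proof (rule nn_integral_mono)
    fix v :: real
    show "ennreal \<bar>hderiv f v\<bar> * emeasure \<mu> {v..} * indicator {0<..1} v \<le> ennreal (C * tail e) * indicator {0..1} v"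
    proof (cases "v \<in> {0<..1}")
      case True
      show ?thesis
      proof (cases "v < e")
        case True
        then show ?thesis using z[of v] \<open>v \<in> {0<..1}\<close> by simp
      next
        case False
        then have "\<bar>hderiv f v\<bar> * tail v \<le> C * tail e"
          using True e C0 by (intro mult_mono C tail_antimono) (auto simp: tail_nonneg)
        then have "ennreal (\<bar>hderiv f v\<bar> * tail v) \<le> ennreal (C * tail e)" by (rule ennreal_leI)
        then show ?thesis using True by (simp add: emeasure_tail ennreal_mult tail_nonneg)
      qed
    qed simp
  qed
  also have "\<dots> < \<infinity>" by (simp add: nn_integral_cmult_indicator)
  finally show "f \<in> D1 \<mu>" using f z[of 0] e by (simp add: D1_def)
qed

text \<open>Dominated convergence; the integrability condition in the definition of \<open>D1\<close> provides the
  dominating function.\<close>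

lemma truncated_weight:
  assumes f: "f \<in> D1 \<mu>" and e: "0 < e"
  obtains \<theta> where "0 < \<theta>" "\<theta> \<le> e"
    "(\<integral>\<^sup>+v\<in>{0<..1}. ennreal (min \<bar>hderiv f v\<bar> \<theta>) * emeasure \<mu> {v..} \<partial>lborel) \<le> ennreal e"
proof -
  have f10: "f \<in> C10" and fin: "small_jump_norm (hderiv f) < \<infinity>"
    using f by (auto simp: D1_def)
  note [measurable] = hderiv_measurable[OF f10]
  define r where "r n = inverse (real (Suc n))" for n
  have r: "0 < r n" for n by (simp add: r_def)
  have r_lim: "r \<longlonglongrightarrow> 0" unfolding r_def by (rule LIMSEQ_inverse_real_of_nat)
  define h where "h v = indicator {0<..1} v * hderiv f v" for v
  have hm[measurable]: "h \<in> borel_measurable borel" unfolding h_def by measurable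
  define u where "u n v = ennreal (min \<bar>h v\<bar> (r n) * (indicator {0<..1} v * tail v))" for n v
  have u: "ennreal (min \<bar>hderiv f v\<bar> (r n)) * emeasure \<mu> {v..} * indicator {0<..1} v = u n v" for n v
    using r[of n] by (auto simp: u_def h_def indicator_def emeasure_tail ennreal_mult'' tail_nonneg)
  have w: "ennreal \<bar>hderiv f v\<bar> * emeasure \<mu> {v..} * indicator {0<..1} v = ennreal (\<bar>h v\<bar> * (indicator {0<..1} v * tail v))" for v
    by (auto simp: h_def indicator_def emeasure_tail ennreal_mult'' tail_nonneg)
  have "(\<lambda>n. \<integral>\<^sup>+v. u n v \<partial>lborel) \<longlonglongrightarrow> (\<integral>\<^sup>+v. 0 \<partial>(lborel :: real measure))"
  proof (rule nn_integral_dominated_convergence[where w="\<lambda>v. ennreal (\<bar>h v\<bar> * (indicator {0<..1} v * tail v))"])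
    show "(\<integral>\<^sup>+v. ennreal (\<bar>h v\<bar> * (indicator {0<..1} v * tail v)) \<partial>lborel) < \<infinity>" using fin unfolding w .
    show "u n \<in> borel_measurable lborel" for n unfolding u_def by measurable
    show "AE v in lborel. u n v \<le> ennreal (\<bar>h v\<bar> * (indicator {0<..1} v * tail v))" for n
      unfolding u_def by (intro AE_I2 ennreal_leI mult_right_mono) (auto simp: tail_nonneg)
    show "AE v in lborel. (\<lambda>n. u n v) \<longlonglongrightarrow> 0"
    proof (rule AE_I2)
      fix v :: real
      have "(\<lambda>n. min \<bar>h v\<bar> (r n) * (indicator {0<..1} v * tail v)) \<longlonglongrightarrow> min \<bar>h v\<bar> 0 * (indicator {0<..1} v * tail v)"
        by (intro tendsto_intros r_lim)
      then have "(\<lambda>n. ennreal (min \<bar>h v\<bar> (r n) * (indicator {0<..1} v * tail v))) \<longlonglongrightarrow> ennreal 0"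
        by (intro tendsto_ennrealI) simp
      then show "(\<lambda>n. u n v) \<longlonglongrightarrow> 0" by (simp add: u_def)
    qed
  qed measurable
  then have "(\<lambda>n. \<integral>\<^sup>+v. u n v \<partial>lborel) \<longlonglongrightarrow> 0" by simp
  then have "eventually (\<lambda>n. (\<integral>\<^sup>+v. u n v \<partial>lborel) < ennreal e) sequentially"
    by (rule order_tendstoD(2)) (use e in simp)
  moreover have "eventually (\<lambda>n. r n < e) sequentially" using r_lim e by (rule order_tendstoD(2))
  ultimately have "eventually (\<lambda>n. (\<integral>\<^sup>+v. u n v \<partial>lborel) < ennreal e \<and> r n < e) sequentially" by (rule eventually_conj)
  then obtain n where n: "(\<integral>\<^sup>+v. u n v \<partial>lborel) < ennreal e" "r n < e" by (auto simp: eventually_sequentially)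
  have "(\<integral>\<^sup>+v\<in>{0<..1}. ennreal (min \<bar>hderiv f v\<bar> (r n)) * emeasure \<mu> {v..} \<partial>lborel) \<le> ennreal e"
    unfolding u using n(1) by (rule less_imp_le)
  then show ?thesis by (rule that[OF r less_imp_le[OF n(2)]])
qed

end

section \<open>Approximation of D1 by primitives\<close>

lemma pos_part_square_deriv: "((\<lambda>x::real. (max 0 x)\<^sup>2) has_real_derivative 2 * max 0 x) (at x)"
proof (cases x "0 :: real" rule: linorder_cases)
  case less
  have "((\<lambda>x. 0) has_real_derivative 0) (at x)" by simp
  then have "((\<lambda>x::real. (max 0 x)\<^sup>2) has_real_derivative 0) (at x)"
    by (rule has_field_derivative_transform_within_open[of _ _ _ "{..<0}"]) (use less in auto)
  then show ?thesis using less by simp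
next
  case greater
  have "((\<lambda>x. x\<^sup>2) has_real_derivative 2 * x) (at x)" by (auto intro!: derivative_eq_intros)
  then have "((\<lambda>x::real. (max 0 x)\<^sup>2) has_real_derivative 2 * x) (at x)"
    by (rule has_field_derivative_transform_within_open[of _ _ _ "{0<..}"]) (use greater in auto)
  then show ?thesis using greater by simp
next
  case equal
  have "((\<lambda>h::real. ((max 0 (0 + h))\<^sup>2 - (max 0 0)\<^sup>2) / h) \<longlongrightarrow> 0) (at 0)"
  proof (rule Lim_null_comparison)
    show "\<forall>\<^sub>F h in at 0. norm (((max 0 (0 + h))\<^sup>2 - (max 0 0)\<^sup>2) / h) \<le> \<bar>h :: real\<bar>"
      by (intro always_eventually allI) (auto simp: max_def power2_eq_square)
    show "((\<lambda>h::real. \<bar>h\<bar>) \<longlongrightarrow> 0) (at 0)" by (auto intro!: tendsto_eq_intros)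
  qed
  then show ?thesis using equal by (simp add: DERIV_def)
qed

text \<open>A continuously differentiable cutoff, equal to \<open>1\<close> up to \<open>R\<close> and to \<open>0\<close> from \<open>R + 1\<close> on; built from
  \<open>(max 0 x)\<^sup>2\<close>, whose derivative needs no case distinction.\<close>

definition cutoff :: "real \<Rightarrow> real \<Rightarrow> real" where
  "cutoff R x = (max 0 (1 - (max 0 (x - R))\<^sup>2))\<^sup>2"

definition cutoff' :: "real \<Rightarrow> real \<Rightarrow> real" where
  "cutoff' R x = 2 * max 0 (1 - (max 0 (x - R))\<^sup>2) * (- (2 * max 0 (x - R)))"

lemma cutoff_deriv: "(cutoff R has_real_derivative cutoff' R x) (at x)"
proof -
  have "((\<lambda>x. x - R) has_real_derivative 1) (at x)" by (auto intro!: derivative_eq_intros)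
  from DERIV_chain2[OF pos_part_square_deriv this]
  have "((\<lambda>x. (max 0 (x - R))\<^sup>2) has_real_derivative 2 * max 0 (x - R)) (at x)" by simp
  from DERIV_diff[OF DERIV_const[of 1] this]
  have "((\<lambda>x. 1 - (max 0 (x - R))\<^sup>2) has_real_derivative - (2 * max 0 (x - R))) (at x)" by simp
  from DERIV_chain2[OF pos_part_square_deriv this] show ?thesis
    unfolding cutoff_def cutoff'_def .
qed

lemma cutoff_left: "x \<le> R \<Longrightarrow> cutoff R x = 1 \<and> cutoff' R x = 0"
  by (simp add: cutoff_def cutoff'_def)

lemma cutoff_right:
  assumes "R + 1 \<le> x"
  shows "cutoff R x = 0 \<and> cutoff' R x = 0"
proof -
  have "1 \<le> (x - R)\<^sup>2" using assms one_le_power[of "x - R" 2] by simp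
  then show ?thesis using assms by (simp add: cutoff_def cutoff'_def)
qed

lemma cutoff_bounds: "0 \<le> cutoff R x" "cutoff R x \<le> 1" "\<bar>cutoff' R x\<bar> \<le> 4"
proof -
  show "0 \<le> cutoff R x" by (simp add: cutoff_def)
  have 1: "0 \<le> max 0 (1 - (max 0 (x - R))\<^sup>2)" "max 0 (1 - (max 0 (x - R))\<^sup>2) \<le> 1" by auto
  then show "cutoff R x \<le> 1" unfolding cutoff_def by (rule power_le_one)
  show "\<bar>cutoff' R x\<bar> \<le> 4"
  proof (cases "R + 1 \<le> x")
    case True
    then show ?thesis using cutoff_right by simp
  next
    case False
    then have 2: "0 \<le> max 0 (x - R)" "max 0 (x - R) \<le> 1" by auto
    have "max 0 (1 - (max 0 (x - R))\<^sup>2) * max 0 (x - R) \<le> 1 * 1" using 1 2 by (intro mult_mono) auto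
    moreover have "0 \<le> max 0 (1 - (max 0 (x - R))\<^sup>2) * max 0 (x - R)" using 1 2 by (intro mult_nonneg_nonneg)
    moreover have "cutoff' R x = - 4 * (max 0 (1 - (max 0 (x - R))\<^sup>2) * max 0 (x - R))" by (simp add: cutoff'_def)
    ultimately show ?thesis by linarith
  qed
qed

context tail_measure
begin

text \<open>First cut \<open>f\<close> off at \<open>\<infinity>\<close>, where \<open>f\<close> and its derivative are small. Then replace the derivative \<open>F'\<close>
  of the result by \<open>F' - max (- \<theta>) (min \<theta> F')\<close>. This soft truncation keeps it continuous, changes it by at most \<open>\<theta>\<close> and
  by at most \<open>\<bar>F'\<bar>\<close>, and makes it vanish near \<open>0\<close> because the derivative of \<open>f\<close> vanishes at \<open>0\<close>.\<close>

lemma D1_approx: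
  assumes f: "f \<in> D1 \<mu>" and e: "0 < e"
  obtains a c g where "0 < a" "a \<le> c" "cont_supp a c g"
    "\<And>x. 0 \<le> x \<Longrightarrow> \<bar>f x - prim g x\<bar> \<le> e" "\<And>x. 0 \<le> x \<Longrightarrow> \<bar>hderiv f x - g x\<bar> \<le> e"
    "small_jump_norm (\<lambda>v. hderiv f v - g v) \<le> ennreal e"
proof -
  have f10: "f \<in> C10" and f'0: "hderiv f 0 = 0" using f by (auto simp: D1_def)
  have cont: "continuous_on {0..} (hderiv f)" "continuous_on {0..} f" "(hderiv f \<longlongrightarrow> 0) at_top" "(f \<longlongrightarrow> 0) at_top"
    using f10 by (auto simp: C10_def C0_def)
  \<comment> \<open>The derivative moves by at most \<open>5 * \<delta>\<close> under the cutoff and by at most \<open>\<theta> \<le> \<delta>\<close> under the truncation.\<close>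
  define \<delta> where "\<delta> = e / 6"
  have \<delta>: "\<delta> > 0" using e by (simp add: \<delta>_def)
  have "eventually (\<lambda>x. \<bar>f x\<bar> < \<delta> \<and> \<bar>hderiv f x\<bar> < \<delta>) at_top"
    using tendstoD[OF cont(3) \<delta>] tendstoD[OF cont(4) \<delta>] by (simp add: dist_real_def eventually_conj)
  then obtain R0 where R0: "\<And>x. x \<ge> R0 \<Longrightarrow> \<bar>f x\<bar> < \<delta> \<and> \<bar>hderiv f x\<bar> < \<delta>"
    unfolding eventually_at_top_linorder by blast
  define R where "R = max R0 1"
  have R: "R \<ge> 1" "\<And>x. x \<ge> R \<Longrightarrow> \<bar>f x\<bar> \<le> \<delta> \<and> \<bar>hderiv f x\<bar> \<le> \<delta>"
    using R0 by (auto simp: R_def less_imp_le)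
  have "0 < \<delta> / (R + 2)" using \<delta> R(1) by simp
  then obtain \<theta> where \<theta>: "0 < \<theta>" "\<theta> \<le> \<delta> / (R + 2)"
    "(\<integral>\<^sup>+v\<in>{0<..1}. ennreal (min \<bar>hderiv f v\<bar> \<theta>) * emeasure \<mu> {v..} \<partial>lborel) \<le> ennreal (\<delta> / (R + 2))"
    using truncated_weight[OF f] by blast
  have \<theta>R: "\<theta> * (R + 2) \<le> \<delta>" using \<theta>(2) R(1) by (simp add: pos_le_divide_eq)
  have "\<theta> * 1 \<le> \<theta> * (R + 2)" using \<theta>(1) R(1) by (intro mult_left_mono) auto
  then have \<theta>\<delta>: "\<theta> \<le> \<delta>" using \<theta>R by simp
  have "\<delta> / (R + 2) \<le> \<delta> / 1" using \<delta> R(1) by (intro divide_left_mono) auto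
  moreover have "\<delta> \<le> e" using e by (simp add: \<delta>_def)
  ultimately have \<delta>e: "\<delta> / (R + 2) \<le> e" by linarith
  define F where "F x = f x * cutoff R x" for x
  define F' where "F' x = hderiv f x * cutoff R x + f x * cutoff' R x" for x
  have Fd: "(F has_real_derivative F' x) (at x within {0..})" if "0 \<le> x" for x
    using DERIV_mult[OF C10_deriv[OF f10 that] has_field_derivative_at_within[OF cutoff_deriv]]
    unfolding F_def F'_def by (simp add: algebra_simps)
  have ccont: "continuous_on S (cutoff R)" "continuous_on S (cutoff' R)" for S
    unfolding cutoff_def cutoff'_def by (auto intro!: continuous_intros)
  have F'c: "continuous_on {0..} F'" unfolding F'_def by (intro continuous_on_add continuous_on_mult cont ccont)
  define clamp where "clamp y = max (- \<theta>) (min \<theta> y)" for y :: real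
  have clamp: "\<bar>clamp y\<bar> \<le> \<theta>" "\<bar>clamp y\<bar> \<le> min \<bar>y\<bar> \<theta>" "\<bar>y\<bar> \<le> \<theta> \<Longrightarrow> clamp y = y" for y
    using \<theta>(1) by (auto simp: clamp_def)
  define g where "g x = F' (max x 0) - clamp (F' (max x 0))" for x
  have gF: "F' x - g x = clamp (F' x)" if "0 \<le> x" for x using that by (simp add: g_def)
  have gc: "continuous_on UNIV g"
  proof -
    have "continuous_on UNIV (\<lambda>x. F' (max x 0))"
      by (rule continuous_on_compose2[OF F'c]) (auto intro!: continuous_intros)
    then show ?thesis unfolding g_def clamp_def by (intro continuous_intros)
  qed
  have Ff: "F' x = hderiv f x" "F x = f x" if "x \<le> R" for x using cutoff_left[OF that] by (simp_all add: F'_def F_def)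
  have Fr: "F' x = 0" "F x = 0" if "R + 1 \<le> x" for x using cutoff_right[OF that] by (simp_all add: F'_def F_def)
  obtain d where d: "d > 0" "\<And>x. x \<in> {0..} \<Longrightarrow> dist x 0 < d \<Longrightarrow> dist (hderiv f x) (hderiv f 0) < \<theta>"
    using cont(1) \<theta>(1) unfolding continuous_on_iff by (metis atLeast_iff order_refl)
  define a where "a = min (d / 2) 1"
  have a: "0 < a" "a \<le> 1" using d by (auto simp: a_def)
  have g: "cont_supp a (R + 1) g"
    unfolding cont_supp_def
  proof (intro conjI gc allI impI)
    fix x assume "x \<notin> {a..R + 1}"
    then consider "x < a" | "R + 1 < x" by force
    then show "g x = 0"
    proof cases
      case 1
      then have "\<bar>hderiv f (max x 0)\<bar> \<le> \<theta>" using d(2)[of "max x 0"] f'0 d(1) by (auto simp: a_def dist_real_def)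
      moreover have "F' (max x 0) = hderiv f (max x 0)" using 1 a R(1) by (intro Ff) auto
      ultimately show ?thesis using clamp(3)[of "F' (max x 0)"] by (simp add: g_def)
    next
      case 2
      then show ?thesis using Fr(1)[of "max x 0"] clamp(3)[of 0] \<theta>(1) by (simp add: g_def)
    qed
  qed
  have FP: "\<bar>F x - prim g x\<bar> \<le> \<theta> * (R + 2)" if x: "0 \<le> x" for x
  proof (cases "x \<le> R + 2")
    case True
    have "norm ((F x - prim g x) - (F (R + 2) - prim g (R + 2))) \<le> \<theta> * norm (x - (R + 2))"
    proof (rule field_differentiable_bound)
      show "convex {0::real..}" by simp
      show "((\<lambda>x. F x - prim g x) has_field_derivative F' z - g z) (at z within {0..})" if "z \<in> {0..}" for z
        using that by (intro DERIV_diff Fd has_field_derivative_at_within[OF prim_has_derivative[OF g]]) auto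
      show "norm (F' z - g z) \<le> \<theta>" if "z \<in> {0..}" for z using gF[of z] clamp(1)[of "F' z"] that by simp
    qed (use x R(1) in auto)
    moreover have "F (R + 2) - prim g (R + 2) = 0" using Fr(2)[of "R + 2"] prim_right[OF cont_supp_imp_bdd_supp[OF g], of "R + 2"] by simp
    moreover have "\<theta> * norm (x - (R + 2)) \<le> \<theta> * (R + 2)" using \<theta>(1) True x by (intro mult_left_mono) auto
    ultimately show ?thesis by simp
  next
    case False
    then show ?thesis using Fr(2)[of x] prim_right[OF cont_supp_imp_bdd_supp[OF g], of x] \<theta>(1) R(1) by simp
  qed
  have fF: "\<bar>f x - F x\<bar> \<le> \<delta>" for x
  proof (cases "x \<le> R")
    case True then show ?thesis using Ff(2) \<delta> by simp
  next
    case False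
    have "\<bar>f x - F x\<bar> = \<bar>f x\<bar> * (1 - cutoff R x)"
      using cutoff_bounds(2)[of R x] abs_mult[of "f x" "1 - cutoff R x"] by (simp add: F_def right_diff_distrib)
    also have "\<dots> \<le> \<delta> * 1" using R(2)[of x] False cutoff_bounds[of R x] \<delta> by (intro mult_mono) auto
    finally show ?thesis by simp
  qed
  have fF': "\<bar>hderiv f x - F' x\<bar> \<le> 5 * \<delta>" for x
  proof (cases "x \<le> R")
    case True then show ?thesis using Ff(1) \<delta> by simp
  next
    case False
    have "\<bar>hderiv f x * (1 - cutoff R x)\<bar> \<le> \<delta> * 1"
      unfolding abs_mult using R(2)[of x] False cutoff_bounds[of R x] \<delta> by (intro mult_mono) auto
    moreover have "\<bar>f x * cutoff' R x\<bar> \<le> \<delta> * 4"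
      unfolding abs_mult using R(2)[of x] False cutoff_bounds[of R x] \<delta> by (intro mult_mono) auto
    moreover have "hderiv f x - F' x = hderiv f x * (1 - cutoff R x) - f x * cutoff' R x" by (simp add: F'_def algebra_simps)
    ultimately show ?thesis by linarith
  qed
  show ?thesis
  proof (rule that[OF a(1) _ g])
    show "a \<le> R + 1" using a R(1) by simp
    show "\<bar>f x - prim g x\<bar> \<le> e" if "0 \<le> x" for x
      using fF[of x] FP[OF that] \<theta>R \<delta> \<delta>_def by linarith
    show "\<bar>hderiv f x - g x\<bar> \<le> e" if "0 \<le> x" for x
      using fF'[of x] gF[OF that] clamp(1)[of "F' x"] \<theta>\<delta> \<delta>_def by linarith
    have "small_jump_norm (\<lambda>v. hderiv f v - g v)
      \<le> (\<integral>\<^sup>+v\<in>{0<..1}. ennreal (min \<bar>hderiv f v\<bar> \<theta>) * emeasure \<mu> {v..} \<partial>lborel)"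
    proof (rule nn_integral_mono)
      fix v :: real
      show "ennreal \<bar>hderiv f v - g v\<bar> * emeasure \<mu> {v..} * indicator {0<..1} v \<le> ennreal (min \<bar>hderiv f v\<bar> \<theta>) * emeasure \<mu> {v..} * indicator {0<..1} v"
      proof (cases "v \<in> {0<..1}")
        case True
        then have "\<bar>hderiv f v - g v\<bar> \<le> min \<bar>hderiv f v\<bar> \<theta>"
          using Ff(1)[of v] gF[of v] clamp(2)[of "hderiv f v"] R(1) by simp
        then show ?thesis by (intro mult_right_mono ennreal_leI) auto
      qed simp
    qed
    also have "\<dots> \<le> ennreal (\<delta> / (R + 2))" by (rule \<theta>(3))
    also have "\<dots> \<le> ennreal e" using \<delta>e by (rule ennreal_leI)
    finally show "small_jump_norm (\<lambda>v. hderiv f v - g v) \<le> ennreal e" .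
  qed
qed

text \<open>Integration by parts, by Fubini for \<open>g v\<close> on the set \<open>x < v \<le> y\<close>.\<close>

lemma prim_jump_integral:
  assumes g: "cont_supp a c g" and a: "0 < a" and x: "0 \<le> x"
  shows "(LINT y:{x<..}|\<mu>. (hprim g) y - (hprim g) x) = - prim (\<lambda>v. g v * tail v) x"
proof -
  interpret PP: pair_sigma_finite "lborel :: real measure" \<mu>
    by (intro pair_sigma_finite.intro sigma_finite_mu lborel.sigma_finite_measure_axioms)
  have bs: "bdd_supp a c g" by (rule cont_supp_imp_bdd_supp[OF g])
  then have gm[measurable]: "g \<in> borel_measurable borel" by (simp add: bdd_supp_def)
  obtain G where G: "G \<ge> 0" "\<And>x. \<bar>g x\<bar> \<le> G" using cont_supp_bounded[OF g] by blast
  have idm: "(\<lambda>y. y) \<in> borel_measurable \<mu>" by (intro measurable_mu_borel) simp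
  have [measurable]: "(\<lambda>p. snd p) \<in> borel_measurable (lborel \<Otimes>\<^sub>M \<mu>)"
    using measurable_compose[OF measurable_snd idm] .
  have [measurable]: "(\<lambda>p. fst p) \<in> borel_measurable (lborel \<Otimes>\<^sub>M \<mu>)"
    using measurable_fst by simp
  define k where "k v y = (if x < v \<and> v \<le> y then g v else 0)" for v y :: real
  have km: "(\<lambda>(v, y). k v y) \<in> borel_measurable (lborel \<Otimes>\<^sub>M \<mu>)"
    unfolding case_prod_beta k_def by measurable
  have as: "{a..} \<in> sets \<mu>" using a by (intro sets_muI) auto
  have int: "integrable (lborel \<Otimes>\<^sub>M \<mu>) (\<lambda>(v, y). k v y)"
  proof (rule integrableI_bounded_set[of "{a..c} \<times> {a..}" _ _ G])
    show "{a..c} \<times> {a..} \<in> sets (lborel \<Otimes>\<^sub>M \<mu>)" using as by (intro pair_measureI) auto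
    have "emeasure (lborel \<Otimes>\<^sub>M \<mu>) ({a..c} \<times> {a..}) = emeasure lborel {a..c} * emeasure \<mu> {a..}"
      using as by (intro sigma_finite_measure.emeasure_pair_measure_Times sigma_finite_mu) auto
    also have "\<dots> < \<infinity>" using a by (simp add: emeasure_tail ennreal_mult_less_top emeasure_lborel_Icc_eq)
    finally show "emeasure (lborel \<Otimes>\<^sub>M \<mu>) ({a..c} \<times> {a..}) < \<infinity>" .
    show "(\<lambda>(v, y). k v y) \<in> borel_measurable (lborel \<Otimes>\<^sub>M \<mu>)" by (rule km)
    show "AE p in lborel \<Otimes>\<^sub>M \<mu>. p \<in> {a..c} \<times> {a..} \<longrightarrow> norm (case p of (v, y) \<Rightarrow> k v y) \<le> G"
      by (intro AE_I2) (use G in \<open>simp add: case_prod_beta k_def\<close>)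
    show "AE p in lborel \<Otimes>\<^sub>M \<mu>. p \<notin> {a..c} \<times> {a..} \<longrightarrow> (case p of (v, y) \<Rightarrow> k v y) = 0"
    proof (intro AE_I2 impI)
      fix p :: "real \<times> real" assume "p \<notin> {a..c} \<times> {a..}"
      then have "fst p \<notin> {a..c} \<or> \<not> fst p \<le> snd p" by (cases p) auto
      then show "(case p of (v, y) \<Rightarrow> k v y) = 0" using g by (cases p) (auto simp: k_def cont_supp_def)
    qed
  qed
  have in1: "(\<integral>v. k v y \<partial>lborel) = indicator {x<..} y *\<^sub>R ((hprim g) y - (hprim g) x)" for y
  proof (cases "x < y")
    case True
    have "(\<integral>v. k v y \<partial>lborel) = (\<integral>v. indicator {x..<y} v * g v \<partial>lborel)"
    proof (rule integral_cong_AE)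
      show "AE v in lborel. k v y = indicator {x..<y} v * g v"
        using AE_lborel_singleton[of x] AE_lborel_singleton[of y]
        by eventually_elim (auto simp: k_def indicator_def)
    qed (simp_all add: k_def)
    then show ?thesis using True x prim_diff[OF bs, of x y] by simp
  next
    case False
    then have "k v y = 0" for v by (simp add: k_def)
    then show ?thesis using False by simp
  qed
  have in2: "(\<integral>y. k v y \<partial>\<mu>) = (if x < v then g v * tail v else 0)" for v
  proof (cases "x < v")
    case True
    then have vs: "{v..} \<in> sets \<mu>" using x by (intro sets_muI) auto
    have "(\<integral>y. k v y \<partial>\<mu>) = (\<integral>y. g v * indicator {v..} y \<partial>\<mu>)"
      using True by (intro Bochner_Integration.integral_cong) (auto simp: k_def indicator_def)
    also have "\<dots> = g v * tail v" using vs by (simp add: tail_def)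
    finally show ?thesis using True by simp
  qed (simp add: k_def)
  have "(LINT y:{x<..}|\<mu>. (hprim g) y - (hprim g) x) = (\<integral>y. (\<integral>v. k v y \<partial>lborel) \<partial>\<mu>)"
    unfolding set_lebesgue_integral_def in1 ..
  also have "\<dots> = (\<integral>v. (\<integral>y. k v y \<partial>\<mu>) \<partial>lborel)"
    by (rule PP.Fubini_integral[OF int])
  also have "\<dots> = (\<integral>v. indicator {x..} v * (g v * tail v) \<partial>lborel)"
    unfolding in2
  proof (rule integral_cong_AE)
    show "AE v in lborel. (if x < v then g v * tail v else 0) = indicator {x..} v * (g v * tail v)"
      using AE_lborel_singleton[of x] by eventually_elim (simp add: indicator_def)
  qed measurable
  finally show ?thesis by (simp add: prim_def)
qed

end

section \<open>The generator on D1 and its cores\<close>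

lemma linear_subspace_D0: "linear_subspace_C0 D0"
  unfolding linear_subspace_C0_def
proof (intro conjI ballI allI)
  show "D0 \<subseteq> C0" by (auto simp: D0_def C10_def)
  have z: "(\<lambda>x\<in>{0..}. 0) \<in> C10"
    by (rule C10_I[where f'="\<lambda>x. 0"])
       (auto simp: C0_def intro!: has_field_derivative_transform_within[OF DERIV_const, of 1] continuous_on_eq[OF continuous_on_const]
         tendsto_eventually eventually_mono[OF eventually_ge_at_top[of 0]])
  have "(\<lambda>x\<in>{0..}. 0 :: real) constant_on {0..1}" unfolding constant_on_def by (intro exI[of _ 0]) simp
  then show "(\<lambda>x\<in>{0..}. 0) \<in> D0"
    unfolding D0_def using z zero_less_one by blast
  fix f g and a c :: real assume f: "f \<in> D0" and g: "g \<in> D0"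
  obtain e1 k1 where e1: "e1 > 0" "\<And>x. x \<in> {0..e1} \<Longrightarrow> f x = k1" using f by (auto simp: D0_def constant_on_def)
  obtain e2 k2 where e2: "e2 > 0" "\<And>x. x \<in> {0..e2} \<Longrightarrow> g x = k2" using g by (auto simp: D0_def constant_on_def)
  have "(\<lambda>x\<in>{0..}. a * f x + c * g x) constant_on {0..min e1 e2}"
    unfolding constant_on_def using e1(2) e2(2) by (intro exI[of _ "a * k1 + c * k2"]) simp
  moreover have "min e1 e2 > 0" using e1 e2 by simp
  ultimately show "(\<lambda>x\<in>{0..}. a * f x + c * g x) \<in> D0"
    using C10_linear(1)[of f g a c] f g unfolding D0_def by blast
qed

context tail_measure
begin

lemma emeasure_weight_measurable:
  assumes "f \<in> C10"
  shows "(\<lambda>v. ennreal \<bar>hderiv f v\<bar> * emeasure \<mu> {v..} * indicator {0<..1} v) \<in> borel_measurable lborel"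
proof -
  note [measurable] = hderiv_measurable[OF assms]
  have "(\<lambda>v. ennreal (\<bar>indicator {0<..1} v * hderiv f v\<bar> * tail v)) \<in> borel_measurable lborel" by measurable
  also have "(\<lambda>v. ennreal (\<bar>indicator {0<..1} v * hderiv f v\<bar> * tail v)) = (\<lambda>v. ennreal \<bar>hderiv f v\<bar> * emeasure \<mu> {v..} * indicator {0<..1} v)"
    by (auto simp: fun_eq_iff indicator_def emeasure_tail ennreal_mult'' tail_nonneg)
  finally show ?thesis .
qed

lemma D1_linear:
  assumes f: "f \<in> D1 \<mu>" and g: "g \<in> D1 \<mu>"
  shows "(\<lambda>x\<in>{0..}. a * f x + c * g x) \<in> D1 \<mu>"
proof -
  let ?h = "\<lambda>x\<in>{0..}. a * f x + c * g x"
  have f10: "f \<in> C10" "g \<in> C10" using f g by (auto simp: D1_def)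
  note hd = C10_linear(2)[OF f10, of _ a c]
  let ?w = "\<lambda>f v. ennreal \<bar>hderiv f v\<bar> * emeasure \<mu> {v..} * indicator {0<..1} v"
  have "(\<integral>\<^sup>+v. ?w ?h v \<partial>lborel) \<le> (\<integral>\<^sup>+v. ennreal \<bar>a\<bar> * ?w f v + ennreal \<bar>c\<bar> * ?w g v \<partial>lborel)"
  proof (rule nn_integral_mono)
    fix v :: real
    show "?w ?h v \<le> ennreal \<bar>a\<bar> * ?w f v + ennreal \<bar>c\<bar> * ?w g v"
    proof (cases "v \<in> {0<..1}")
      case True
      have "\<bar>a * hderiv f v + c * hderiv g v\<bar> \<le> \<bar>a\<bar> * \<bar>hderiv f v\<bar> + \<bar>c\<bar> * \<bar>hderiv g v\<bar>"
        by (metis abs_mult abs_triangle_ineq)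
      then have "ennreal \<bar>hderiv ?h v\<bar> \<le> ennreal \<bar>a\<bar> * ennreal \<bar>hderiv f v\<bar> + ennreal \<bar>c\<bar> * ennreal \<bar>hderiv g v\<bar>"
        using True by (simp add: hd ennreal_leI flip: ennreal_mult ennreal_plus)
      then have "ennreal \<bar>hderiv ?h v\<bar> * emeasure \<mu> {v..} \<le> (ennreal \<bar>a\<bar> * ennreal \<bar>hderiv f v\<bar> + ennreal \<bar>c\<bar> * ennreal \<bar>hderiv g v\<bar>) * emeasure \<mu> {v..}"
        by (rule mult_right_mono) simp
      then show ?thesis using True by (simp add: distrib_right mult.assoc)
    qed simp
  qed
  also have "\<dots> = ennreal \<bar>a\<bar> * (\<integral>\<^sup>+v. ?w f v \<partial>lborel) + ennreal \<bar>c\<bar> * (\<integral>\<^sup>+v. ?w g v \<partial>lborel)"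
    using emeasure_weight_measurable[OF f10(1)] emeasure_weight_measurable[OF f10(2)]
    by (subst nn_integral_add) (simp_all add: nn_integral_cmult)
  also have "\<dots> < \<infinity>" using f g by (simp add: D1_def ennreal_mult_less_top)
  finally have fin: "(\<integral>\<^sup>+v. ?w ?h v \<partial>lborel) < \<infinity>" .
  have "hderiv ?h 0 = 0" using hd[of 0] f g by (simp add: D1_def)
  then show ?thesis using fin C10_linear(1)[OF f10, of a c] by (simp add: D1_def)
qed

lemma linear_subspace_D1: "linear_subspace_C0 (D1 \<mu>)"
  unfolding linear_subspace_C0_def
proof (intro conjI ballI allI D1_linear)
  show "D1 \<mu> \<subseteq> C0" by (auto simp: D1_def C10_def)
  show "(\<lambda>x\<in>{0..}. 0) \<in> D1 \<mu>"
    using D0_subset_D1 linear_subspace_D0 unfolding linear_subspace_C0_def by blast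
qed

end

context shot_noise
begin

definition esn_operator :: "(real \<Rightarrow> real) \<Rightarrow> real \<Rightarrow> real" where
  "esn_operator f = (\<lambda>x\<in>{0..}. (LINT y:{x<..}|\<mu>. f y - f x) - b * hderiv f x)"

lemma esn_operator_prim:
  assumes g: "cont_supp a c g" and a: "0 < a"
  shows "esn_operator (hprim g) = prim_operator g"
  unfolding esn_operator_def prim_operator_def using prim_jump_integral[OF g a] prim_in_D0(2)[OF g a] by (intro restrict_ext) simp

text \<open>The bound \<open>jump_integral_bound\<close>, applied to the difference of \<open>f\<close> and an approximating primitive.\<close>

lemma esn_operator_approx:
  assumes f: "f \<in> D1 \<mu>" and e: "0 < e"
  obtains a c g where "0 < a" "a \<le> c" "cont_supp a c g"
    "\<And>x. 0 \<le> x \<Longrightarrow> \<bar>prim g x - f x\<bar> \<le> e" "\<And>x. 0 \<le> x \<Longrightarrow> \<bar>prim_operator g x - esn_operator f x\<bar> \<le> e"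
proof -
  have f10: "f \<in> C10" using f by (simp add: D1_def)
  define K where "K = 2 * tail 1 + 1 + \<bar>b\<bar>"
  have K: "K \<ge> 1" using tail_nonneg[of 1] by (simp add: K_def)
  have eK: "0 < e / K" using e K by simp
  have eKe: "e / K \<le> e" using e K by (simp add: divide_le_eq mult_le_cancel_left1)
  obtain a c g where g: "0 < a" "a \<le> c" "cont_supp a c g"
    "\<And>x. 0 \<le> x \<Longrightarrow> \<bar>f x - prim g x\<bar> \<le> e / K" "\<And>x. 0 \<le> x \<Longrightarrow> \<bar>hderiv f x - g x\<bar> \<le> e / K"
    "small_jump_norm (\<lambda>v. hderiv f v - g v) \<le> ennreal (e / K)"
    using D1_approx[OF f eK] by blast
  let ?p = "hprim g"
  define d where "d = (\<lambda>x\<in>{0..}. 1 * f x + (- 1) * ?p x)"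
  have p0: "?p \<in> D0" by (rule prim_in_D0(1)[OF g(3,1)])
  then have p1: "?p \<in> D1 \<mu>" using D0_subset_D1 by blast
  have p10: "?p \<in> C10" using p0 by (simp add: D0_def)
  have d10: "d \<in> C10" unfolding d_def by (rule C10_linear(1)[OF f10 p10])
  have dh: "hderiv d x = hderiv f x - g x" if "0 \<le> x" for x
    unfolding d_def C10_linear(2)[OF f10 p10 that] prim_in_D0(2)[OF g(3,1) that] by simp
  have d1: "d \<in> D1 \<mu>" unfolding d_def by (rule D1_linear[OF f p1])
  have W: "small_jump_norm (hderiv d) \<le> ennreal (e / K)"
  proof -
    have "small_jump_norm (hderiv d)
      = small_jump_norm (\<lambda>v. hderiv f v - g v)"
      by (intro nn_integral_cong) (auto simp: indicator_def dh)
    then show ?thesis using g(6) by simp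
  qed
  have "\<bar>prim_operator g x - esn_operator f x\<bar> \<le> e" if x: "0 \<le> x" for x
  proof -
    have "(LINT y:{x<..}|\<mu>. d y - d x) = (LINT y:{x<..}|\<mu>. (f y - f x) - (?p y - ?p x))"
      unfolding set_lebesgue_integral_def using x
      by (intro Bochner_Integration.integral_cong) (auto simp: d_def indicator_def)
    also have "\<dots> = (LINT y:{x<..}|\<mu>. f y - f x) - (LINT y:{x<..}|\<mu>. ?p y - ?p x)"
      by (rule set_integral_diff(2)[OF jump_integrable[OF f x] jump_integrable[OF p1 x]])
    finally have eq: "(LINT y:{x<..}|\<mu>. d y - d x) = (LINT y:{x<..}|\<mu>. f y - f x) - (LINT y:{x<..}|\<mu>. ?p y - ?p x)" .
    have "\<bar>LINT y:{x<..}|\<mu>. d y - d x\<bar> \<le> 2 * (e / K) * tail 1 + e / K"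
    proof (rule jump_integral_bound[OF d10 x _ _ W jump_integrable[OF d1 x]])
      show "\<bar>d z\<bar> \<le> e / K" if "0 \<le> z" for z using g(4)[OF that] that by (simp add: d_def)
    qed (use eK in simp)
    moreover have "\<bar>b * (hderiv f x - g x)\<bar> \<le> \<bar>b\<bar> * (e / K)"
      unfolding abs_mult by (intro mult_left_mono g(5) x) simp
    moreover have "prim_operator g x - esn_operator f x = - (LINT y:{x<..}|\<mu>. d y - d x) + b * (hderiv f x - g x)"
      unfolding eq esn_operator_prim[OF g(3,1), symmetric] using x by (simp add: esn_operator_def prim_in_D0(2)[OF g(3,1)] algebra_simps)
    ultimately have "\<bar>prim_operator g x - esn_operator f x\<bar> \<le> 2 * (e / K) * tail 1 + e / K + \<bar>b\<bar> * (e / K)" by linarith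
    also have "\<dots> = K * (e / K)" unfolding K_def[symmetric] by (simp only: K_def distrib_right) simp
    also have "\<dots> = e" using K by simp
    finally show ?thesis .
  qed
  moreover have "\<bar>prim g x - f x\<bar> \<le> e" if "0 \<le> x" for x using g(4)[OF that] eKe by linarith
  ultimately show ?thesis using that[OF g(1,2,3)] by blast
qed

lemma esn_operator_C0:
  assumes f: "f \<in> D1 \<mu>"
  shows "esn_operator f \<in> C0"
proof (rule C0_uniform_closed)
  show "esn_operator f \<in> extensional {0..}" by (simp add: esn_operator_def)
  fix e :: real assume "0 < e"
  then obtain a c g where "0 < a" "cont_supp a c g" "\<And>x. 0 \<le> x \<Longrightarrow> \<bar>prim_operator g x - esn_operator f x\<bar> \<le> e" using esn_operator_approx[OF f] by metis
  then show "\<exists>g\<in>C0. \<forall>x\<ge>0. \<bar>esn_operator f x - g x\<bar> \<le> e"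
    using prim_operator_C0 by (intro bexI[of _ "prim_operator g"]) (auto simp: abs_minus_commute)
qed

lemma generator_D1:
  assumes f: "f \<in> D1 \<mu>"
  shows "is_generator_value P f (esn_operator f)"
proof (rule esn.generator_closed[OF _ esn_operator_C0[OF f]])
  show "f \<in> C0" using f by (simp add: D1_def C10_def)
  fix e :: real assume e: "0 < e"
  obtain a c g where g: "0 < a" "a \<le> c" "cont_supp a c g"
    "\<And>x. 0 \<le> x \<Longrightarrow> \<bar>prim g x - f x\<bar> \<le> e" "\<And>x. 0 \<le> x \<Longrightarrow> \<bar>prim_operator g x - esn_operator f x\<bar> \<le> e"
    using esn_operator_approx[OF f e] by blast
  show "\<exists>f' g'. f' \<in> C0 \<and> is_generator_value P f' g' \<and> (\<forall>x\<ge>0. \<bar>f' x - f x\<bar> \<le> e) \<and> (\<forall>x\<ge>0. \<bar>g' x - esn_operator f x\<bar> \<le> e)"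
    using g(4,5) by (intro exI[of _ "hprim g"] exI[of _ "prim_operator g"] conjI
      prim_C0[OF cont_supp_imp_bdd_supp[OF g(3)]] generator_prim[OF g(3,1,2)]) simp_all
qed

text \<open>The closure of the graph stays in the graph of the generator by closedness. Conversely, for \<open>f\<close> in
  the domain choose a primitive \<open>p\<close> with \<open>p - A p\<close> close to \<open>f - A f\<close>; dissipativity makes \<open>p\<close>
  close to \<open>f\<close>, hence \<open>A p\<close> close to \<open>A f\<close>.\<close>

lemma core_between_D0_D1:
  assumes D: "linear_subspace_C0 D" "D0 \<subseteq> D" "D \<subseteq> D1 \<mu>"
    and b: "0 \<le> b \<or> tail_diverges"
  shows "is_core P D"
proof -
  have dom: "D \<subseteq> gen_domain P"
    using D(3) generator_D1 unfolding gen_domain_def by (auto simp: D1_def C10_def)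
  have gC0: "f \<in> C0" "generator P f \<in> C0" if "f \<in> gen_domain P" for f
    using that generator_value[OF that] by (auto simp: gen_domain_def is_generator_value_def)
  have S: "gen_graph P D \<subseteq> C0 \<times> C0" using dom gC0 by (auto simp: gen_graph_def)
  have "(f, h) \<in> prod_topology C0_topology C0_topology closure_of gen_graph P D \<longleftrightarrow> (f, h) \<in> gen_graph P (gen_domain P)" for f h
  proof
    assume l: "(f, h) \<in> prod_topology C0_topology C0_topology closure_of gen_graph P D"
    then have fh: "f \<in> C0" "h \<in> C0" and app: "\<And>e. e > 0 \<Longrightarrow> \<exists>(f', g')\<in>gen_graph P D. (\<forall>x\<ge>0. \<bar>f' x - f x\<bar> \<le> e) \<and> (\<forall>x\<ge>0. \<bar>g' x - h x\<bar> \<le> e)"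
      by (simp_all add: in_closure_C0_iff[OF S])
    have "is_generator_value P f h"
    proof (rule esn.generator_closed[OF fh])
      fix e :: real assume "0 < e"
      then obtain f' where f': "f' \<in> D" "\<forall>x\<ge>0. \<bar>f' x - f x\<bar> \<le> e" "\<forall>x\<ge>0. \<bar>generator P f' x - h x\<bar> \<le> e"
        using app unfolding gen_graph_def by blast
      then have f'd: "f' \<in> gen_domain P" using dom by blast
      show "\<exists>f' g'. f' \<in> C0 \<and> is_generator_value P f' g' \<and> (\<forall>x\<ge>0. \<bar>f' x - f x\<bar> \<le> e) \<and> (\<forall>x\<ge>0. \<bar>g' x - h x\<bar> \<le> e)"
        using f'(2,3) gC0(1)[OF f'd] generator_value[OF f'd] by blast
    qed
    then show "(f, h) \<in> gen_graph P (gen_domain P)"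
      using fh unfolding gen_graph_def gen_domain_def by (auto simp: generator_eqI image_iff intro!: bexI[of _ f])
  next
    assume "(f, h) \<in> gen_graph P (gen_domain P)"
    then have f: "f \<in> gen_domain P" and h: "h = generator P f" by (auto simp: gen_graph_def)
    have v: "is_generator_value P f h" unfolding h by (rule generator_value[OF f])
    have fh: "f \<in> C0" "h \<in> C0" using gC0[OF f] by (auto simp: h)
    have "\<exists>(f', g')\<in>gen_graph P D. (\<forall>x\<ge>0. \<bar>f' x - f x\<bar> \<le> e) \<and> (\<forall>x\<ge>0. \<bar>g' x - h x\<bar> \<le> e)" if e: "e > 0" for e
    proof -
      have e2: "e / 2 > 0" using e by simp
      have target: "(\<lambda>x\<in>{0..}. 1 * f x + (- 1) * h x) \<in> C0" by (rule C0_linear[OF fh])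
      obtain a c g where g: "0 < a" "a \<le> c" "cont_supp a c g"
        "\<And>x. x \<ge> 0 \<Longrightarrow> \<bar>prim g x + prim (\<lambda>v. g v * tail v) x + b * g x - (\<lambda>x\<in>{0..}. 1 * f x + (- 1) * h x) x\<bar> \<le> e / 2"
        using range_dense[OF b target e2] by blast
      let ?p = "hprim g"
      have pC: "?p \<in> C0" by (rule prim_C0[OF cont_supp_imp_bdd_supp[OF g(3)]])
      have pv: "is_generator_value P ?p (prim_operator g)" by (rule generator_prim[OF g(3,1,2)])
      have pD: "?p \<in> D" using prim_in_D0(1)[OF g(3,1)] D(2) by blast
      have res: "\<bar>(prim g x - f x) - (prim_operator g x - h x)\<bar> \<le> e / 2" if "x \<ge> 0" for x
      proof -
        have "(prim g x - f x) - (prim_operator g x - h x) = prim g x + prim (\<lambda>v. g v * tail v) x + b * g x - (\<lambda>x\<in>{0..}. 1 * f x + (- 1) * h x) x"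
          using that by (simp add: prim_operator_def)
        then show ?thesis using g(4)[OF that] by (simp only:)
      qed
      have d: "\<bar>prim g x - f x\<bar> \<le> e / 2" if x: "x \<ge> 0" for x
      proof -
        have "\<bar>(\<lambda>x\<in>{0..}. 1 * ?p x + (- 1) * f x) x\<bar> \<le> e / 2"
        proof (rule esn.dissipative[OF C0_linear[OF pC fh(1)] esn.generator_value_linear[OF pv v pC fh(1)] _ x])
          fix z :: real assume "0 \<le> z"
          then show "\<bar>(\<lambda>x\<in>{0..}. 1 * ?p x + (- 1) * f x) z - (\<lambda>x\<in>{0..}. 1 * prim_operator g x + (- 1) * h x) z\<bar> \<le> e / 2"
            using res[of z] by simp
        qed
        then show ?thesis using x by simp
      qed
      have "\<bar>prim_operator g x - h x\<bar> \<le> e" if x: "x \<ge> 0" for x using d[OF x] res[OF x] by linarith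
      moreover have "\<bar>?p x - f x\<bar> \<le> e" if x: "x \<ge> 0" for x using d[OF x] x e by simp
      moreover have "(?p, prim_operator g) \<in> gen_graph P D"
        unfolding gen_graph_def using pD generator_eqI[OF pv] by (intro image_eqI[of _ _ ?p]) simp_all
      ultimately show ?thesis by (intro bexI[of _ "(?p, prim_operator g)"]) auto
    qed
    then show "(f, h) \<in> prod_topology C0_topology C0_topology closure_of gen_graph P D"
      using fh by (simp add: in_closure_C0_iff[OF S])
  qed
  then have "prod_topology C0_topology C0_topology closure_of gen_graph P D = gen_graph P (gen_domain P)" by (auto simp: set_eq_iff)
  then show ?thesis using D(1) dom by (simp add: is_core_def)
qed

end

theorem theorem2p2:
  fixes b :: real and \<mu> :: "real measure"
    and \<Omega> :: "'w measure" and \<xi> :: "'w \<Rightarrow> real \<Rightarrow> real"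
  assumes "sets \<mu> = sets (restrict_space borel {0<..})"
    and "\<And>x. x > 0 \<Longrightarrow> emeasure \<mu> {x..} < \<infinity>"
    and "prob_space \<Omega>"
    and "esn_noise \<Omega> \<mu> \<xi>"
  defines "P \<equiv> esn_semigroup \<Omega> b \<xi>"
  shows "D0 \<subseteq> D1 \<mu> \<and> D1 \<mu> \<subseteq> gen_domain P \<and>
    (\<forall>f\<in>D1 \<mu>. \<forall>x\<ge>0.
        set_integrable \<mu> {x<..} (\<lambda>y. f y - f x) \<and>
        generator P f x = (LINT y:{x<..}|\<mu>. f y - f x) - b * hderiv f x) \<and>
    (b > 0 \<longrightarrow> is_core P D0 \<and> is_core P (D1 \<mu>)) \<and>
    (b \<le> 0 \<and> (\<integral>\<^sup>+v\<in>{0<..1}. emeasure \<mu> {v..} \<partial>lborel) = \<infinity> \<longrightarrow> is_core P (D1 \<mu>))"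
proof -
  interpret prob_space \<Omega> by (rule assms(3))
  interpret shot_noise \<mu> \<Omega> b \<xi>
    by unfold_locales (fact assms)+
  have gen: "is_generator_value P f (esn_operator f)" if "f \<in> D1 \<mu>" for f
    unfolding P_def using generator_D1[OF that] .
  have "generator P f x = (LINT y:{x<..}|\<mu>. f y - f x) - b * hderiv f x" if "f \<in> D1 \<mu>" "0 \<le> x" for f x
    using generator_eqI[OF gen[OF that(1)]] that(2) by (simp add: esn_operator_def)
  moreover have "D1 \<mu> \<subseteq> gen_domain P" using gen by (auto simp: gen_domain_def D1_def C10_def)
  moreover have "is_core P D0" if "b > 0"
    unfolding P_def by (rule core_between_D0_D1[OF linear_subspace_D0 order_refl D0_subset_D1]) (use that in simp)
  moreover have "is_core P (D1 \<mu>)" if "b > 0 \<or> (\<integral>\<^sup>+v\<in>{0<..1}. emeasure \<mu> {v..} \<partial>lborel) = \<infinity>"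
    unfolding P_def by (rule core_between_D0_D1[OF linear_subspace_D1 D0_subset_D1 order_refl]) (use that in auto)
  ultimately show ?thesis using D0_subset_D1 jump_integrable by blast
qed

end
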